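(* Let $\alpha>\frac14$, $0<\delta<0.1$, $0<\epsilon<\delta$, $0<\xi<\epsilon^{-4}$, let $f,g$ be the traveling wave coefficients with $f(0)=g(0)=\epsilon$, and consider the (non-simplified) linearized Boussinesq equations at frequency $\xi$ in $y$, $$\partial_t\begin{pmatrix}Z\\Q\end{pmatrix}+A\begin{pmatrix}Z\\Q\end{pmatrix}=\begin{pmatrix}f(t)\Delta_t^{-1/4}(\cos(x)\,\partial_y\Delta_t^{-3/4}Z)\\ g(t)\Delta_t^{1/4}(\cos(x)\,\partial_y\Delta_t^{-3/4}Z)\end{pmatrix}+\frac{1}{1+t^2}\begin{pmatrix}f(t)\Delta_t^{-1/4}(\cos(x)\,\partial_y\Delta_t^{1/4}Z)\\ f(t)\Delta_t^{1/4}(\cos(x)\,\partial_y\Delta_t^{-1/4}Q)\end{pmatrix},$$ on the time interval $I_k=(t_k,t_{k-1})$ with $1\le k\le k_0$. Then there exist constants $C=C(\alpha)$ and $0<\gamma<\delta$ such that for all choices of data at time $t_k$ and all $t\in\overline{I_k}$ with $t\le\delta^2\epsilon^{-2}$ it holds that $$\|(Z,Q)(t)\|_{\ell^2}\le C\,\epsilon\Big(\frac{\xi}{k}\Big)^{1/2}\Big(\frac{\xi}{k^2}\Big)^{1/2+\gamma}\|(Z,Q)(t_k)\|_{\ell^2}.$$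
   Context: Times and indices: $t_0=2\xi$, $t_k=\frac12\big(\frac{\xi}{k+1}+\frac{\xi}{k}\big)$ for $k\ge1$, $k_0=\lfloor(\epsilon|\xi|)^{2/3}\rfloor$. Domain $\mathbb{T}\times\mathbb{R}$, $\mathbb{T}=\mathbb{R}/2\pi\mathbb{Z}$. The equations decouple with respect to the frequency $\xi$ in $y$ (so $\partial_y$ acts as $i\xi$). For fixed $\xi$, $(Z_l,Q_l)_{l\in\mathbb{Z}}$ are the Fourier modes in $x$, and $\|(Z,Q)\|_{\ell^2}^2=\sum_l(|Z_l|^2+|Q_l|^2)$. Operators are Fourier multipliers, with the following symbols at $x$-frequency $l$. $\Delta_t^s$, where $\Delta_t=\partial_x^2+(\partial_y-t\partial_x)^2$: $(l^2+(\xi-lt)^2)^s$. $L_t$: $\frac{l(\xi-lt)}{l^2+(\xi-lt)^2}$. $M_t=\partial_x\Delta_t^{-1/2}$: $\frac{l}{(l^2+(\xi-lt)^2)^{1/2}}$. Further, $$A=\begin{pmatrix}-\frac12L_t&\sqrt\alpha M_t\\-\sqrt\alpha M_t&\frac12L_t\end{pmatrix}.$$ Traveling wave coefficients: $f'=g$, $g'=-\alpha f/(1+t^2)$, $f(0)=g(0)=\epsilon$ (equivalently, $\omega=-1+f(t)\cos(x-ty)$, $\theta=\alpha y+g(t)\sin(x-ty)$ solve the nonlinear inviscid Boussinesq equations). *)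

theory Defs
  imports "HOL-Analysis.Analysis"
begin

text \<open>
  A function on the torus (at a fixed frequency \<open>\<xi>\<close> in \<open>y\<close>) is represented by its
  Fourier coefficients in \<open>x\<close>; a pair of time-dependent functions \<open>(Z, Q)\<close> by two
  curves \<open>real \<Rightarrow> modes\<close>.
\<close>

type_synonym modes = "int \<Rightarrow> complex"

definition tres :: "real \<Rightarrow> nat \<Rightarrow> real" where
  "tres \<xi> k = (if k = 0 then 2 * \<xi> else (\<xi> / (real k + 1) + \<xi> / real k) / 2)"

definition k0 :: "real \<Rightarrow> real \<Rightarrow> nat" where
  "k0 \<epsilon> \<xi> = nat \<lfloor>(\<epsilon> * \<bar>\<xi>\<bar>) powr (2 / 3)\<rfloor>"

definition wave_coefficients ::
  "real \<Rightarrow> real \<Rightarrow> (real \<Rightarrow> real) \<Rightarrow> (real \<Rightarrow> real) \<Rightarrow> bool" where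
  "wave_coefficients \<alpha> \<epsilon> f g \<longleftrightarrow>
     f 0 = \<epsilon> \<and> g 0 = \<epsilon> \<and>
     (\<forall>t\<ge>0. (f has_real_derivative g t) (at t within {0..}) \<and>
            (g has_real_derivative - \<alpha> * f t / (1 + t\<^sup>2)) (at t within {0..}))"


subsection \<open>Operators on the Fourier side\<close>

definition multiplier :: "(int \<Rightarrow> complex) \<Rightarrow> modes \<Rightarrow> modes" where
  "multiplier m u = (\<lambda>l. m l * u l)"

text \<open>
  The symbol of \<open>\<Delta>\<^sub>t\<close> is taken with a positive sign. It is positive for every \<open>l\<close>,
  including \<open>l = 0\<close>, as soon as \<open>\<xi> \<noteq> 0\<close>.
\<close>

definition Delta_symbol :: "real \<Rightarrow> real \<Rightarrow> int \<Rightarrow> real" where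
  "Delta_symbol \<xi> t l = (of_int l)\<^sup>2 + (\<xi> - of_int l * t)\<^sup>2"

definition Delta_pow :: "real \<Rightarrow> real \<Rightarrow> real \<Rightarrow> modes \<Rightarrow> modes" where
  "Delta_pow \<xi> t s = multiplier (\<lambda>l. of_real (Delta_symbol \<xi> t l powr s))"

definition L_op :: "real \<Rightarrow> real \<Rightarrow> modes \<Rightarrow> modes" where
  "L_op \<xi> t =
     multiplier (\<lambda>l. of_real (of_int l * (\<xi> - of_int l * t) / Delta_symbol \<xi> t l))"

text \<open>The symbol of \<open>M\<^sub>t\<close> is real by convention: there is no factor \<open>\<i>\<close> from \<open>\<partial>\<^sub>x\<close>.\<close>

definition M_op :: "real \<Rightarrow> real \<Rightarrow> modes \<Rightarrow> modes" where
  "M_op \<xi> t = multiplier (\<lambda>l. of_real (of_int l / Delta_symbol \<xi> t l powr (1 / 2)))"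

definition dy :: "real \<Rightarrow> modes \<Rightarrow> modes" where
  "dy \<xi> = multiplier (\<lambda>l. \<i> * of_real \<xi>)"

text \<open>Multiplication by \<open>cos x = (e\<^sup>i\<^sup>x + e\<^sup>-\<^sup>i\<^sup>x) / 2\<close> averages the two neighbouring modes.\<close>

definition cos_mult :: "modes \<Rightarrow> modes" where
  "cos_mult u = (\<lambda>l. (u (l - 1) + u (l + 1)) / 2)"


subsection \<open>The linearized Boussinesq equations\<close>

definition A1 :: "real \<Rightarrow> real \<Rightarrow> real \<Rightarrow> modes \<Rightarrow> modes \<Rightarrow> modes" where
  "A1 \<alpha> \<xi> t Z Q =
     (\<lambda>l. - (1 / 2) * L_op \<xi> t Z l + of_real (sqrt \<alpha>) * M_op \<xi> t Q l)"

definition A2 :: "real \<Rightarrow> real \<Rightarrow> real \<Rightarrow> modes \<Rightarrow> modes \<Rightarrow> modes" where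
  "A2 \<alpha> \<xi> t Z Q =
     (\<lambda>l. - of_real (sqrt \<alpha>) * M_op \<xi> t Z l + (1 / 2) * L_op \<xi> t Q l)"

definition rhs1 ::
  "(real \<Rightarrow> real) \<Rightarrow> (real \<Rightarrow> real) \<Rightarrow> real \<Rightarrow> real \<Rightarrow> modes \<Rightarrow> modes \<Rightarrow> modes" where
  "rhs1 f g \<xi> t Z Q = (\<lambda>l.
     of_real (f t) * Delta_pow \<xi> t (-1/4) (cos_mult (dy \<xi> (Delta_pow \<xi> t (-3/4) Z))) l
     + of_real (1 / (1 + t\<^sup>2)) *
       (of_real (f t) * Delta_pow \<xi> t (-1/4) (cos_mult (dy \<xi> (Delta_pow \<xi> t (1/4) Z))) l))"

definition rhs2 ::
  "(real \<Rightarrow> real) \<Rightarrow> (real \<Rightarrow> real) \<Rightarrow> real \<Rightarrow> real \<Rightarrow> modes \<Rightarrow> modes \<Rightarrow> modes" where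
  "rhs2 f g \<xi> t Z Q = (\<lambda>l.
     of_real (g t) * Delta_pow \<xi> t (1/4) (cos_mult (dy \<xi> (Delta_pow \<xi> t (-3/4) Z))) l
     + of_real (1 / (1 + t\<^sup>2)) *
       (of_real (f t) * Delta_pow \<xi> t (1/4) (cos_mult (dy \<xi> (Delta_pow \<xi> t (-1/4) Q))) l))"

definition in_l2 :: "modes \<Rightarrow> modes \<Rightarrow> bool" where
  "in_l2 Z Q \<longleftrightarrow> (\<lambda>l. (cmod (Z l))\<^sup>2 + (cmod (Q l))\<^sup>2) summable_on UNIV"

definition l2_norm :: "modes \<Rightarrow> modes \<Rightarrow> real" where
  "l2_norm Z Q = sqrt (\<Sum>\<^sub>\<infinity>l. (cmod (Z l))\<^sup>2 + (cmod (Q l))\<^sup>2)"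

text \<open>
  A solution on \<open>(a, b)\<close> is a curve that is continuous on \<open>[a, b]\<close> with values in \<open>\<ell>\<^sup>2\<close> and
  satisfies the equations mode by mode on \<open>(a, b)\<close>. For \<open>\<xi> \<noteq> 0\<close> all operators involved are
  bounded on \<open>\<ell>\<^sup>2\<close>, so the mode-wise and the \<open>\<ell>\<^sup>2\<close>-valued derivative amount to the same.
\<close>

definition boussinesq_solution ::
  "real \<Rightarrow> (real \<Rightarrow> real) \<Rightarrow> (real \<Rightarrow> real) \<Rightarrow> real \<Rightarrow> real \<Rightarrow> real \<Rightarrow>
   (real \<Rightarrow> modes) \<Rightarrow> (real \<Rightarrow> modes) \<Rightarrow> bool" where
  "boussinesq_solution \<alpha> f g \<xi> a b Z Q \<longleftrightarrow>
     (\<forall>t\<in>{a..b}. in_l2 (Z t) (Q t)) \<and>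
     (\<forall>t\<in>{a..b}. ((\<lambda>s. l2_norm (\<lambda>l. Z s l - Z t l) (\<lambda>l. Q s l - Q t l)) \<longlongrightarrow> 0)
                   (at t within {a..b})) \<and>
     (\<forall>t\<in>{a<..<b}. \<forall>l. \<exists>Z' Q'.
        ((\<lambda>s. Z s l) has_vector_derivative Z') (at t) \<and>
        ((\<lambda>s. Q s l) has_vector_derivative Q') (at t) \<and>
        Z' + A1 \<alpha> \<xi> t (Z t) (Q t) l = rhs1 f g \<xi> t (Z t) (Q t) l \<and>
        Q' + A2 \<alpha> \<xi> t (Z t) (Q t) l = rhs2 f g \<xi> t (Z t) (Q t) l)"

end

theory Submission
  imports Defs
begin

text \<open>
  Near the time \<open>\<xi> / k\<close> only the mode \<open>k\<close> is resonant, and the only coupling that is not integrable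
  to \<open>O(1)\<close> is the one from \<open>Z\<^sub>k\<close> to the modes \<open>k \<plusminus> 1\<close>, of total size
  \<open>X = \<epsilon> \<xi> k\<^sup>-\<^sup>3\<^sup>/\<^sup>2 \<ge> 1\<close>. In the rescaled variable \<open>\<Delta>\<^sub>k\<^sup>-\<^sup>1\<^sup>/\<^sup>4 Q\<^sub>k\<close> the equation for \<open>Q\<^sub>k\<close>
  loses its diagonal term, so this coupling is, up to integrable errors, a time derivative: subtracting
  a multiple (of size \<open>X\<close>) of \<open>i \<Delta>\<^sub>k\<^sup>-\<^sup>1\<^sup>/\<^sup>4 Q\<^sub>k\<close> from \<open>Z\<^sub>k\<^sub>\<plusminus>\<^sub>1\<close> and \<open>Q\<^sub>k\<^sub>\<plusminus>\<^sub>1\<close> removes it. The price is an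
  additional term in the equation for \<open>Z\<^sub>k\<close>, which merely replaces \<open>\<alpha>\<close> by \<open>\<alpha> + d\<close> with a slowly
  varying \<open>d \<ge> 0\<close>. Since \<open>\<alpha> > 1/4\<close>, the resonant block has the positive definite energy
  \<open>|Z\<^sub>k|\<^sup>2 + (1 + d / \<alpha>) |Q\<^sub>k|\<^sup>2 - \<alpha>\<^sup>-\<^sup>1\<^sup>/\<^sup>2 L M\<^sup>-\<^sup>1 Re (Z\<^sub>k Q\<^sub>k\<^sup>*)\<close>, whose derivative only contains
  integrable terms. Hence the shifted unknowns stay bounded by a constant depending on \<open>\<alpha>\<close>, and
  undoing the shift costs the factor \<open>X\<close>; the exponent \<open>\<gamma>\<close> is not used up at all.
\<close>

subsection \<open>Gronwall estimates and square-summable curves\<close>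

text \<open>Sizes, with \<eta> = \<xi> / k and \<tau> = t - \<eta>: the restriction on t gives
  \<epsilon>^2 \<eta> \<le> 1/75, so f = O(1) and g = O(1/\<eta>) on the whole interval, and k \<le>
  k_0 then forces \<eta> \<ge> 75 k. Couplings between nonresonant modes are O(k/\<eta>), which is
  integrable because the interval has length O(\<eta>/k). Next to the resonance the rate is
  (k/\<eta>)^(1/2) (1 + \<tau>^2)^(-1/4), whose integral is O(1) too. The obstacle is that a direct
  Gronwall estimate would exponentiate X. The shift turns X into a linear factor, and this factor is
  paid only once: t_k lies at a distance of order \<eta>/k from the resonance, where the shift is
  O(1). The condition \<alpha> > 1/4 enters twice with the same constant 1/(2 sqrt \<alpha>) < 1: in
  the resonant energy, and before that in the wave coefficients, where f'' = -\<alpha> f / (1 + t^2)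
  is asymptotically an Euler equation with exponents of real part 1/2. Hence f grows like t^(1/2)
  and g decays like t^(-1/2).\<close>

lemma at_within_Icc_at_real: "a < t \<Longrightarrow> t < b \<Longrightarrow> at t within {a..b} = at (t::real)"
  by (rule at_within_interior) auto

lemma gronwall_exp:
  fixes S R r :: "real \<Rightarrow> real"
  assumes ab: "a \<le> b"
    and S: "\<And>t. t \<in> {a..b} \<Longrightarrow> S t \<le> S a + integral {a..t} (\<lambda>s. r s * S s)"
    and S_cont: "continuous_on {a..b} S" and r_cont: "continuous_on {a..b} r"
    and r_nonneg: "\<And>t. t \<in> {a..b} \<Longrightarrow> 0 \<le> r t"
    and R: "\<And>t. t \<in> {a..b} \<Longrightarrow> (R has_real_derivative r t) (at t within {a..b})"
  shows "S b \<le> exp (R b - R a) * S a"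
proof -
  define H where "H = (\<lambda>t. integral {a..t} (\<lambda>s. r s * S s))"
  have H: "(H has_real_derivative r t * S t) (at t within {a..b})" if "t \<in> {a..b}" for t
    unfolding H_def using that
    by (intro integral_has_real_derivative continuous_intros S_cont r_cont)
  define V where "V = (\<lambda>t. (S a + H t) * exp (- R t))"
  have V: "(V has_real_derivative (r t * S t - r t * (S a + H t)) * exp (- R t)) (at t within {a..b})"
    if "t \<in> {a..b}" for t
    unfolding V_def
    by (rule derivative_eq_intros H[OF that] R[OF that] refl | simp add: algebra_simps)+
  have "V b \<le> V a"
  proof (rule DERIV_nonpos_imp_decreasing_open[OF ab])
    fix t assume t: "a < t" "t < b"
    have "r t * S t \<le> r t * (S a + H t)"
      using S[of t] r_nonneg[of t] t by (intro mult_left_mono) (auto simp: H_def)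
    then have "(r t * S t - r t * (S a + H t)) * exp (- R t) \<le> 0"
      by (simp add: mult_le_0_iff)
    then show "\<exists>y. (V has_real_derivative y) (at t) \<and> y \<le> 0"
      using V[of t] t by (auto simp: at_within_Icc_at_real)
  next
    show "continuous_on {a..b} V"
      using V by (rule DERIV_continuous_on)
  qed
  then have "(S a + H b) * exp (- R b) * exp (R b) \<le> S a * exp (- R a) * exp (R b)"
    by (intro mult_right_mono) (auto simp: V_def H_def)
  then have "S a + H b \<le> exp (R b - R a) * S a"
    by (simp add: mult.assoc exp_diff exp_minus flip: exp_add) (simp add: field_simps)
  with S[of b] ab show ?thesis
    by (simp add: H_def)
qed

text \<open>Only finite partial sums are differentiated. Each of the five translates of a finite
  index set is again finite, so it contributes at most the full sum \<open>S\<close>; this gives the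
  factor 5. The supremum over finite sets is taken after integrating in time.\<close>

lemma gronwall_lattice_sum:
  fixes e e' :: "int \<Rightarrow> real \<Rightarrow> real" and R r :: "real \<Rightarrow> real"
  assumes ab: "a \<le> b"
    and cont: "\<And>l. continuous_on {a..b} (e l)"
    and deriv: "\<And>l t. a < t \<Longrightarrow> t < b \<Longrightarrow> (e l has_real_derivative e' l t) (at t)"
    and bound: "\<And>l t. a < t \<Longrightarrow> t < b \<Longrightarrow> e' l t \<le> r t * (\<Sum>j\<in>{-2..2}. e (l + j) t)"
    and nonneg: "\<And>l t. t \<in> {a..b} \<Longrightarrow> 0 \<le> e l t" "\<And>t. t \<in> {a..b} \<Longrightarrow> 0 \<le> r t"
    and summable: "\<And>t. t \<in> {a..b} \<Longrightarrow> (\<lambda>l. e l t) summable_on UNIV"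
    and S_cont: "continuous_on {a..b} (\<lambda>t. \<Sum>\<^sub>\<infinity>l. e l t)" and r_cont: "continuous_on {a..b} r"
    and R: "\<And>t. t \<in> {a..b} \<Longrightarrow> (R has_real_derivative r t) (at t within {a..b})"
  shows "(\<Sum>\<^sub>\<infinity>l. e l b) \<le> exp (5 * (R b - R a)) * (\<Sum>\<^sub>\<infinity>l. e l a)"
proof -
  define S where "S = (\<lambda>t. \<Sum>\<^sub>\<infinity>l. e l t)"
  define r5 where "r5 = (\<lambda>t. 5 * r t)"
  have r5_cont: "continuous_on {a..b} r5"
    unfolding r5_def by (intro continuous_intros r_cont)
  have S_cont': "continuous_on {a..b} S"
    using S_cont by (simp add: S_def)
  have partial: "sum (\<lambda>l. e l s) F \<le> S s" if "finite F" "s \<in> {a..b}" for F s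
    unfolding S_def using that by (intro finite_sum_le_infsum summable nonneg) auto
  have S_le: "S t \<le> S a + integral {a..t} (\<lambda>s. r5 s * S s)" if t: "t \<in> {a..b}" for t
  proof -
    have "(\<Sum>\<^sub>\<infinity>l. e l t) \<le> S a + integral {a..t} (\<lambda>s. r5 s * S s)"
    proof (rule infsum_le_finite_sums)
      fix F :: "int set" assume F: "finite F"
      \<comment> \<open>The integral already contains the full sum \<open>S\<close> and not the
        partial one, since the neighbours of modes in \<open>F\<close> may lie outside
        \<open>F\<close>.\<close>
      define G where "G = (\<lambda>s. (\<Sum>l\<in>F. e l s) - integral {a..s} (\<lambda>s. r5 s * S s))"
      have int: "((\<lambda>s. integral {a..s} (\<lambda>s. r5 s * S s)) has_real_derivative r5 s * S s)
          (at s within {a..b})" if "s \<in> {a..b}" for s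
        using that by (intro integral_has_real_derivative continuous_intros S_cont' r5_cont)
      have "G t \<le> G a"
      proof (rule DERIV_nonpos_imp_decreasing_open[where f = G])
        fix s assume s: "a < s" "s < t"
        then have s': "s \<in> {a..b}" "s < b" using t by auto
        have "(G has_real_derivative (\<Sum>l\<in>F. e' l s) - r5 s * S s) (at s)"
          unfolding G_def using int[OF s'(1)] s s'
          by (intro derivative_intros deriv) (auto simp: at_within_Icc_at_real)
        moreover have "(\<Sum>l\<in>F. e' l s) \<le> r5 s * S s"
        proof -
          have "(\<Sum>l\<in>F. e' l s) \<le> (\<Sum>l\<in>F. r s * (\<Sum>j\<in>{-2..2}. e (l + j) s))"
            using s s' by (intro sum_mono bound) auto
          also have "\<dots> = r s * (\<Sum>j\<in>{-2..2}. \<Sum>l\<in>F. e (l + j) s)"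
            by (simp flip: sum_distrib_left add: sum.swap[of _ "{-2..2}"])
          also have "(\<Sum>j\<in>{-2..2}. \<Sum>l\<in>F. e (l + j) s) \<le> (\<Sum>j\<in>{-2..2::int}. S s)"
          proof (rule sum_mono)
            fix j :: int
            have "(\<Sum>l\<in>F. e (l + j) s) = sum (\<lambda>l. e l s) ((\<lambda>l. l + j) ` F)"
              by (simp add: sum.reindex inj_on_def)
            also have "\<dots> \<le> S s"
              using F s' by (intro partial) auto
            finally show "(\<Sum>l\<in>F. e (l + j) s) \<le> S s" .
          qed
          then have "r s * (\<Sum>j\<in>{-2..2}. \<Sum>l\<in>F. e (l + j) s) \<le> r s * (\<Sum>j\<in>{-2..2::int}. S s)"
            using nonneg(2)[OF s'(1)] by (rule mult_left_mono)
          finally show ?thesis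
            by (simp add: r5_def)
        qed
        ultimately show "\<exists>y. (G has_real_derivative y) (at s) \<and> y \<le> 0"
          by force
      next
        have "continuous_on {a..b} (\<lambda>s. integral {a..s} (\<lambda>s. r5 s * S s))"
          using int by (rule DERIV_continuous_on)
        then have "continuous_on {a..b} G"
          unfolding G_def by (intro continuous_intros cont)
        then show "continuous_on {a..t} G"
          by (rule continuous_on_subset) (use t in auto)
      qed (use t in auto)
      then have "(\<Sum>l\<in>F. e l t) \<le> (\<Sum>l\<in>F. e l a) + integral {a..t} (\<lambda>s. r5 s * S s)"
        by (simp add: G_def)
      with partial[OF F, of a] ab
      show "(\<Sum>l\<in>F. e l t) \<le> S a + integral {a..t} (\<lambda>s. r5 s * S s)"
        by simp
    qed (use t summable in auto)
    then show ?thesis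
      by (simp add: S_def)
  qed
  have "S b \<le> exp ((\<lambda>t. 5 * R t) b - (\<lambda>t. 5 * R t) a) * S a"
  proof (rule gronwall_exp[where r = r5])
    show "((\<lambda>t. 5 * R t) has_real_derivative r5 t) (at t within {a..b})" if "t \<in> {a..b}" for t
      unfolding r5_def using R[OF that] by (rule DERIV_cmult)
  qed (use ab S_le S_cont' r5_cont nonneg(2) in \<open>auto simp: r5_def\<close>)
  then show ?thesis
    by (simp add: S_def algebra_simps)
qed

section \<open>The norm on square-summable pairs and continuity of curves\<close>

lemma norm_pair_sq: "(norm (z, q))\<^sup>2 = (norm z)\<^sup>2 + (norm q)\<^sup>2"
  by (simp add: norm_Pair)

lemma in_l2_diff:
  assumes "in_l2 Z Q" "in_l2 Z' Q'"
  shows "in_l2 (\<lambda>l. Z l - Z' l) (\<lambda>l. Q l - Q' l)"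
proof -
  have sq: "(cmod (u - v))\<^sup>2 \<le> 2 * (cmod u)\<^sup>2 + 2 * (cmod v)\<^sup>2" for u v
  proof -
    have "(cmod (u - v))\<^sup>2 \<le> (cmod u + cmod v)\<^sup>2"
      by (intro power_mono norm_triangle_ineq4) auto
    also have "\<dots> \<le> 2 * (cmod u)\<^sup>2 + 2 * (cmod v)\<^sup>2"
      using sum_squares_ge_zero[of "cmod u - cmod v" 0] by (simp add: power2_eq_square algebra_simps)
    finally show ?thesis .
  qed
  have "(\<lambda>l. 2 * ((cmod (Z l))\<^sup>2 + (cmod (Q l))\<^sup>2) + 2 * ((cmod (Z' l))\<^sup>2 + (cmod (Q' l))\<^sup>2))
      summable_on UNIV"
    using assms unfolding in_l2_def
    by (rule summable_on_add[OF summable_on_cmult_right summable_on_cmult_right])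
  then show ?thesis
    unfolding in_l2_def[of "\<lambda>l. Z l - Z' l"]
  proof (rule summable_on_comparison_test)
    fix l
    show "(cmod (Z l - Z' l))\<^sup>2 + (cmod (Q l - Q' l))\<^sup>2 \<le>
      2 * ((cmod (Z l))\<^sup>2 + (cmod (Q l))\<^sup>2) + 2 * ((cmod (Z' l))\<^sup>2 + (cmod (Q' l))\<^sup>2)"
      using sq[of "Z l" "Z' l"] sq[of "Q l" "Q' l"] by simp
  qed auto
qed

lemma l2_norm_nonneg: "0 \<le> l2_norm Z Q"
  unfolding l2_norm_def by (simp add: infsum_nonneg)

lemma l2_norm_sq: "(l2_norm Z Q)\<^sup>2 = (\<Sum>\<^sub>\<infinity>l. (cmod (Z l))\<^sup>2 + (cmod (Q l))\<^sup>2)"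
  unfolding l2_norm_def by (simp add: infsum_nonneg)

lemma L2_set_le_l2_norm:
  assumes "in_l2 Z Q" "finite F"
  shows "L2_set (\<lambda>l. norm (Z l, Q l)) F \<le> l2_norm Z Q"
  unfolding L2_set_def l2_norm_def norm_pair_sq using assms
  by (intro real_sqrt_le_mono finite_sum_le_infsum) (auto simp: in_l2_def)

text \<open>Minkowski's inequality for finite sections, with each mode regarded as a vector (Z_l,
  Q_l) in a product space, followed by a supremum.\<close>

lemma l2_norm_triangle:
  assumes "in_l2 Z Q" "in_l2 Z' Q'"
  shows "l2_norm Z Q \<le> l2_norm (\<lambda>l. Z l - Z' l) (\<lambda>l. Q l - Q' l) + l2_norm Z' Q'"
    (is "_ \<le> ?n + _")
proof -
  have "(\<Sum>\<^sub>\<infinity>l. (cmod (Z l))\<^sup>2 + (cmod (Q l))\<^sup>2) \<le> (?n + l2_norm Z' Q')\<^sup>2"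
  proof (rule infsum_le_finite_sums)
    fix F :: "int set" assume F: "finite F"
    have "L2_set (\<lambda>l. norm (Z l, Q l)) F
        \<le> L2_set (\<lambda>l. norm (Z l - Z' l, Q l - Q' l) + norm (Z' l, Q' l)) F"
    proof (rule L2_set_mono)
      show "norm (Z l, Q l) \<le> norm (Z l - Z' l, Q l - Q' l) + norm (Z' l, Q' l)" for l
        using norm_triangle_ineq[of "(Z l - Z' l, Q l - Q' l)" "(Z' l, Q' l)"] by simp
    qed auto
    also have "\<dots> \<le> L2_set (\<lambda>l. norm (Z l - Z' l, Q l - Q' l)) F + L2_set (\<lambda>l. norm (Z' l, Q' l)) F"
      by (rule L2_set_triangle_ineq)
    also have "\<dots> \<le> ?n + l2_norm Z' Q'"
      using assms F by (intro add_mono L2_set_le_l2_norm in_l2_diff)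
    finally have "(L2_set (\<lambda>l. norm (Z l, Q l)) F)\<^sup>2 \<le> (?n + l2_norm Z' Q')\<^sup>2"
      by (intro power_mono) auto
    then show "(\<Sum>l\<in>F. (cmod (Z l))\<^sup>2 + (cmod (Q l))\<^sup>2) \<le> (?n + l2_norm Z' Q')\<^sup>2"
      by (simp add: L2_set_def norm_pair_sq sum_nonneg)
  qed (use assms in \<open>auto simp: in_l2_def\<close>)
  then have "(l2_norm Z Q)\<^sup>2 \<le> (?n + l2_norm Z' Q')\<^sup>2"
    by (simp only: l2_norm_sq)
  then show ?thesis
    by (rule power2_le_imp_le) (simp add: l2_norm_nonneg)
qed

lemma l2_norm_minus_commute:
  "l2_norm (\<lambda>l. Z l - Z' l) (\<lambda>l. Q l - Q' l) = l2_norm (\<lambda>l. Z' l - Z l) (\<lambda>l. Q' l - Q l)"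
  by (simp add: l2_norm_def norm_minus_commute)

lemma norm_mode_le_l2_norm:
  assumes "in_l2 Z Q"
  shows "cmod (Z l) \<le> l2_norm Z Q" "cmod (Q l) \<le> l2_norm Z Q"
  using L2_set_le_l2_norm[OF assms, of "{l}"] norm_fst_le[of "Z l" "Q l"] norm_snd_le[of "Q l" "Z l"]
  by (auto simp: L2_set_def)

text \<open>The reverse triangle inequality controls the norm, and a single mode is dominated by the
  norm. Continuity of the norm is what later makes the infinite sum of energies continuous.\<close>

lemma continuous_on_l2_curve:
  assumes l2: "\<And>t. t \<in> I \<Longrightarrow> in_l2 (Z t) (Q t)"
    and cont: "\<And>t. t \<in> I \<Longrightarrow>
      ((\<lambda>s. l2_norm (\<lambda>l. Z s l - Z t l) (\<lambda>l. Q s l - Q t l)) \<longlongrightarrow> 0) (at t within I)"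
  shows "continuous_on I (\<lambda>t. l2_norm (Z t) (Q t))"
    and "continuous_on I (\<lambda>t. Z t l)" and "continuous_on I (\<lambda>t. Q t l)"
proof -
  show "continuous_on I (\<lambda>t. l2_norm (Z t) (Q t))"
    unfolding continuous_on_def
  proof
    fix t assume t: "t \<in> I"
    have "\<bar>l2_norm (Z s) (Q s) - l2_norm (Z t) (Q t)\<bar>
        \<le> l2_norm (\<lambda>l. Z s l - Z t l) (\<lambda>l. Q s l - Q t l)" if "s \<in> I" for s
      using l2_norm_triangle[OF l2[OF that] l2[OF t]] l2_norm_triangle[OF l2[OF t] l2[OF that]]
      by (simp add: l2_norm_minus_commute[of "Z t"])
    then have "\<forall>\<^sub>F s in at t within I. norm (l2_norm (Z s) (Q s) - l2_norm (Z t) (Q t))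
        \<le> l2_norm (\<lambda>l. Z s l - Z t l) (\<lambda>l. Q s l - Q t l)"
      by (auto simp: eventually_at_filter)
    then have "((\<lambda>s. l2_norm (Z s) (Q s) - l2_norm (Z t) (Q t)) \<longlongrightarrow> 0) (at t within I)"
      using cont[OF t] by (rule Lim_null_comparison)
    then show "((\<lambda>t. l2_norm (Z t) (Q t)) \<longlongrightarrow> l2_norm (Z t) (Q t)) (at t within I)"
      by (simp add: LIM_zero_iff)
  qed
  have diff: "cmod (Z s l - Z t l) \<le> l2_norm (\<lambda>l. Z s l - Z t l) (\<lambda>l. Q s l - Q t l)"
    "cmod (Q s l - Q t l) \<le> l2_norm (\<lambda>l. Z s l - Z t l) (\<lambda>l. Q s l - Q t l)"
    if "s \<in> I" "t \<in> I" for s t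
    using norm_mode_le_l2_norm[OF in_l2_diff[OF l2[OF that(1)] l2[OF that(2)]], of l] by auto
  show "continuous_on I (\<lambda>t. Z t l)"
    unfolding continuous_on_def
  proof
    fix t assume t: "t \<in> I"
    have "\<forall>\<^sub>F s in at t within I. norm (Z s l - Z t l)
        \<le> l2_norm (\<lambda>l. Z s l - Z t l) (\<lambda>l. Q s l - Q t l)"
      using diff t by (auto simp: eventually_at_filter)
    from Lim_null_comparison[OF this cont[OF t]]
    show "((\<lambda>t. Z t l) \<longlongrightarrow> Z t l) (at t within I)"
      by (simp add: LIM_zero_iff)
  qed
  show "continuous_on I (\<lambda>t. Q t l)"
    unfolding continuous_on_def
  proof
    fix t assume t: "t \<in> I"
    have "\<forall>\<^sub>F s in at t within I. norm (Q s l - Q t l)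
        \<le> l2_norm (\<lambda>l. Z s l - Z t l) (\<lambda>l. Q s l - Q t l)"
      using diff t by (auto simp: eventually_at_filter)
    from Lim_null_comparison[OF this cont[OF t]]
    show "((\<lambda>t. Q t l) \<longlongrightarrow> Q t l) (at t within I)"
      by (simp add: LIM_zero_iff)
  qed
qed

text \<open>The mode energies differ from |Z_l|^2 + |Q_l|^2 only for l = k - 1, k, k + 1, so
  summability and continuity of their sum are inherited through this correction formula.\<close>

lemma infsum_finite_change:
  fixes u v :: "'a \<Rightarrow> real"
  assumes v: "v summable_on UNIV" and F: "finite F" and eq: "\<And>l. l \<notin> F \<Longrightarrow> u l = v l"
  shows "u summable_on UNIV" "infsum u UNIV = infsum v UNIV + (\<Sum>l\<in>F. u l - v l)"
proof -
  have u: "u = (\<lambda>l. v l + (if l \<in> F then u l - v l else 0))"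
    using eq by fastforce
  have "((\<lambda>l. if l \<in> F then u l - v l else 0) has_sum (\<Sum>l\<in>F. u l - v l)) UNIV"
    using has_sum_finite[OF F, of "\<lambda>l. u l - v l"]
    by (rule has_sum_cong_neutral[THEN iffD1, rotated -1]) auto
  with v have "((\<lambda>l. v l + (if l \<in> F then u l - v l else 0)) has_sum
      infsum v UNIV + (\<Sum>l\<in>F. u l - v l)) UNIV"
    by (intro has_sum_add has_sum_infsum)
  then have "(u has_sum infsum v UNIV + (\<Sum>l\<in>F. u l - v l)) UNIV"
    by (subst u)
  then show "u summable_on UNIV" "infsum u UNIV = infsum v UNIV + (\<Sum>l\<in>F. u l - v l)"
    by (auto simp: summable_on_def infsumI)
qed

lemma power4_mono_imp: "u ^ 4 \<le> v ^ 4 \<Longrightarrow> 0 \<le> v \<Longrightarrow> u \<le> v" for u v :: real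
  using power_mono_iff by (metis linorder_le_cases order_trans zero_less_numeral)

lemma norm_diff_mono: "norm a \<le> r \<Longrightarrow> norm b \<le> s \<Longrightarrow> norm (a - b) \<le> r + s"
  by (rule order_trans[OF norm_triangle_ineq4]) simp

lemma norm_scaleR_le: "\<bar>c\<bar> \<le> r \<Longrightarrow> norm a \<le> s \<Longrightarrow> norm (c *\<^sub>R a) \<le> r * s"
  using norm_ge_zero[of a] by (simp add: mult_mono)

lemma inner_has_real_derivative:
  assumes "(u has_vector_derivative u') (at t)" "(v has_vector_derivative v') (at t)"
  shows "((\<lambda>t. u t \<bullet> v t) has_real_derivative u t \<bullet> v' + u' \<bullet> v t) (at t)"
  using bounded_bilinear.has_vector_derivative[OF bounded_bilinear_inner assms]
  by (simp add: has_real_derivative_iff_has_vector_derivative)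

lemma sq_sum_le:
  assumes "cmod (u - v) \<le> K * p" "0 \<le> K"
  shows "(cmod u)\<^sup>2 \<le> 2 * (cmod v)\<^sup>2 + 2 * K\<^sup>2 * p\<^sup>2"
proof -
  have "cmod u \<le> cmod v + K * p"
    using norm_triangle_ineq[of v "u - v"] assms(1) by simp
  then have "(cmod u)\<^sup>2 \<le> (cmod v + K * p)\<^sup>2"
    by (intro power_mono) auto
  also have "\<dots> \<le> 2 * (cmod v)\<^sup>2 + 2 * (K * p)\<^sup>2"
    using sum_squares_bound[of "cmod v" "K * p"] by (simp add: power2_sum)
  finally show ?thesis by (simp add: power_mult_distrib)
qed

subsection \<open>The traveling wave coefficients\<close>

lemma has_real_derivative_at_nonneg:
  "0 < t \<Longrightarrow> (u has_real_derivative u') (at t within {0..}) \<Longrightarrow> (u has_real_derivative u') (at t)"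
  for t :: real
  using at_within_interior[of t "{0..}"] by (simp only: interior_real_atLeast greaterThan_iff)

lemma weighted_am_gm: "0 < a \<Longrightarrow> \<bar>u * v\<bar> \<le> (a * u\<^sup>2 + v\<^sup>2 / a) / 2" for a u v :: real
proof -
  assume a: "0 < a"
  have "0 \<le> (a * \<bar>u\<bar> - \<bar>v\<bar>)\<^sup>2 / a"
    using a by simp
  also have "\<dots> = a * u\<^sup>2 + v\<^sup>2 / a - 2 * (\<bar>u\<bar> * \<bar>v\<bar>)"
    using a by (simp add: power2_diff power_mult_distrib field_simps) (simp add: power2_eq_square)
  finally show ?thesis
    by (simp add: abs_mult)
qed

text \<open>With r = sqrt (1 + t^2), the corrected energy \<open>En\<close> = \<alpha> f^2 / r + r
  g^2 - f g t / r has derivative exactly - f g / r^3: all terms that are not integrable cancel. The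
  correction is dominated by the rest because |f g| \<le> \<theta> N with \<theta> < 1, which is the
  condition \<alpha> > 1/4.\<close>

lemma wave_energy_bound:
  assumes \<alpha>: "\<alpha> > 1 / 4" and wave: "wave_coefficients \<alpha> \<epsilon> f g" and t: "0 \<le> t"
  defines "\<theta> \<equiv> 1 / (2 * sqrt \<alpha>)" and "r \<equiv> \<lambda>t. sqrt (1 + t\<^sup>2)"
  shows "\<alpha> * (f t)\<^sup>2 / r t + r t * (g t)\<^sup>2 \<le> exp (\<theta> / (1 - \<theta>)) * (\<alpha> + 1) / (1 - \<theta>) * \<epsilon>\<^sup>2"
proof -
  have "sqrt (1 / 4) < sqrt \<alpha>"
    using \<alpha> by (simp only: real_sqrt_less_iff)
  then have \<alpha>': "1 / 2 < sqrt \<alpha>"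
    by (simp add: real_sqrt_divide)
  have \<theta>: "0 < \<theta>" "\<theta> < 1"
    unfolding \<theta>_def using \<alpha>' \<alpha> by (auto simp: divide_less_eq)
  \<comment> \<open>Chosen such that |f g| \<le> c \<open>En\<close>: |f g| \<le> \<theta> N and (1
    - \<theta>) N \<le> \<open>En\<close>.\<close>
  define c where "c = \<theta> / (1 - \<theta>)"
  have c: "0 < c" using \<theta> by (simp add: c_def)
  define N where "N = (\<lambda>t. \<alpha> * (f t)\<^sup>2 / r t + r t * (g t)\<^sup>2)"
  define En where "En = (\<lambda>t. N t - f t * g t * (t / r t))"
  have r: "0 < r t" "(r t)\<^sup>2 = 1 + t\<^sup>2" "\<bar>t\<bar> \<le> r t" for t
    unfolding r_def by (auto simp: add_pos_nonneg real_le_rsqrt)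
  have fg: "\<bar>f t * g t\<bar> \<le> \<theta> * N t" for t
  proof -
    have "\<bar>f t * g t\<bar> \<le> (sqrt \<alpha> / r t * (f t)\<^sup>2 + (g t)\<^sup>2 / (sqrt \<alpha> / r t)) / 2"
      using r[of t] \<alpha> by (intro weighted_am_gm divide_pos_pos) auto
    also have "\<dots> = \<theta> * ((sqrt \<alpha> * sqrt \<alpha>) * (f t)\<^sup>2 / r t + r t * (g t)\<^sup>2)"
    proof -
      have id: "(a / b * u + v / (a / b)) / 2 = 1 / (2 * a) * ((a * a) * u / b + b * v)"
        if "0 < a" "0 < b" for a b u v :: real
        using that by (simp add: add_divide_distrib distrib_left mult.commute)
      then show ?thesis
        unfolding \<theta>_def using r(1)[of t] \<alpha> by (intro id) auto
    qed
    also have "\<dots> = \<theta> * N t"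
      using \<alpha> by (simp add: N_def)
    finally show ?thesis .
  qed
  have En: "(1 - \<theta>) * N t \<le> En t" for t
  proof -
      have "\<bar>t / r t\<bar> \<le> 1"
        using r(1,3)[of t] by (simp add: abs_of_pos)
      then have "\<bar>f t * g t\<bar> * \<bar>t / r t\<bar> \<le> \<bar>f t * g t\<bar> * 1"
        by (rule mult_left_mono) simp
      then have "f t * g t * (t / r t) \<le> \<bar>f t * g t\<bar>"
        using abs_ge_self[of "f t * g t * (t / r t)"] by (simp only: abs_mult mult_1_right)
    with fg[of t] show ?thesis
      by (simp add: En_def algebra_simps)
  qed
  have fgc: "\<bar>f t * g t\<bar> \<le> c * En t" for t
  proof -
    have "\<theta> * N t = c * ((1 - \<theta>) * N t)"
      using \<theta> by (simp add: c_def)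
    also have "\<dots> \<le> c * En t"
      using En c by (intro mult_left_mono) auto
    finally show ?thesis using fg[of t] by linarith
  qed
  have f': "(f has_real_derivative g s) (at s within {0..})"
    and g': "(g has_real_derivative - \<alpha> * f s / (1 + s\<^sup>2)) (at s within {0..})" if "s \<ge> 0" for s
    using wave that by (auto simp: wave_coefficients_def)
  \<comment> \<open>t / r is an antiderivative of 1 / r^3 and stays below 1, so the integrating
    factor costs at most exp c for all times.\<close>
  define W where "W = (\<lambda>t. En t * exp (- c * (t / r t)))"
  have "W t \<le> W 0"
  proof (rule DERIV_nonpos_imp_decreasing_open[where f = W])
    fix s assume s: "0 < s" "s < t"
    have s0: "0 \<le> s" using s by simp
    note f1 = has_real_derivative_at_nonneg[OF s(1) f'[OF s0]]
    note g1 = has_real_derivative_at_nonneg[OF s(1) g'[OF s0]]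
    have g1': "(g has_real_derivative - \<alpha> * f s / (r s)\<^sup>2) (at s)"
      using g1 by (simp add: r)
    have r1: "(r has_real_derivative s / r s) (at s)"
      unfolding r_def using add_pos_nonneg[OF zero_less_one zero_le_power2[of s]]
      by (auto intro!: derivative_eq_intros simp: field_simps)
    have q1: "((\<lambda>s. s / r s) has_real_derivative 1 / r s ^ 3) (at s)"
    proof -
      have "((\<lambda>s. s / r s) has_real_derivative (1 * r s - s * (s / r s)) / (r s * r s)) (at s)"
        using r[of s] by (intro DERIV_divide DERIV_ident r1) auto
      also have "(1 * r s - s * (s / r s)) / (r s * r s) = ((r s)\<^sup>2 - s\<^sup>2) / r s ^ 3"
        using r[of s] by (simp add: field_simps power2_eq_square power3_eq_cube)
      finally show ?thesis using r[of s] by simp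
    qed
    have En1: "(En has_real_derivative - (f s * g s) / r s ^ 3) (at s)"
    proof -
      have f2: "((\<lambda>s. (f s)\<^sup>2) has_real_derivative 2 * f s * g s) (at s)"
        using DERIV_power[OF f1, of 2] by (simp add: mult.assoc mult.left_commute mult.commute)
      have g2: "((\<lambda>s. (g s)\<^sup>2) has_real_derivative 2 * g s * (- \<alpha> * f s / (r s)\<^sup>2)) (at s)"
        using DERIV_power[OF g1', of 2] by (simp add: mult.assoc mult.left_commute mult.commute)
      have n1: "((\<lambda>s. \<alpha> * (f s)\<^sup>2 / r s) has_real_derivative
          (\<alpha> * (2 * f s * g s) * r s - \<alpha> * (f s)\<^sup>2 * (s / r s)) / (r s * r s)) (at s)"
        using r(1)[of s] by (intro DERIV_divide DERIV_cmult f2 r1) auto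
      have n2: "((\<lambda>s. r s * (g s)\<^sup>2) has_real_derivative
          s / r s * (g s)\<^sup>2 + 2 * g s * (- \<alpha> * f s / (r s)\<^sup>2) * r s) (at s)"
        by (intro DERIV_mult r1 g2)
      have n3: "((\<lambda>s. f s * g s * (s / r s)) has_real_derivative
          (g s * g s + - \<alpha> * f s / (r s)\<^sup>2 * f s) * (s / r s) + 1 / r s ^ 3 * (f s * g s)) (at s)"
        by (intro DERIV_mult f1 g1' q1)
      have "(\<alpha> * (2 * F * G) * R - \<alpha> * F\<^sup>2 * (s / R)) / (R * R)
          + (s / R * G\<^sup>2 + 2 * G * (- \<alpha> * F / R\<^sup>2) * R)
          - ((G * G + - \<alpha> * F / R\<^sup>2 * F) * (s / R) + 1 / R ^ 3 * (F * G)) = - (F * G) / R ^ 3"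
        if "0 < R" for F G R :: real
        using that by (simp add: field_simps power2_eq_square power3_eq_cube)
      from this[OF r(1)] DERIV_diff[OF DERIV_add[OF n1 n2] n3]
      show ?thesis
        unfolding En_def N_def by metis
    qed
    have "(W has_real_derivative (- (f s * g s) / r s ^ 3 - c * En s / r s ^ 3) * exp (- c * (s / r s))) (at s)"
      unfolding W_def by (rule derivative_eq_intros En1 q1 refl | simp add: algebra_simps)+
    moreover have "- (f s * g s) / r s ^ 3 - c * En s / r s ^ 3 \<le> 0"
      unfolding diff_divide_distrib[symmetric] using fgc[of s] r(1)[of s]
      by (intro divide_nonpos_pos) auto
    ultimately show "\<exists>y. (W has_real_derivative y) (at s) \<and> y \<le> 0"
      by (auto simp: mult_le_0_iff)
  next
    have "continuous_on {0..} f" "continuous_on {0..} g"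
      using f' g' by (auto intro!: DERIV_continuous_on)
    then have "continuous_on {0..t} f" "continuous_on {0..t} g"
      by (auto elim: continuous_on_subset)
    then show "continuous_on {0..t} W"
      unfolding W_def En_def N_def r_def by (intro continuous_intros) (auto simp: add_nonneg_eq_0_iff)
  qed (use t in auto)
  also have "W 0 = (\<alpha> + 1) * \<epsilon>\<^sup>2"
    using wave by (simp add: W_def En_def N_def r_def wave_coefficients_def algebra_simps)
  finally have "En t \<le> (\<alpha> + 1) * \<epsilon>\<^sup>2 * exp (c * (t / r t))"
    using r[of t] by (simp add: W_def exp_minus field_simps)
  also have "\<dots> \<le> (\<alpha> + 1) * \<epsilon>\<^sup>2 * exp c"
  proof -
    have "c * (t / r t) \<le> c * 1"
      using c r(1,3)[of t] by (intro mult_left_mono) (auto simp: divide_le_eq)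
    then show ?thesis
      using \<alpha> by (intro mult_left_mono) auto
  qed
  finally have "(1 - \<theta>) * N t \<le> (\<alpha> + 1) * \<epsilon>\<^sup>2 * exp c"
    using En[of t] by simp
  then have "N t \<le> exp c * (\<alpha> + 1) / (1 - \<theta>) * \<epsilon>\<^sup>2"
    using \<theta> by (simp add: field_simps)
  then show ?thesis
    by (simp add: N_def c_def)
qed

text \<open>The window from 3/4 \<eta> to 2 \<eta> contains the whole resonant interval when \<eta>
  = \<xi> / k. \<open>F\<close> is obtained before \<epsilon>, f, g and \<eta>, so it depends on
  \<alpha> only.\<close>

lemma wave_coefficients_bound:
  assumes \<alpha>: "\<alpha> > 1 / 4"
  obtains F where "F \<ge> 1"
    "\<And>\<epsilon> f g \<eta> t. \<lbrakk>0 < \<epsilon>; wave_coefficients \<alpha> \<epsilon> f g; 1 \<le> \<eta>; 3 / 4 * \<eta> \<le> t; t \<le> 2 * \<eta>\<rbrakk>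
      \<Longrightarrow> \<bar>f t\<bar> \<le> F * \<epsilon> * sqrt \<eta> \<and> \<bar>g t\<bar> \<le> F * \<epsilon> / sqrt \<eta>"
proof -
  define \<theta> where "\<theta> = 1 / (2 * sqrt \<alpha>)"
  define c where "c = exp (\<theta> / (1 - \<theta>)) * (\<alpha> + 1) / (1 - \<theta>)"
  have "sqrt (1 / 4) < sqrt \<alpha>"
    using \<alpha> by (simp only: real_sqrt_less_iff)
  then have "\<theta> < 1"
    using \<alpha> by (simp add: real_sqrt_divide \<theta>_def divide_less_eq)
  then have c: "0 < c" using \<alpha> by (simp add: c_def)
  \<comment> \<open>12 = 4 * 3, from 1 / \<alpha> < 4 and r \<le> 3 \<eta>; the summand 1 ensures
    \<open>F\<close> \<ge> 1.\<close>
  define F where "F = sqrt (12 * c + 1)"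
  have F: "F\<^sup>2 = 12 * c + 1" "F \<ge> 1" using c by (auto simp: F_def)
  show thesis
  proof
    fix \<epsilon> \<eta> t :: real and f g :: "real \<Rightarrow> real"
    assume \<epsilon>: "0 < \<epsilon>" and wave: "wave_coefficients \<alpha> \<epsilon> f g" and \<eta>: "1 \<le> \<eta>"
      and t: "3 / 4 * \<eta> \<le> t" "t \<le> 2 * \<eta>"
    define r where "r = sqrt (1 + t\<^sup>2)"
    have bound: "\<alpha> * (f t)\<^sup>2 / r + r * (g t)\<^sup>2 \<le> c * \<epsilon>\<^sup>2"
      unfolding r_def c_def \<theta>_def using wave_energy_bound[OF \<alpha> wave, of t] t \<eta> by simp
    have r: "3 / 4 * \<eta> \<le> r" "0 < r" "r \<le> 3 * \<eta>"
    proof -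
      have "\<bar>t\<bar> \<le> r" unfolding r_def by (rule real_le_rsqrt) simp
      then show "3 / 4 * \<eta> \<le> r" using t by simp
      then show "0 < r" using \<eta> by simp
      have "t\<^sup>2 \<le> (2 * \<eta>)\<^sup>2" using t \<eta> by (intro power_mono) auto
      then have "t\<^sup>2 \<le> 4 * \<eta>\<^sup>2" by (simp add: power_mult_distrib)
      moreover have "1 \<le> \<eta>\<^sup>2" using \<eta> by simp
      ultimately have "1 + t\<^sup>2 \<le> 9 * \<eta>\<^sup>2" by linarith
      then have "1 + t\<^sup>2 \<le> (3 * \<eta>)\<^sup>2" by (simp add: power_mult_distrib)
      then show "r \<le> 3 * \<eta>"
        unfolding r_def using \<eta> by (intro real_le_lsqrt) auto
    qed
    have "\<alpha> * (f t)\<^sup>2 / r \<le> c * \<epsilon>\<^sup>2"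
      using bound r mult_nonneg_nonneg[of r "(g t)\<^sup>2"] zero_le_power2[of "g t"] by linarith
    then have "\<alpha> * (f t)\<^sup>2 \<le> c * \<epsilon>\<^sup>2 * r"
      using r by (simp add: field_simps)
    moreover have "1 / 4 * (f t)\<^sup>2 \<le> \<alpha> * (f t)\<^sup>2"
      using \<alpha> by (intro mult_right_mono) auto
    ultimately have "(f t)\<^sup>2 \<le> 4 * (c * \<epsilon>\<^sup>2) * r" by simp
    also have "\<dots> \<le> 4 * (c * \<epsilon>\<^sup>2) * (3 * \<eta>)"
      using r c by (intro mult_left_mono) auto
    also have "\<dots> \<le> (12 * c + 1) * \<epsilon>\<^sup>2 * \<eta>"
      using c \<eta> by (simp add: algebra_simps)
    also have "\<dots> = (F * \<epsilon> * sqrt \<eta>)\<^sup>2"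
      using \<eta> F by (simp add: power_mult_distrib)
    finally have f: "\<bar>f t\<bar> \<le> F * \<epsilon> * sqrt \<eta>"
      using F \<epsilon> \<eta> by (simp add: power2_le_iff_abs_le)
    have "r * (g t)\<^sup>2 \<le> c * \<epsilon>\<^sup>2"
      using bound r \<alpha> divide_nonneg_nonneg[of "\<alpha> * (f t)\<^sup>2" r] mult_nonneg_nonneg[of \<alpha> "(f t)\<^sup>2"]
        zero_le_power2[of "f t"] by linarith
    moreover have "3 / 4 * \<eta> * (g t)\<^sup>2 \<le> r * (g t)\<^sup>2"
      using r by (intro mult_right_mono) auto
    ultimately have "\<eta> * (g t)\<^sup>2 \<le> 4 / 3 * (c * \<epsilon>\<^sup>2)" by simp
    also have "\<dots> \<le> (12 * c + 1) * \<epsilon>\<^sup>2"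
      using c by (simp add: algebra_simps)
    finally have "(g t)\<^sup>2 \<le> F\<^sup>2 * \<epsilon>\<^sup>2 / \<eta>"
      using \<eta> by (simp add: F field_simps)
    also have "\<dots> = (F * \<epsilon> / sqrt \<eta>)\<^sup>2"
      using \<eta> by (simp add: power_mult_distrib power_divide)
    finally have g: "\<bar>g t\<bar> \<le> F * \<epsilon> / sqrt \<eta>"
      using F \<epsilon> \<eta> by (simp add: power2_le_iff_abs_le)
    from f g show "\<bar>f t\<bar> \<le> F * \<epsilon> * sqrt \<eta> \<and> \<bar>g t\<bar> \<le> F * \<epsilon> / sqrt \<eta>" ..
  qed (rule F)
qed

subsection \<open>Geometry of the resonant interval\<close>

text \<open>This is X^2 \<ge> 1 for X = \<epsilon> \<xi> k^(-3/2), free of fractional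
  powers.\<close>

lemma k0_bound:
  assumes "0 < \<epsilon>" "0 < \<xi>" "k \<le> k0 \<epsilon> \<xi>"
  shows "real k ^ 3 \<le> (\<epsilon> * \<xi>)\<^sup>2"
proof -
  have p: "0 < \<epsilon> * \<xi>" using assms by simp
  have "real k \<le> (\<epsilon> * \<xi>) powr (2 / 3)"
  proof -
    have "int k \<le> \<lfloor>(\<epsilon> * \<xi>) powr (2 / 3)\<rfloor>"
      using assms by (simp add: k0_def le_nat_iff)
    then show ?thesis by (simp add: le_floor_iff)
  qed
  then have "real k ^ 3 \<le> ((\<epsilon> * \<xi>) powr (2 / 3)) ^ 3"
    by (intro power_mono) auto
  also have "\<dots> = (\<epsilon> * \<xi>)\<^sup>2"
    using p by (simp add: powr_powr flip: powr_numeral)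
  finally show ?thesis .
qed

lemma tres_lower:
  assumes "0 < \<xi>" "1 \<le> k"
  shows "3 / 4 * (\<xi> / real k) \<le> tres \<xi> k"
proof -
  have "\<xi> / (2 * real k) \<le> \<xi> / (real k + 1)"
    using assms by (intro divide_left_mono) auto
  then show ?thesis using assms by (simp add: tres_def)
qed

text \<open>\<open>small\<close> is what remains of the restriction t \<le> \<delta>^2 /
  \<epsilon>^2; it constrains \<eta> only, so all later bounds hold up to the right endpoint of the
  interval. \<open>fg_bound\<close> is an assumption so that every constant is explicit in \<alpha>
  and \<open>F\<close>.\<close>

locale resonance =
  fixes \<alpha> \<epsilon> \<xi> F :: real and f g :: "real \<Rightarrow> real" and k :: nat
  assumes \<alpha>: "\<alpha> > 1 / 4" and \<epsilon>: "0 < \<epsilon>" and \<xi>: "0 < \<xi>" and k: "1 \<le> k" and F: "1 \<le> F"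
    and wave: "wave_coefficients \<alpha> \<epsilon> f g"
    and resonant: "real k ^ 3 \<le> (\<epsilon> * \<xi>)\<^sup>2"
    and small: "\<epsilon>\<^sup>2 * (\<xi> / real k) \<le> 1 / 75"
    and fg_bound: "\<And>t. 3 / 4 * (\<xi> / real k) \<le> t \<Longrightarrow> t \<le> 2 * (\<xi> / real k) \<Longrightarrow>
      \<bar>f t\<bar> \<le> F * \<epsilon> * sqrt (\<xi> / real k) \<and> \<bar>g t\<bar> \<le> F * \<epsilon> / sqrt (\<xi> / real k)"
begin

text \<open>
  Fractional powers are avoided by computing with roots: with \<open>\<eta> = \<xi> / k\<close> and \<open>\<tau> = t - \<eta>\<close>, the
  constants \<open>sk\<close>, \<open>sh\<close>, \<open>res_root t\<close> and \<open>Delta_root l t\<close> are \<open>k\<^sup>1\<^sup>/\<^sup>2\<close>, \<open>\<eta>\<^sup>1\<^sup>/\<^sup>2\<close>, \<open>(1 + \<tau>\<^sup>2)\<^sup>1\<^sup>/\<^sup>4\<close>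
  and \<open>\<Delta>\<^sub>l\<^sup>1\<^sup>/\<^sup>4\<close>.
\<close>

definition "sk = sqrt (real k)"
definition "sh = sqrt (\<xi> / real k)"
definition "I = {tres \<xi> k..tres \<xi> (k - 1)}"
definition Delta_root :: "int \<Rightarrow> real \<Rightarrow> real" where "Delta_root l t = Delta_symbol \<xi> t l powr (1 / 4)"
definition res_root :: "real \<Rightarrow> real" where "res_root t = (1 + (t - \<xi> / real k)\<^sup>2) powr (1 / 4)"

lemma sk: "1 \<le> sk" "0 < sk" "sk\<^sup>2 = real k"
  using k by (auto simp: sk_def)

lemma sh: "0 < sh" "sh\<^sup>2 = \<xi> / real k"
  using k \<xi> by (auto simp: sh_def)

lemma xi_eq: "\<xi> = sk\<^sup>2 * sh\<^sup>2"
  using k by (simp add: sk sh)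

text \<open>In terms of \<eta> = \<xi> / k this is 75 k \<le> \<eta>: the distance between
  consecutive resonant times, of order \<eta> / k, is large compared with the width 1 of a
  resonance. It combines k^3 \<le> \<epsilon>^2 \<xi>^2 with \<epsilon>^2 \<eta> \<le> 1/75.\<close>

lemma sh_ge: "75 * sk\<^sup>2 \<le> sh\<^sup>2"
proof -
  have "real k ^ 3 \<le> \<epsilon>\<^sup>2 * (\<xi> / real k) * (\<xi> * real k)"
    using resonant k by (simp add: power2_eq_square ac_simps)
  also have "\<dots> \<le> 1 / 75 * (\<xi> * real k)"
    using small k \<xi> by (intro mult_right_mono) auto
  finally have "(75 * (real k)\<^sup>2) * real k \<le> \<xi> * real k"
    by (simp add: power2_eq_square power3_eq_cube)
  then have "75 * (real k)\<^sup>2 \<le> \<xi>"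
    using k by simp
  then show ?thesis
    using k unfolding sk sh by (simp add: field_simps power2_eq_square)
qed

lemma sh_ge_1: "75 \<le> sh\<^sup>2" "1 \<le> sh"
proof -
  have "1 \<le> sk\<^sup>2" using k by (simp add: sk)
  then show "75 \<le> sh\<^sup>2" using sh_ge by linarith
  then have "1\<^sup>2 \<le> sh\<^sup>2" by simp
  then show "1 \<le> sh" using sh(1) by (intro power2_le_imp_le[of 1 sh]) auto
qed

lemma eps_sh: "\<epsilon> * sh \<le> 1"
proof -
  have "\<epsilon>\<^sup>2 * (\<xi> / real k) \<le> 1"
    using small by linarith
  then have "(\<epsilon> * sh)\<^sup>2 \<le> 1\<^sup>2"
    by (simp add: power_mult_distrib sh)
  then show ?thesis
    by (rule power2_le_imp_le) simp
qed

text \<open>Exactly, \<xi> / t_k = k + k / (2 k + 1). The last bound separates t_k from the resonant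
  time \<eta> by \<eta> / (4 k); it makes the shift harmless at the initial time.\<close>

lemma tres_ge: "(real k + 2 / 3) * tres \<xi> k \<ge> \<xi>" "3 / 4 * sh\<^sup>2 \<le> tres \<xi> k" "tres \<xi> k \<le> sh\<^sup>2 - sh\<^sup>2 / (4 * real k)"
proof -
  define m where "m = real k"
  have m: "1 \<le> m" "sh\<^sup>2 = \<xi> * (1 / m)" using k by (auto simp: m_def sh)
  have t: "tres \<xi> k = \<xi> * ((2 * m + 1) / (2 * m * (m + 1)))"
    using m(1) k by (simp add: tres_def divide_simps flip: m_def) (simp add: algebra_simps)
  have pos: "0 < 2 * m * (m + 1)" using m(1) by simp
  have "1 \<le> (m + 2 / 3) * ((2 * m + 1) / (2 * m * (m + 1)))"
    using m(1) unfolding times_divide_eq_right pos_le_divide_eq[OF pos] by (simp add: algebra_simps)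
  from mult_left_mono[OF this, of \<xi>] \<xi>
  show "(real k + 2 / 3) * tres \<xi> k \<ge> \<xi>"
    unfolding m_def[symmetric] t by (simp add: mult.left_commute)
  show "3 / 4 * sh\<^sup>2 \<le> tres \<xi> k"
    using tres_lower[OF \<xi> k] by (simp add: sh)
  have "(2 * m + 1) / (2 * m * (m + 1)) \<le> 1 / m - 1 / m / (4 * m)"
    using m(1) unfolding pos_divide_le_eq[OF pos] by (simp add: field_simps)
  from mult_left_mono[OF this, of \<xi>] \<xi>
  show "tres \<xi> k \<le> sh\<^sup>2 - sh\<^sup>2 / (4 * real k)"
    unfolding m_def[symmetric] t m(2) by (simp add: right_diff_distrib)
qed

text \<open>For k \<ge> 2, \<xi> / t_{k-1} = k - k / (2 k - 1), so 2/3 is attained at k = 2. For k =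
  1 the separate value t_0 = 2 \<xi> gives 1/2. Any constant below 1 would keep the other modes away
  from resonance.\<close>

lemma tres_le: "(real k - 2 / 3) * tres \<xi> (k - 1) \<le> \<xi>" "tres \<xi> (k - 1) \<le> 2 * sh\<^sup>2"
proof -
  consider "k = 1" | "2 \<le> k" using k by linarith
  then have "(real k - 2 / 3) * tres \<xi> (k - 1) \<le> \<xi> \<and> tres \<xi> (k - 1) \<le> 2 * sh\<^sup>2"
  proof cases
    case 1
    then have "sh\<^sup>2 = \<xi>" "tres \<xi> (k - 1) = 2 * \<xi>"
      using sh(2) by (simp_all add: tres_def)
    with 1 show ?thesis using \<xi> by simp
  next
    case 2
    define m where "m = real k"
    have m: "2 \<le> m" "real (k - 1) = m - 1" "m \<noteq> 0" "m \<noteq> 1"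
      using 2 by (auto simp: m_def)
    have t: "tres \<xi> (k - 1) = \<xi> * ((2 * m - 1) / (2 * m * (m - 1)))"
      using 2 m by (simp add: tres_def) (simp add: divide_simps algebra_simps)
    have "(m - 2 / 3) * ((2 * m - 1) / (2 * m * (m - 1))) \<le> 1"
      using m(1) by (simp add: field_simps)
    from mult_left_mono[OF this, of \<xi>] \<xi>
    have 1: "(m - 2 / 3) * tres \<xi> (k - 1) \<le> \<xi>"
      unfolding t by (simp add: mult.left_commute)
    have "(2 * m - 1) / (2 * m * (m - 1)) \<le> 2 * (1 / m)"
      using m(1) by (simp add: field_simps)
    from mult_left_mono[OF this, of \<xi>] \<xi>
    have "tres \<xi> (k - 1) \<le> 2 * sh\<^sup>2"
      unfolding t by (simp add: sh m_def)
    with 1 show ?thesis by (simp add: m_def)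
  qed
  then show "(real k - 2 / 3) * tres \<xi> (k - 1) \<le> \<xi>" "tres \<xi> (k - 1) \<le> 2 * sh\<^sup>2" by auto
qed

lemma I_bounds:
  assumes "t \<in> I"
  shows "3 / 4 * sh\<^sup>2 \<le> t" "t \<le> 2 * sh\<^sup>2" "0 < t" "50 * real k \<le> t" "50 \<le> t" "\<bar>\<xi> - real k * t\<bar> \<le> 2 / 3 * t"
proof -
  show t: "3 / 4 * sh\<^sup>2 \<le> t" "t \<le> 2 * sh\<^sup>2"
    using assms tres_ge tres_le by (auto simp: I_def)
  then show "50 \<le> t" "0 < t" using sh_ge_1 by auto
  show "50 * real k \<le> t" using sh_ge t by (simp add: sk)
  have "\<xi> \<le> (real k + 2 / 3) * tres \<xi> k" using tres_ge by simp
  also have "\<dots> \<le> (real k + 2 / 3) * t"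
    using assms by (intro mult_left_mono) (auto simp: I_def)
  finally have 1: "\<xi> - real k * t \<le> 2 / 3 * t" by (simp add: algebra_simps)
  have "(real k - 2 / 3) * t \<le> (real k - 2 / 3) * tres \<xi> (k - 1)"
    using assms k by (intro mult_left_mono) (auto simp: I_def)
  also have "\<dots> \<le> \<xi>" using tres_le by simp
  finally have "real k * t - \<xi> \<le> 2 / 3 * t" by (simp add: algebra_simps)
  with 1 show "\<bar>\<xi> - real k * t\<bar> \<le> 2 / 3 * t" by linarith
qed

text \<open>The bounds retaining \<epsilon> \<eta>^(1/2) are needed once, for the size of the shift,
  where this factor becomes part of X. Elsewhere it is estimated by 1.\<close>

lemma f_bound: "t \<in> I \<Longrightarrow> \<bar>f t\<bar> \<le> F * (\<epsilon> * sh)" "t \<in> I \<Longrightarrow> \<bar>f t\<bar> \<le> F"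
  and g_bound: "t \<in> I \<Longrightarrow> \<bar>g t\<bar> \<le> F * (\<epsilon> * sh) / sh\<^sup>2" "t \<in> I \<Longrightarrow> \<bar>g t\<bar> \<le> F / sh\<^sup>2"
proof -
  assume t: "t \<in> I"
  have *: "\<bar>f t\<bar> \<le> F * \<epsilon> * sh \<and> \<bar>g t\<bar> \<le> F * \<epsilon> / sh"
    unfolding sh_def using I_bounds[OF t] by (intro fg_bound) (auto simp: sh)
  have s: "F * (\<epsilon> * sh) \<le> F * 1"
    using eps_sh F by (intro mult_left_mono) auto
  show 1: "\<bar>f t\<bar> \<le> F * (\<epsilon> * sh)" using * by (simp add: mult.assoc)
  show 2: "\<bar>g t\<bar> \<le> F * (\<epsilon> * sh) / sh\<^sup>2" using * sh(1) by (simp add: power2_eq_square)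
  show "\<bar>f t\<bar> \<le> F" using 1 s by simp
  show "\<bar>g t\<bar> \<le> F / sh\<^sup>2"
    using 2 divide_right_mono[OF s, of "sh\<^sup>2"] by simp
qed

section \<open>The weights \<Delta>^(1/4) at and away from the resonant mode\<close>

lemma Delta_pos: "0 < Delta_symbol \<xi> t l"
proof (cases "l = 0")
  case True
  then show ?thesis using \<xi> by (simp add: Delta_symbol_def)
next
  case False
  then show ?thesis by (auto simp: Delta_symbol_def intro: add_pos_nonneg)
qed

lemma Delta_root: "0 < Delta_root l t" "Delta_root l t ^ 4 = Delta_symbol \<xi> t l"
  using Delta_pos[of t l] by (auto simp: Delta_root_def powr_powr simp flip: powr_numeral)

lemma Delta_powr:
  "Delta_symbol \<xi> t l powr (1 / 4) = Delta_root l t"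
  "Delta_symbol \<xi> t l powr (- 1 / 4) = 1 / Delta_root l t"
  "Delta_symbol \<xi> t l powr (- 3 / 4) = 1 / Delta_root l t ^ 3"
  "Delta_symbol \<xi> t l powr (1 / 2) = (Delta_root l t)\<^sup>2"
  using Delta_pos[of t l]
  by (auto simp: Delta_root_def powr_powr powr_minus_divide simp flip: powr_numeral)

lemma res_root: "1 \<le> res_root t" "res_root t ^ 4 = 1 + (t - \<xi> / real k)\<^sup>2"
proof -
  have "0 < 1 + (t - \<xi> / real k)\<^sup>2" by (simp add: add_pos_nonneg)
  then show "1 \<le> res_root t" "res_root t ^ 4 = 1 + (t - \<xi> / real k)\<^sup>2"
    by (auto simp: res_root_def powr_powr ge_one_powr_ge_zero simp flip: powr_numeral)
qed

lemma Delta_root_k: "Delta_root (int k) t = sk * res_root t"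
proof (rule power_eq_imp_eq_base)
  have "sk ^ 4 = (real k)\<^sup>2"
    using power_mult[of sk 2 2] by (simp add: sk)
  then have "(sk * res_root t) ^ 4 = (real k)\<^sup>2 * (1 + (t - \<xi> / real k)\<^sup>2)"
    by (simp add: power_mult_distrib res_root)
  also have "\<dots> = Delta_symbol \<xi> t (int k)"
    using k by (simp add: Delta_symbol_def power2_eq_square field_simps)
  finally show "Delta_root (int k) t ^ 4 = (sk * res_root t) ^ 4"
    by (simp add: Delta_root)
qed (use Delta_root(1)[of "int k" t] sk res_root(1)[of t] in auto)

lemma Delta_root_k_upper:
  assumes "t \<in> I"
  shows "sk * res_root t \<le> 2 * sh"
proof (rule power4_mono_imp)
  note t = I_bounds[OF assms]
  have "(sk * res_root t) ^ 4 = (real k)\<^sup>2 + (\<xi> - real k * t)\<^sup>2"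
    using Delta_root(2)[of "int k" t] by (simp add: Delta_root_k Delta_symbol_def)
  also have "\<dots> \<le> t\<^sup>2 / 9 + (2 / 3 * t)\<^sup>2"
  proof (intro add_mono)
    have "(real k)\<^sup>2 \<le> (t / 3)\<^sup>2" using t by (intro power_mono) auto
    then show "(real k)\<^sup>2 \<le> t\<^sup>2 / 9" by (simp add: power_divide)
    show "(\<xi> - real k * t)\<^sup>2 \<le> (2 / 3 * t)\<^sup>2"
      using t by (subst abs_le_square_iff[symmetric]) auto
  qed
  also have "\<dots> \<le> (2 * sh\<^sup>2)\<^sup>2"
  proof -
    have "t\<^sup>2 \<le> (2 * sh\<^sup>2)\<^sup>2" using t by (intro power_mono) auto
    moreover have "t\<^sup>2 / 9 + (2 / 3 * t)\<^sup>2 \<le> t\<^sup>2"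
      by (simp add: power_mult_distrib power_divide)
    ultimately show ?thesis by linarith
  qed
  also have "\<dots> \<le> (2 * sh) ^ 4"
    by (simp add: power_mult_distrib flip: power_mult)
  finally show "(sk * res_root t) ^ 4 \<le> (2 * sh) ^ 4" .
qed (use sh in auto)

text \<open>\<xi> - l t = (\<xi> - k t) - (l - k) t, and the first part is at most 2/3 t, hence at
  most 2/3 of the second.\<close>

lemma nonres_lower:
  assumes "t \<in> I" "l \<noteq> int k"
  shows "\<bar>of_int (l - int k)\<bar> * t / 3 \<le> \<bar>\<xi> - of_int l * t\<bar>"
    and "\<bar>\<xi> - of_int l * t\<bar> \<le> 5 / 3 * \<bar>of_int (l - int k)\<bar> * t"
proof -
  note t = I_bounds[OF assms(1)]
  have n: "1 \<le> \<bar>of_int (l - int k) :: real\<bar>"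
    using assms(2) by linarith
  have eq: "\<xi> - of_int l * t = (\<xi> - real k * t) - of_int (l - int k) * t"
    by (simp add: algebra_simps)
  have "\<bar>of_int (l - int k) * t\<bar> = \<bar>of_int (l - int k)\<bar> * t"
    using t by (simp add: abs_mult)
  moreover have "1 * t \<le> \<bar>of_int (l - int k)\<bar> * t"
    using n t by (intro mult_right_mono) auto
  ultimately show "\<bar>of_int (l - int k)\<bar> * t / 3 \<le> \<bar>\<xi> - of_int l * t\<bar>"
    "\<bar>\<xi> - of_int l * t\<bar> \<le> 5 / 3 * \<bar>of_int (l - int k)\<bar> * t"
    using t(6) unfolding eq by linarith+
qed

lemma xi_le_Delta_root: "\<bar>\<xi> - of_int l * t\<bar> \<le> (Delta_root l t)\<^sup>2"
proof -
  have "\<bar>\<xi> - of_int l * t\<bar>\<^sup>2 \<le> ((Delta_root l t)\<^sup>2)\<^sup>2"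
    using Delta_root(2)[of l t] by (simp add: Delta_symbol_def flip: power_mult)
  then show ?thesis by (rule power2_le_imp_le) simp
qed

lemma nonres_upper:
  assumes "t \<in> I" "l \<noteq> int k"
  shows "Delta_symbol \<xi> t l \<le> 3 * (\<bar>of_int (l - int k)\<bar> * t)\<^sup>2"
proof -
  note t = I_bounds[OF assms(1)]
  define n where "n = \<bar>of_int (l - int k) :: real\<bar>"
  have n: "1 \<le> n" unfolding n_def using assms(2) by linarith
  have "\<bar>of_int l\<bar> \<le> real k + n"
    unfolding n_def by linarith
  also have "\<dots> \<le> 1 / 50 * t + n * (1 / 50 * t)"
    using t n mult_left_mono[of 1 "1 / 50 * t" n] by linarith
  also have "\<dots> \<le> 1 / 25 * (n * t)"
  proof -
    have "1 * t \<le> n * t" using t n by (intro mult_right_mono) auto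
    then show ?thesis by simp
  qed
  finally have 1: "(of_int l)\<^sup>2 \<le> (1 / 25 * (n * t))\<^sup>2"
    using n t by (subst abs_le_square_iff[symmetric]) auto
  have 2: "(\<xi> - of_int l * t)\<^sup>2 \<le> (5 / 3 * (n * t))\<^sup>2"
    using nonres_lower(2)[OF assms] n t unfolding n_def[symmetric]
    by (subst abs_le_square_iff[symmetric]) auto
  have "(1 / 25 * (n * t))\<^sup>2 + (5 / 3 * (n * t))\<^sup>2 \<le> 3 * (n * t)\<^sup>2"
    by (simp add: power_mult_distrib power_divide)
  with 1 2 show ?thesis
    unfolding Delta_symbol_def n_def[symmetric] by linarith
qed

text \<open>With n = |l - k| \<ge> 1, \<Delta>_l^(1/2) \<ge> n \<eta> / 4 while |l| \<le> k + n
  \<le> 2 k n. The factor n cancels, so the second bound is uniform in l.\<close>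

lemma Delta_root_nonres:
  assumes "t \<in> I" "l \<noteq> int k"
  shows "sh / 2 \<le> Delta_root l t" and "\<bar>of_int l\<bar> / (Delta_root l t)\<^sup>2 \<le> 8 * (sk\<^sup>2 / sh\<^sup>2)"
proof -
  note t = I_bounds[OF assms(1)]
  define n where "n = \<bar>of_int (l - int k) :: real\<bar>"
  have n: "1 \<le> n" unfolding n_def using assms(2) by linarith
  have "n * (3 / 4 * sh\<^sup>2) \<le> n * t"
    using n t by (intro mult_left_mono) auto
  then have B: "n * (sh\<^sup>2 / 4) \<le> (Delta_root l t)\<^sup>2"
    using nonres_lower(1)[OF assms] xi_le_Delta_root[of l t] unfolding n_def[symmetric] by linarith
  have "1 * (sh\<^sup>2 / 4) \<le> n * (sh\<^sup>2 / 4)"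
    using n by (intro mult_right_mono) auto
  with B have "(sh / 2)\<^sup>2 \<le> (Delta_root l t)\<^sup>2" by (simp add: power_divide)
  then show "sh / 2 \<le> Delta_root l t"
    using Delta_root(1)[of l t] by (intro power2_le_imp_le[of "sh / 2"]) auto
  have "\<bar>of_int l\<bar> \<le> real k + n"
    unfolding n_def by linarith
  also have "\<dots> \<le> 2 * (real k * n)"
  proof -
    have "1 * n \<le> real k * n" using n k by (intro mult_right_mono) auto
    moreover have "real k * 1 \<le> real k * n" using n k by (intro mult_left_mono) auto
    ultimately show ?thesis by simp
  qed
  finally have "\<bar>of_int l\<bar> / (Delta_root l t)\<^sup>2 \<le> 2 * (real k * n) / (n * (sh\<^sup>2 / 4))"
    using B n sh(1) by (intro frac_le mult_pos_pos) auto
  also have "\<dots> = 8 * (sk\<^sup>2 / sh\<^sup>2)"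
    using n by (simp add: sk)
  finally show "\<bar>of_int l\<bar> / (Delta_root l t)\<^sup>2 \<le> 8 * (sk\<^sup>2 / sh\<^sup>2)" .
qed

text \<open>If l and m are neighbours and both differ from k, then |l - k| \<le> 2 |m - k|; and
  \<Delta>_l is comparable to ((l - k) t)^2 off the resonance.\<close>

lemma Delta_root_adjacent:
  assumes "t \<in> I" "l \<noteq> int k" "m \<noteq> int k" "\<bar>l - m\<bar> = 1"
  shows "Delta_root l t \<le> 4 * Delta_root m t"
proof (rule power4_mono_imp)
  note t = I_bounds[OF assms(1)]
  have "\<bar>l - int k\<bar> \<le> 2 * \<bar>m - int k\<bar>"
    using assms(2-) by presburger
  then have "\<bar>of_int (l - int k) :: real\<bar> \<le> 2 * \<bar>of_int (m - int k)\<bar>"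
    by linarith
  then have "\<bar>of_int (l - int k)\<bar> * t \<le> 6 * (\<bar>of_int (m - int k)\<bar> * t / 3)"
    using t mult_right_mono[of "\<bar>of_int (l - int k) :: real\<bar>" _ t] by fastforce
  also have "\<dots> \<le> 6 * \<bar>\<xi> - of_int m * t\<bar>"
    using nonres_lower(1)[OF assms(1,3)] by (intro mult_left_mono) auto
  finally have "(\<bar>of_int (l - int k)\<bar> * t)\<^sup>2 \<le> (6 * \<bar>\<xi> - of_int m * t\<bar>)\<^sup>2"
    using t by (intro power_mono) auto
  also have "\<dots> \<le> 36 * Delta_symbol \<xi> t m"
    by (simp add: power_mult_distrib Delta_symbol_def)
  finally have "Delta_symbol \<xi> t l \<le> 3 * (36 * Delta_symbol \<xi> t m)"
    using nonres_upper[OF assms(1,2)] by linarith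
  also have "\<dots> \<le> 256 * Delta_symbol \<xi> t m"
    using Delta_pos[of t m] by simp
  finally show "Delta_root l t ^ 4 \<le> (4 * Delta_root m t) ^ 4"
    by (simp add: Delta_root power_mult_distrib)
qed (use Delta_root(1)[of m t] in simp)

lemma Delta_root_neighbour:
  assumes "t \<in> I" "\<bar>l - int k\<bar> = 1"
  shows "Delta_root l t \<le> 3 * sh"
proof (rule power4_mono_imp)
  note t = I_bounds[OF assms(1)]
  have l: "l \<noteq> int k" "\<bar>of_int (l - int k) :: real\<bar> = 1" using assms(2) by linarith+
  have "Delta_root l t ^ 4 \<le> 3 * t\<^sup>2"
    using nonres_upper[OF assms(1) l(1)] l(2) by (simp add: Delta_root)
  also have "t\<^sup>2 \<le> (2 * sh\<^sup>2)\<^sup>2" using t by (intro power_mono) auto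
  also have "3 * (2 * sh\<^sup>2)\<^sup>2 \<le> (3 * sh) ^ 4"
    by (simp add: power_mult_distrib flip: power_mult)
  finally show "Delta_root l t ^ 4 \<le> (3 * sh) ^ 4" by simp
qed (use sh in simp)

end

subsection \<open>The coupling coefficients\<close>

context resonance
begin

text \<open>Three sizes that organise all estimates: \<open>inv_width\<close> is k / \<eta>, the
  inverse order of the interval length; \<open>rho\<close> is the largest rate tolerated in
  Gronwall, with integral O(1) over the interval; \<open>theta\<close> is \<eta>^(1/2) /
  \<Delta>_k^(1/4), the growth of the shift near resonance. The exact relation
  \<open>inv_width * theta t = rho t\<close> is why undoing a shift in an O(k/\<eta>) term is
  affordable.\<close>

definition "inv_width = sk\<^sup>2 / sh\<^sup>2"
definition "rho t = sk / (sh * res_root t)"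
definition "theta t = sh / (sk * res_root t)"

definition "L_symbol l t = of_int l * (\<xi> - of_int l * t) / Delta_root l t ^ 4"
definition "M_symbol l t = of_int l / (Delta_root l t)\<^sup>2"
text \<open>Influence of mode m on mode l. The factor i of the y-derivative is split off, which
  leaves real coefficients; \<xi> / 2 combines that derivative with the 1/2 from the cosine.\<close>

definition "coupling_ZZ l m t = \<xi> / 2 * f t * (1 / (Delta_root l t * Delta_root m t ^ 3) + Delta_root m t / (Delta_root l t * (1 + t\<^sup>2)))"
definition "coupling_QZ l m t = \<xi> / 2 * g t * (Delta_root l t / Delta_root m t ^ 3)"
definition "coupling_QQ l m t = \<xi> / 2 * f t * (Delta_root l t / (Delta_root m t * (1 + t\<^sup>2)))"

definition "adjacent l \<longleftrightarrow> \<bar>l - int k\<bar> = 1"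
text \<open>
  The multiples of \<open>i Q\<^sub>k\<close> to be subtracted from \<open>Z\<^sub>l\<close> and \<open>Q\<^sub>l\<close>. They are chosen such that the
  derivative of \<open>Q\<^sub>k\<close> reproduces the non-integrable part of the coupling from \<open>Z\<^sub>k\<close>.
\<close>

definition "shift_scale = sh\<^sup>2 / (2 * sqrt \<alpha>)"
definition "shift_Z l t = (if adjacent l then shift_scale * (f t / (Delta_root l t * Delta_root (int k) t)) else 0)"
definition "shift_Q l t = (if adjacent l then shift_scale * (g t * Delta_root l t / Delta_root (int k) t) else 0)"

lemma inv_width_pos: "0 < inv_width" and rho_pos: "0 < rho t" and theta_pos: "0 < theta t"
  using sk(2) sh(1) res_root(1)[of t] by (auto simp: inv_width_def rho_def theta_def)

lemma inv_width_theta: "inv_width * theta t = rho t"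
  using sk(2) sh(1) res_root(1)[of t] by (simp add: inv_width_def rho_def theta_def power2_eq_square)

lemma inv_width_over_theta: "t \<in> I \<Longrightarrow> inv_width / theta t \<le> 2 * inv_width"
  using Delta_root_k_upper[of t] sh(1) inv_width_pos by (simp add: theta_def divide_le_eq)

lemma inv_width_le_rho: "t \<in> I \<Longrightarrow> inv_width \<le> 2 * rho t"
  using inv_width_over_theta[of t] inv_width_theta[of t] theta_pos[of t] by (simp add: field_simps)

lemma inv_eta_le: "1 / sh\<^sup>2 \<le> inv_width"
  unfolding inv_width_def using sk(3) k by (intro divide_right_mono) auto

lemma sqrt_alpha: "1 / 2 < sqrt \<alpha>"
proof -
  have "sqrt (1 / 4) < sqrt \<alpha>"
    using \<alpha> by (simp only: real_sqrt_less_iff)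
  then show ?thesis by (simp add: real_sqrt_divide)
qed

lemma shift_scale: "0 < shift_scale" "shift_scale \<le> sh\<^sup>2"
proof -
  show "0 < shift_scale" using sqrt_alpha sh(1) \<alpha> by (simp add: shift_scale_def)
  have "sh\<^sup>2 / (2 * sqrt \<alpha>) \<le> sh\<^sup>2 / 1"
    using sqrt_alpha \<alpha> by (intro divide_left_mono) auto
  then show "shift_scale \<le> sh\<^sup>2" by (simp add: shift_scale_def)
qed

lemma inv_t_bound: "t \<in> I \<Longrightarrow> 1 / (1 + t\<^sup>2) \<le> 2 / sh ^ 4"
proof -
  assume "t \<in> I"
  note t = I_bounds[OF this]
  have "(3 / 4 * sh\<^sup>2)\<^sup>2 \<le> t\<^sup>2" using t by (intro power_mono) auto
  then have "9 / 16 * sh ^ 4 \<le> t\<^sup>2"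
    by (simp add: power_mult_distrib power_divide flip: power_mult)
  moreover have "0 \<le> sh ^ 4" by simp
  ultimately have "sh ^ 4 / 2 \<le> 1 + t\<^sup>2" by linarith
  then have "1 / (1 + t\<^sup>2) \<le> 1 / (sh ^ 4 / 2)"
    using sh(1) by (intro divide_left_mono) (auto intro!: mult_pos_pos add_pos_nonneg)
  then show ?thesis by simp
qed

lemma coefficient_f:
  assumes "t \<in> I" "0 \<le> s" "s \<le> S"
  shows "\<bar>\<xi> / 2 * f t * s\<bar> \<le> sk\<^sup>2 * sh\<^sup>2 / 2 * F * S"
proof -
  have "\<bar>\<xi> / 2 * f t * s\<bar> = \<xi> / 2 * \<bar>f t\<bar> * s"
    using \<xi> assms by (simp add: abs_mult)
  also have "\<dots> \<le> \<xi> / 2 * F * S"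
    using \<xi> F assms f_bound(2)[OF assms(1)] by (intro mult_mono) auto
  finally show ?thesis by (simp add: xi_eq[symmetric])
qed

lemma coefficient_g:
  assumes "t \<in> I" "0 \<le> s" "s \<le> S"
  shows "\<bar>\<xi> / 2 * g t * s\<bar> \<le> sk\<^sup>2 * sh\<^sup>2 / 2 * (F / sh\<^sup>2) * S"
proof -
  have "\<bar>\<xi> / 2 * g t * s\<bar> = \<xi> / 2 * \<bar>g t\<bar> * s"
    using \<xi> assms by (simp add: abs_mult)
  also have "\<dots> \<le> \<xi> / 2 * (F / sh\<^sup>2) * S"
    using \<xi> F assms g_bound(2)[OF assms(1)] by (intro mult_mono) auto
  finally show ?thesis by (simp add: xi_eq[symmetric])
qed

section \<open>Sizes of the couplings and of the shifts\<close>

lemma Delta_root_ratio: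
  assumes "t \<in> I" "l \<noteq> int k" "m \<noteq> int k" "\<bar>l - m\<bar> = 1"
  shows "Delta_root l t / Delta_root m t \<le> 4"
  using Delta_root_adjacent[OF assms] Delta_root(1)[of m t] by (simp add: divide_le_eq)

lemma inverse_Delta_root:
  assumes "t \<in> I" "l \<noteq> int k"
  shows "1 / Delta_root l t \<le> 2 / sh" "1 / Delta_root l t ^ n \<le> 2 ^ n / sh ^ n"
proof -
  have "1 / Delta_root l t \<le> 1 / (sh / 2)"
    using Delta_root_nonres(1)[OF assms] sh(1) Delta_root(1)[of l t] by (intro divide_left_mono) auto
  then show 1: "1 / Delta_root l t \<le> 2 / sh" by simp
  have "(1 / Delta_root l t) ^ n \<le> (2 / sh) ^ n"
    using 1 Delta_root(1)[of l t] by (intro power_mono) auto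
  then show "1 / Delta_root l t ^ n \<le> 2 ^ n / sh ^ n"
    by (simp add: power_divide)
qed

lemma adjacent_imp:
  assumes "adjacent m" shows "m \<noteq> int k" "m = int k - 1 \<or> m = int k + 1"
  using assms by (auto simp: adjacent_def abs_if split: if_splits)

text \<open>\<xi> = k \<eta>. In ZZ and QQ the weights contribute \<eta>^(-2) and f = O(1); in QZ
  they contribute only \<eta>^(-1), but g = O(1/\<eta>). All three are O(k/\<eta>).\<close>

lemma coefficients_nonres:
  assumes t: "t \<in> I" and l: "l \<noteq> int k" and m: "m \<noteq> int k" "\<bar>l - m\<bar> = 1"
  shows "\<bar>coupling_ZZ l m t\<bar> \<le> 12 * F * inv_width" "\<bar>coupling_QZ l m t\<bar> \<le> 8 * F * inv_width" "\<bar>coupling_QQ l m t\<bar> \<le> 4 * F * inv_width"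
proof -
  have ml: "\<bar>m - l\<bar> = 1" using m by simp
  note pos = Delta_root(1)[of l t] Delta_root(1)[of m t] sh(1)
  have a: "1 / (Delta_root l t * Delta_root m t ^ 3) \<le> 16 / sh ^ 4"
  proof -
    have "1 / Delta_root l t * (1 / Delta_root m t ^ 3) \<le> 2 / sh * (2 ^ 3 / sh ^ 3)"
      using inverse_Delta_root(1)[OF t l] inverse_Delta_root(2)[OF t m(1), of 3] pos by (intro mult_mono) auto
    then show ?thesis by (simp add: power_numeral_reduce)
  qed
  have b: "Delta_root i t / (Delta_root j t * (1 + t\<^sup>2)) \<le> 8 / sh ^ 4"
    if "Delta_root i t / Delta_root j t \<le> 4" for i j
  proof -
    have "Delta_root i t / Delta_root j t * (1 / (1 + t\<^sup>2)) \<le> 4 * (2 / sh ^ 4)"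
      using that inv_t_bound[OF t] Delta_root(1)[of i t] Delta_root(1)[of j t] by (intro mult_mono) auto
    then show ?thesis by simp
  qed
  have c: "Delta_root l t / Delta_root m t ^ 3 \<le> 16 / sh\<^sup>2"
  proof -
    have "Delta_root l t / Delta_root m t * (1 / (Delta_root m t)\<^sup>2) \<le> 4 * (2\<^sup>2 / sh\<^sup>2)"
      using Delta_root_ratio[OF t l m] inverse_Delta_root(2)[OF t m(1), of 2] pos by (intro mult_mono) auto
    then show ?thesis by (simp add: power_numeral_reduce)
  qed
  have "\<bar>coupling_ZZ l m t\<bar> \<le> sk\<^sup>2 * sh\<^sup>2 / 2 * F * (16 / sh ^ 4 + 8 / sh ^ 4)"
    unfolding coupling_ZZ_def using a b[OF Delta_root_ratio[OF t m(1) l ml]] pos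
    by (intro coefficient_f t add_mono) (auto intro!: add_nonneg_nonneg)
  also have "\<dots> = 12 * F * inv_width"
    using sh(1) by (simp add: inv_width_def power_numeral_reduce)
  finally show "\<bar>coupling_ZZ l m t\<bar> \<le> 12 * F * inv_width" .
  have "\<bar>coupling_QZ l m t\<bar> \<le> sk\<^sup>2 * sh\<^sup>2 / 2 * (F / sh\<^sup>2) * (16 / sh\<^sup>2)"
    unfolding coupling_QZ_def using c pos by (intro coefficient_g t) auto
  also have "\<dots> = 8 * F * inv_width"
    using sh(1) by (simp add: inv_width_def)
  finally show "\<bar>coupling_QZ l m t\<bar> \<le> 8 * F * inv_width" .
  have "\<bar>coupling_QQ l m t\<bar> \<le> sk\<^sup>2 * sh\<^sup>2 / 2 * F * (8 / sh ^ 4)"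
    unfolding coupling_QQ_def using b[OF Delta_root_ratio[OF t l m]] pos by (intro coefficient_f t) auto
  also have "\<dots> = 4 * F * inv_width"
    using sh(1) by (simp add: inv_width_def power_numeral_reduce)
  finally show "\<bar>coupling_QQ l m t\<bar> \<le> 4 * F * inv_width" .
qed

lemma Delta_root_k_le:
  assumes "t \<in> I"
  shows "Delta_root (int k) t \<le> 2 * sh"
  using Delta_root_k_upper[OF assms] by (simp add: Delta_root_k)

lemma Delta_root_over_k: "t \<in> I \<Longrightarrow> adjacent l \<Longrightarrow> Delta_root l t / Delta_root (int k) t \<le> 3 * theta t"
  using Delta_root_neighbour[of t l] sk(2) res_root(1)[of t]
  by (simp add: adjacent_def Delta_root_k theta_def divide_right_mono)

text \<open>These are the couplings out of k that survive the shift: the part of ZZ carrying 1 / (1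
  + t^2), and QQ. The main part of ZZ and all of QZ, which are too large for Gronwall, are cancelled
  exactly in \<open>shift_cancels_coupling\<close>.\<close>

lemma coefficients_from_k:
  assumes t: "t \<in> I" and l: "adjacent l"
  shows "\<bar>\<xi> / 2 * f t * (Delta_root (int k) t / (Delta_root l t * (1 + t\<^sup>2)))\<bar> \<le> 4 * F * inv_width"
    "\<bar>coupling_QQ l (int k) t\<bar> \<le> 3 * F * rho t"
proof -
  note pos = Delta_root(1)[of l t] Delta_root(1)[of "int k" t] sh(1)
  have "Delta_root (int k) t * (1 / Delta_root l t) * (1 / (1 + t\<^sup>2)) \<le> 2 * sh * (2 / sh) * (2 / sh ^ 4)"
    using Delta_root_k_le[OF t] inverse_Delta_root(1)[OF t adjacent_imp(1)[OF l]] inv_t_bound[OF t] pos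
    by (intro mult_mono) auto
  then have "Delta_root (int k) t / (Delta_root l t * (1 + t\<^sup>2)) \<le> 8 / sh ^ 4"
    using pos by simp
  then have "\<bar>\<xi> / 2 * f t * (Delta_root (int k) t / (Delta_root l t * (1 + t\<^sup>2)))\<bar> \<le> sk\<^sup>2 * sh\<^sup>2 / 2 * F * (8 / sh ^ 4)"
    using pos by (intro coefficient_f t) auto
  also have "\<dots> = 4 * F * inv_width"
    using sh(1) by (simp add: inv_width_def power_numeral_reduce)
  finally show "\<bar>\<xi> / 2 * f t * (Delta_root (int k) t / (Delta_root l t * (1 + t\<^sup>2)))\<bar> \<le> 4 * F * inv_width" .
  have "Delta_root l t / Delta_root (int k) t * (1 / (1 + t\<^sup>2)) \<le> 3 * theta t * (2 / sh ^ 4)"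
    using Delta_root_over_k[OF t l] inv_t_bound[OF t] pos theta_pos[of t] by (intro mult_mono) auto
  then have "\<bar>coupling_QQ l (int k) t\<bar> \<le> sk\<^sup>2 * sh\<^sup>2 / 2 * F * (3 * theta t * (2 / sh ^ 4))"
    unfolding coupling_QQ_def using pos by (intro coefficient_f t) auto
  also have "\<dots> = 3 * F * (inv_width * theta t)"
    using sh(1) by (simp add: inv_width_def power_numeral_reduce)
  finally show "\<bar>coupling_QQ l (int k) t\<bar> \<le> 3 * F * rho t" by (simp add: inv_width_theta)
qed

text \<open>Couplings into k are harmless. The gain 1 / \<open>theta\<close> in the equation for Q_k
  has to be kept, since this forcing is multiplied by a shift of size \<open>theta\<close> when the
  shifted unknowns are differentiated.\<close>

lemma coefficients_to_k:
  assumes t: "t \<in> I" and m: "adjacent m"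
  shows "\<bar>coupling_ZZ (int k) m t\<bar> \<le> 7 * F * rho t" "\<bar>coupling_QZ (int k) m t\<bar> \<le> 4 * F * (inv_width / theta t)"
    "\<bar>coupling_QQ (int k) m t\<bar> \<le> 4 * F * (inv_width / theta t)"
proof -
  note m' = adjacent_imp(1)[OF m]
  note pos = Delta_root(1)[of m t] Delta_root(1)[of "int k" t] sh(1)
  have k1: "1 / Delta_root (int k) t = theta t / sh" "Delta_root (int k) t = sh / theta t"
    using sh(1) sk(2) res_root(1)[of t] by (auto simp: Delta_root_k theta_def)
  have "1 / Delta_root (int k) t * (1 / Delta_root m t ^ 3) \<le> theta t / sh * (2 ^ 3 / sh ^ 3)"
    using inverse_Delta_root(2)[OF t m', of 3] pos theta_pos[of t] unfolding k1(1) by (intro mult_mono) auto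
  moreover have "Delta_root m t / Delta_root (int k) t * (1 / (1 + t\<^sup>2)) \<le> 3 * theta t * (2 / sh ^ 4)"
    using Delta_root_over_k[OF t m] inv_t_bound[OF t] pos theta_pos[of t] by (intro mult_mono) auto
  ultimately have "1 / (Delta_root (int k) t * Delta_root m t ^ 3) + Delta_root m t / (Delta_root (int k) t * (1 + t\<^sup>2))
      \<le> theta t / sh * (2 ^ 3 / sh ^ 3) + 3 * theta t * (2 / sh ^ 4)"
    by simp
  then have "\<bar>coupling_ZZ (int k) m t\<bar> \<le> sk\<^sup>2 * sh\<^sup>2 / 2 * F * (theta t / sh * (2 ^ 3 / sh ^ 3) + 3 * theta t * (2 / sh ^ 4))"
    unfolding coupling_ZZ_def using pos by (intro coefficient_f t) (auto intro!: add_nonneg_nonneg)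
  also have "\<dots> = 7 * F * (inv_width * theta t)"
    using sh(1) by (simp add: inv_width_def power_numeral_reduce distrib_left)
  finally show "\<bar>coupling_ZZ (int k) m t\<bar> \<le> 7 * F * rho t" by (simp add: inv_width_theta)
  have "Delta_root (int k) t * (1 / Delta_root m t ^ 3) \<le> sh / theta t * (2 ^ 3 / sh ^ 3)"
    using inverse_Delta_root(2)[OF t m', of 3] pos theta_pos[of t] unfolding k1(2) by (intro mult_mono) auto
  then have "\<bar>coupling_QZ (int k) m t\<bar> \<le> sk\<^sup>2 * sh\<^sup>2 / 2 * (F / sh\<^sup>2) * (sh / theta t * (2 ^ 3 / sh ^ 3))"
    unfolding coupling_QZ_def using pos by (intro coefficient_g t) auto
  also have "\<dots> = 4 * F * (inv_width / theta t)"
    using sh(1) by (simp add: inv_width_def power_numeral_reduce mult_ac)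
  finally show "\<bar>coupling_QZ (int k) m t\<bar> \<le> 4 * F * (inv_width / theta t)" .
  have "Delta_root (int k) t * (1 / Delta_root m t) * (1 / (1 + t\<^sup>2)) \<le> sh / theta t * (2 / sh) * (2 / sh ^ 4)"
    using inverse_Delta_root(1)[OF t m'] inv_t_bound[OF t] pos theta_pos[of t] unfolding k1(2)
    by (intro mult_mono) auto
  then have "\<bar>coupling_QQ (int k) m t\<bar> \<le> sk\<^sup>2 * sh\<^sup>2 / 2 * F * (sh / theta t * (2 / sh) * (2 / sh ^ 4))"
    unfolding coupling_QQ_def using pos by (intro coefficient_f t) auto
  also have "\<dots> = 2 * F * (inv_width / theta t)"
    using sh(1) by (simp add: inv_width_def power_numeral_reduce mult_ac)
  also have "\<dots> \<le> 4 * F * (inv_width / theta t)"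
    using F inv_width_pos theta_pos[of t] by (intro mult_right_mono) auto
  finally show "\<bar>coupling_QQ (int k) m t\<bar> \<le> 4 * F * (inv_width / theta t)" .
qed

lemma symbol_bounds:
  shows "\<bar>L_symbol l t\<bar> \<le> \<bar>M_symbol l t\<bar>" "t \<in> I \<Longrightarrow> l \<noteq> int k \<Longrightarrow> \<bar>M_symbol l t\<bar> \<le> 8 * inv_width"
    "t \<in> I \<Longrightarrow> l \<noteq> int k \<Longrightarrow> \<bar>L_symbol l t\<bar> \<le> 8 * inv_width"
proof -
  have "\<bar>L_symbol l t\<bar> = \<bar>of_int l\<bar> * (\<bar>\<xi> - of_int l * t\<bar> / Delta_root l t ^ 4)"
    using Delta_root(1)[of l t] by (simp add: L_symbol_def abs_mult abs_divide)
  also have "\<dots> \<le> \<bar>of_int l\<bar> * ((Delta_root l t)\<^sup>2 / Delta_root l t ^ 4)"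
    using xi_le_Delta_root[of l t] Delta_root(1)[of l t] by (intro mult_left_mono divide_right_mono) auto
  also have "\<dots> = \<bar>M_symbol l t\<bar>"
    using Delta_root(1)[of l t] by (simp add: M_symbol_def abs_divide power_numeral_reduce)
  finally show 1: "\<bar>L_symbol l t\<bar> \<le> \<bar>M_symbol l t\<bar>" .
  show 2: "\<bar>M_symbol l t\<bar> \<le> 8 * inv_width" if "t \<in> I" "l \<noteq> int k"
    using Delta_root_nonres(2)[OF that] Delta_root(1)[of l t] by (simp add: M_symbol_def inv_width_def abs_divide)
  show "\<bar>L_symbol l t\<bar> \<le> 8 * inv_width" if "t \<in> I" "l \<noteq> int k"
    using 1 2[OF that] by linarith
qed

text \<open>At the resonance \<open>theta\<close> reaches (\<eta>/k)^(1/2), so the bound becomes 3 F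
  X; this is the only source of the growth.\<close>

lemma shift_bound:
  assumes t: "t \<in> I"
  shows "\<bar>shift_Z l t\<bar> \<le> 3 * F * (\<epsilon> * sh) * theta t" "\<bar>shift_Q l t\<bar> \<le> 3 * F * (\<epsilon> * sh) * theta t"
proof -
  have local_size: "0 \<le> 3 * F * (\<epsilon> * sh) * theta t"
    using F \<epsilon> sh(1) theta_pos[of t] by simp
  note pos = Delta_root(1)[of l t] Delta_root(1)[of "int k" t] sh(1)
  have k1: "1 / Delta_root (int k) t = theta t / sh"
    using sh(1) sk(2) res_root(1)[of t] by (auto simp: Delta_root_k theta_def)
  show "\<bar>shift_Z l t\<bar> \<le> 3 * F * (\<epsilon> * sh) * theta t"
  proof (cases "adjacent l")
    case True
    have "\<bar>shift_Z l t\<bar> = shift_scale * (\<bar>f t\<bar> * (1 / Delta_root l t) * (1 / Delta_root (int k) t))"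
      using True pos shift_scale(1) by (simp add: shift_Z_def abs_mult abs_divide)
    also have "\<dots> \<le> sh\<^sup>2 * (F * (\<epsilon> * sh) * (2 / sh) * (theta t / sh))"
      unfolding k1 using f_bound(1)[OF t] inverse_Delta_root(1)[OF t adjacent_imp(1)[OF True]] shift_scale F \<epsilon> theta_pos[of t] pos
      by (intro mult_mono) auto
    also have "\<dots> = 2 * F * (\<epsilon> * sh) * theta t"
      using sh(1) by (simp add: power2_eq_square)
    also have "\<dots> \<le> 3 * F * (\<epsilon> * sh) * theta t"
      using F \<epsilon> sh(1) theta_pos[of t] by (intro mult_right_mono) auto
    finally show ?thesis .
  qed (use local_size in \<open>simp add: shift_Z_def\<close>)
  show "\<bar>shift_Q l t\<bar> \<le> 3 * F * (\<epsilon> * sh) * theta t"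
  proof (cases "adjacent l")
    case True
    have "\<bar>shift_Q l t\<bar> = shift_scale * (\<bar>g t\<bar> * (Delta_root l t / Delta_root (int k) t))"
      using True pos shift_scale(1) by (simp add: shift_Q_def abs_mult abs_divide)
    also have "\<dots> \<le> sh\<^sup>2 * (F * (\<epsilon> * sh) / sh\<^sup>2 * (3 * theta t))"
      using g_bound(1)[OF t] Delta_root_over_k[OF t True] shift_scale F \<epsilon> theta_pos[of t] pos
      by (intro mult_mono) auto
    also have "\<dots> = 3 * F * (\<epsilon> * sh) * theta t"
      using sh(1) by simp
    finally show ?thesis .
  qed (use local_size in \<open>simp add: shift_Q_def\<close>)
qed

lemma shift_bound':
  assumes t: "t \<in> I"
  shows "\<bar>shift_Z l t\<bar> \<le> 3 * F * theta t" "\<bar>shift_Q l t\<bar> \<le> 3 * F * theta t"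
proof -
  have "3 * F * (\<epsilon> * sh) * theta t \<le> 3 * F * 1 * theta t"
    using eps_sh F theta_pos[of t] by (intro mult_right_mono mult_left_mono) auto
  then show "\<bar>shift_Z l t\<bar> \<le> 3 * F * theta t" "\<bar>shift_Q l t\<bar> \<le> 3 * F * theta t"
    using shift_bound[OF t, of l] by auto
qed

text \<open>
  The derivatives of the shifts, apart from \<open>L\<^sub>k / 2\<close> times the shift itself: that term cancels
  against the diagonal term of the equation for \<open>Q\<^sub>k\<close>.
\<close>

definition "shift_Z_rem l t = shift_scale * (g t / (Delta_root l t * Delta_root (int k) t)) + L_symbol l t / 2 * shift_Z l t"
definition "shift_Q_rem l t = shift_scale * (- \<alpha> * f t / (1 + t\<^sup>2) * (Delta_root l t / Delta_root (int k) t)) - L_symbol l t / 2 * shift_Q l t"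

text \<open>Apart from \<Delta>_k, every factor of a shift varies slowly: differentiating f or g
  gains 1/\<eta>, differentiating the weight \<Delta>_l gains k/\<eta>. Either gain turns
  \<open>theta\<close> into at most a multiple of \<open>rho\<close>.\<close>

lemma shift_rem_bound:
  assumes t: "t \<in> I" and l: "adjacent l"
  shows "\<bar>shift_Z_rem l t\<bar> \<le> 14 * F * rho t" "\<bar>shift_Q_rem l t\<bar> \<le> (6 * \<alpha> + 12) * F * rho t"
proof -
  note pos = Delta_root(1)[of l t] Delta_root(1)[of "int k" t] sh(1)
  note l' = adjacent_imp(1)[OF l]
  have k1: "1 / Delta_root (int k) t = theta t / sh"
    using sh(1) sk(2) res_root(1)[of t] by (auto simp: Delta_root_k theta_def)
  have L: "\<bar>L_symbol l t / 2 * c\<bar> \<le> 12 * F * rho t" if "\<bar>c\<bar> \<le> 3 * F * theta t" for c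
  proof -
    have "\<bar>L_symbol l t / 2\<bar> * \<bar>c\<bar> \<le> 4 * inv_width * (3 * F * theta t)"
      using symbol_bounds(3)[OF t l'] that inv_width_pos by (intro mult_mono) auto
    then show ?thesis by (simp add: abs_mult mult_ac flip: inv_width_theta)
  qed
  have th: "1 / sh\<^sup>2 * theta t \<le> rho t"
    unfolding inv_width_theta[symmetric] using inv_eta_le theta_pos[of t] by (intro mult_right_mono) auto
  have "\<bar>shift_scale * (g t / (Delta_root l t * Delta_root (int k) t))\<bar> = shift_scale * (\<bar>g t\<bar> * (1 / Delta_root l t) * (1 / Delta_root (int k) t))"
    using pos shift_scale(1) by (simp add: abs_mult abs_divide)
  also have "\<dots> \<le> sh\<^sup>2 * (F / sh\<^sup>2 * (2 / sh) * (theta t / sh))"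
    unfolding k1 using g_bound(2)[OF t] inverse_Delta_root(1)[OF t l'] shift_scale F theta_pos[of t] pos
    by (intro mult_mono) auto
  also have "\<dots> = 2 * F * (1 / sh\<^sup>2 * theta t)"
    using sh(1) by (simp add: power2_eq_square)
  also have "\<dots> \<le> 2 * F * rho t"
    using th F by (intro mult_left_mono) auto
  finally show "\<bar>shift_Z_rem l t\<bar> \<le> 14 * F * rho t"
    using L[OF shift_bound'(1)[OF t, of l]] unfolding shift_Z_rem_def by linarith
  have "\<bar>shift_scale * (- \<alpha> * f t / (1 + t\<^sup>2) * (Delta_root l t / Delta_root (int k) t))\<bar>
      = shift_scale * (\<alpha> * \<bar>f t\<bar> * (1 / (1 + t\<^sup>2)) * (Delta_root l t / Delta_root (int k) t))"
    using pos shift_scale(1) \<alpha> by (simp add: abs_mult abs_divide)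
  also have "\<dots> \<le> sh\<^sup>2 * (\<alpha> * F * (2 / sh ^ 4) * (3 * theta t))"
    using f_bound(2)[OF t] inv_t_bound[OF t] Delta_root_over_k[OF t l] shift_scale F theta_pos[of t] pos \<alpha>
    by (intro mult_mono) auto
  also have "\<dots> = 6 * \<alpha> * F * (1 / sh\<^sup>2 * theta t)"
    using sh(1) by (simp add: power_numeral_reduce)
  also have "\<dots> \<le> 6 * \<alpha> * F * rho t"
    using th F \<alpha> by (intro mult_left_mono) auto
  finally show "\<bar>shift_Q_rem l t\<bar> \<le> (6 * \<alpha> + 12) * F * rho t"
    using L[OF shift_bound'(2)[OF t, of l]] unfolding shift_Q_rem_def distrib_right by linarith
qed

text \<open>The increase \<open>d\<close> of \<open>\<alpha>\<close> that the shift causes in the equation for \<open>Z\<^sub>k\<close>, and its derivative.\<close>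

definition "alpha_shift t = sh ^ 4 / 4 * (f t)\<^sup>2 *
  (1 / Delta_root (int k - 1) t ^ 4 + 1 / Delta_root (int k + 1) t ^ 4 + 2 / (1 + t\<^sup>2))"
definition "alpha_shift' t = sh ^ 4 / 4 * (2 * f t * g t *
    (1 / Delta_root (int k - 1) t ^ 4 + 1 / Delta_root (int k + 1) t ^ 4 + 2 / (1 + t\<^sup>2))
  + (f t)\<^sup>2 * (2 * L_symbol (int k - 1) t / Delta_root (int k - 1) t ^ 4 + 2 * L_symbol (int k + 1) t / Delta_root (int k + 1) t ^ 4
      - 4 * t / (1 + t\<^sup>2)\<^sup>2))"

text \<open>The bracket is O(\<eta>^(-2)), hence \<open>alpha_shift\<close> is O(1); its derivative
  involves only f, g and nonresonant weights, which gains k/\<eta>.\<close>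

lemma alpha_shift_bound:
  assumes t: "t \<in> I"
  shows "0 \<le> alpha_shift t" "alpha_shift t \<le> 9 * F\<^sup>2" "\<bar>alpha_shift' t\<bar> \<le> 300 * F\<^sup>2 * rho t"
proof -
  define S where "S = 1 / Delta_root (int k - 1) t ^ 4 + 1 / Delta_root (int k + 1) t ^ 4 + 2 / (1 + t\<^sup>2)"
  define S' where "S' = 2 * L_symbol (int k - 1) t / Delta_root (int k - 1) t ^ 4
      + 2 * L_symbol (int k + 1) t / Delta_root (int k + 1) t ^ 4 - 4 * t / (1 + t\<^sup>2)\<^sup>2"
  note tb = I_bounds[OF t]
  have S0: "0 \<le> S" unfolding S_def by (intro add_nonneg_nonneg) auto
  have S1: "S \<le> 36 / sh ^ 4"
    using inverse_Delta_root(2)[OF t, of "int k - 1" 4] inverse_Delta_root(2)[OF t, of "int k + 1" 4] inv_t_bound[OF t]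
    unfolding S_def by simp
  have f2: "(f t)\<^sup>2 \<le> F\<^sup>2"
    using f_bound(2)[OF t] F by (simp add: abs_le_square_iff[symmetric])
  show "0 \<le> alpha_shift t"
    unfolding alpha_shift_def S_def[symmetric] using S0 sh by simp
  have "alpha_shift t \<le> sh ^ 4 / 4 * F\<^sup>2 * (36 / sh ^ 4)"
    unfolding alpha_shift_def S_def[symmetric] using S0 S1 f2 sh by (intro mult_mono) auto
  then show "alpha_shift t \<le> 9 * F\<^sup>2" using sh(1) by simp
  have LB: "\<bar>2 * L_symbol l t / Delta_root l t ^ 4\<bar> \<le> 256 * inv_width / sh ^ 4" if "l \<noteq> int k" for l
  proof -
    have "2 * \<bar>L_symbol l t\<bar> * (1 / Delta_root l t ^ 4) \<le> 2 * (8 * inv_width) * (2 ^ 4 / sh ^ 4)"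
      using symbol_bounds(3)[OF t that] inverse_Delta_root(2)[OF t that, of 4] inv_width_pos by (intro mult_mono) auto
    then show ?thesis using Delta_root(1)[of l t] by (simp add: abs_mult abs_divide)
  qed
  have tt: "\<bar>4 * t / (1 + t\<^sup>2)\<^sup>2\<bar> \<le> 16 * inv_width / sh ^ 4"
  proof -
    have "t / (1 + t\<^sup>2) \<le> t / t\<^sup>2"
      using tb by (intro divide_left_mono) (auto intro!: mult_pos_pos add_pos_pos)
    also have "\<dots> = 1 / t" using tb by (simp add: power2_eq_square)
    also have "\<dots> \<le> 1 / (sh\<^sup>2 / 2)"
      using tb sh(1) by (intro divide_left_mono) auto
    also have "\<dots> \<le> 2 * inv_width" using inv_eta_le by simp
    finally have "4 * (t / (1 + t\<^sup>2)) * (1 / (1 + t\<^sup>2)) \<le> 4 * (2 * inv_width) * (2 / sh ^ 4)"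
      using inv_t_bound[OF t] inv_width_pos tb(3) by (intro mult_mono) (auto intro!: divide_nonneg_pos add_pos_nonneg)
    then show ?thesis using tb by (simp add: power2_eq_square)
  qed
  have S': "\<bar>S'\<bar> \<le> 528 * inv_width / sh ^ 4"
    using LB[of "int k - 1"] LB[of "int k + 1"] tt unfolding S'_def
    by (simp only: abs_le_iff) (simp add: add_divide_distrib)
  have "\<bar>alpha_shift' t\<bar> \<le> sh ^ 4 / 4 * (2 * \<bar>f t\<bar> * \<bar>g t\<bar> * S + (f t)\<^sup>2 * \<bar>S'\<bar>)"
  proof -
    have "\<bar>2 * f t * g t * S + (f t)\<^sup>2 * S'\<bar> \<le> \<bar>2 * f t * g t * S\<bar> + \<bar>(f t)\<^sup>2 * S'\<bar>"
      by (rule abs_triangle_ineq)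
    also have "\<dots> = 2 * \<bar>f t\<bar> * \<bar>g t\<bar> * S + (f t)\<^sup>2 * \<bar>S'\<bar>"
      using S0 by (simp add: abs_mult)
    finally have "sh ^ 4 / 4 * \<bar>2 * f t * g t * S + (f t)\<^sup>2 * S'\<bar>
        \<le> sh ^ 4 / 4 * (2 * \<bar>f t\<bar> * \<bar>g t\<bar> * S + (f t)\<^sup>2 * \<bar>S'\<bar>)"
      by (rule mult_left_mono) (use sh in auto)
    then show ?thesis
      unfolding alpha_shift'_def S_def[symmetric] S'_def[symmetric] by (simp add: abs_mult)
  qed
  also have "\<dots> \<le> sh ^ 4 / 4 * (2 * F * (F / sh\<^sup>2) * (36 / sh ^ 4) + F\<^sup>2 * (528 * inv_width / sh ^ 4))"
    using f_bound(2)[OF t] g_bound(2)[OF t] S0 S1 S' f2 F sh(1) by (intro mult_left_mono add_mono mult_mono) auto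
  also have "\<dots> = F\<^sup>2 * (18 * (1 / sh\<^sup>2) + 132 * inv_width)"
    using sh(1) by (simp add: power_numeral_reduce field_simps)
  also have "\<dots> \<le> F\<^sup>2 * (300 * rho t)"
    using inv_eta_le inv_width_le_rho[OF t] by (intro mult_left_mono) auto
  finally show "\<bar>alpha_shift' t\<bar> \<le> 300 * F\<^sup>2 * rho t" by (simp add: mult_ac)
qed

section \<open>Exact cancellations and derivatives of the coefficients\<close>

lemma half_xi: "\<xi> / 2 = sk\<^sup>2 * sh\<^sup>2 / 2"
  by (simp flip: xi_eq)

text \<open>Writing Z_{k+1} and Z_{k-1} as shifted unknown plus i times shift times Q_k produces i *
  i = -1 in the equation for Z_k, that is, a term of the same form and sign as - sqrt \<alpha> M_k
  Q_k. It is nonnegative relative to M_k because coupling and shift both carry f.\<close>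

lemma sum_coupling_shift:
  "(\<Sum>m\<in>{int k - 1, int k + 1}. coupling_ZZ (int k) m t * shift_Z m t) = sqrt \<alpha> * M_symbol (int k) t * (alpha_shift t / \<alpha>)"
proof -
  have eq: "coupling_ZZ (int k) m t * shift_Z m t =
      sh ^ 4 * (sk\<^sup>2 / (Delta_root (int k) t)\<^sup>2) * (f t)\<^sup>2 / (4 * sqrt \<alpha>) * (1 / Delta_root m t ^ 4 + 1 / (1 + t\<^sup>2))"
    if "adjacent m" for m
  proof -
    have id: "s * h\<^sup>2 / 2 * F * (1 / (b * c ^ 3) + c / (b * u)) * (h\<^sup>2 / (2 * v) * (F / (c * b)))
        = h ^ 4 * (s / b\<^sup>2) * F\<^sup>2 / (4 * v) * (1 / c ^ 4 + 1 / u)"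
      if "0 < b" "0 < c" "0 < u" "0 < v" for b c u v F h s :: real
      using that by (simp add: field_simps power_numeral_reduce)
    have "0 < 1 + t\<^sup>2" by (simp add: add_pos_nonneg)
    note id = id[OF Delta_root(1)[of "int k" t] Delta_root(1)[of m t] this, of "sqrt \<alpha>" "sk\<^sup>2" sh "f t"]
    show ?thesis
      unfolding coupling_ZZ_def shift_Z_def shift_scale_def half_xi if_P[OF that] by (rule id) (use \<alpha> in simp)
  qed
  have "adjacent (int k - 1)" "adjacent (int k + 1)" by (auto simp: adjacent_def)
  then have "(\<Sum>m\<in>{int k - 1, int k + 1}. coupling_ZZ (int k) m t * shift_Z m t)
      = sh ^ 4 * (sk\<^sup>2 / (Delta_root (int k) t)\<^sup>2) * (f t)\<^sup>2 / (4 * sqrt \<alpha>) *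
        (1 / Delta_root (int k - 1) t ^ 4 + 1 / Delta_root (int k + 1) t ^ 4 + 2 / (1 + t\<^sup>2))"
    by (simp add: eq) (simp add: distrib_left add_divide_distrib)
  also have "\<dots> = (1 / sqrt \<alpha>) * M_symbol (int k) t * alpha_shift t"
    by (simp add: alpha_shift_def M_symbol_def sk mult_ac)
  also have "1 / sqrt \<alpha> = sqrt \<alpha> / \<alpha>"
    using \<alpha> by (simp add: real_div_sqrt field_simps)
  finally show ?thesis by simp
qed

text \<open>The derivative of Q_k contains sqrt \<alpha> M_k Z_k, so subtracting i times shift times
  Q_k removes this multiple of Z_k from the equation of a neighbour. The scale \<eta> / (2 sqrt
  \<alpha>) is fixed by matching \<xi> / 2 = k \<eta> / 2.\<close>

lemma shift_cancels_coupling: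
  assumes "adjacent l"
  shows "coupling_ZZ l (int k) t - shift_Z l t * (sqrt \<alpha> * M_symbol (int k) t)
      = \<xi> / 2 * f t * (Delta_root (int k) t / (Delta_root l t * (1 + t\<^sup>2)))"
    and "coupling_QZ l (int k) t = shift_Q l t * (sqrt \<alpha> * M_symbol (int k) t)"
proof -
  note pos = Delta_root(1)[of l t] Delta_root(1)[of "int k" t]
  have a: "sqrt \<alpha> \<noteq> 0" using \<alpha> by simp
  have "shift_Z l t * (sqrt \<alpha> * M_symbol (int k) t) = \<xi> / 2 * f t * (1 / (Delta_root l t * Delta_root (int k) t ^ 3))"
    unfolding shift_Z_def shift_scale_def M_symbol_def half_xi if_P[OF assms]
    using a pos by (simp add: sk(3)[symmetric] power_numeral_reduce mult_ac)
  then show "coupling_ZZ l (int k) t - shift_Z l t * (sqrt \<alpha> * M_symbol (int k) t)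
      = \<xi> / 2 * f t * (Delta_root (int k) t / (Delta_root l t * (1 + t\<^sup>2)))"
    by (simp add: coupling_ZZ_def algebra_simps)
  show "coupling_QZ l (int k) t = shift_Q l t * (sqrt \<alpha> * M_symbol (int k) t)"
    unfolding coupling_QZ_def shift_Q_def shift_scale_def M_symbol_def half_xi if_P[OF assms]
    using a pos by (simp add: sk(3)[symmetric] power_numeral_reduce mult_ac)
qed

lemma f_deriv: "0 < t \<Longrightarrow> (f has_real_derivative g t) (at t)"
  and g_deriv: "0 < t \<Longrightarrow> (g has_real_derivative - \<alpha> * f t / (1 + t\<^sup>2)) (at t)"
  using wave by (auto simp: wave_coefficients_def intro: has_real_derivative_at_nonneg)

text \<open>The logarithmic derivative -L/2 is the diagonal coefficient of the equation for Q. Hence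
  the factor 1 / \<Delta>_k^(1/4) in the shifts yields the term that cancels this diagonal.\<close>

lemma Delta_root_deriv: "(Delta_root l has_real_derivative - (L_symbol l t / 2) * Delta_root l t) (at t)"
proof -
  have D: "(Delta_symbol \<xi> \<midarrow>t\<rightarrow> undefined) \<or> True" by simp
  have "((\<lambda>t. (of_int l)\<^sup>2 + (\<xi> - of_int l * t)\<^sup>2) has_real_derivative
      2 * (\<xi> - of_int l * t) * - of_int l) (at t)"
    by (rule derivative_eq_intros refl | simp)+
  then have D: "((\<lambda>t. Delta_symbol \<xi> t l) has_real_derivative 2 * (\<xi> - of_int l * t) * - of_int l) (at t)"
    by (simp add: Delta_symbol_def)
  have "((\<lambda>t. Delta_symbol \<xi> t l powr (1 / 4)) has_real_derivative
      (1 / 4 * Delta_symbol \<xi> t l powr (1 / 4 - 1)) * (2 * (\<xi> - of_int l * t) * - of_int l)) (at t)"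
    by (rule DERIV_chain2[OF has_real_derivative_powr[OF Delta_pos] D])
  moreover have "Delta_symbol \<xi> t l powr (1 / 4 - 1) = Delta_root l t / Delta_root l t ^ 4"
    using Delta_pos[of t l] unfolding powr_diff by (simp add: Delta_root(2) Delta_powr(1))
  ultimately have "((\<lambda>t. Delta_root l t) has_real_derivative
      (1 / 4 * (Delta_root l t / Delta_root l t ^ 4)) * (2 * (\<xi> - of_int l * t) * - of_int l)) (at t)"
    by (simp only: Delta_powr(1))
  moreover have "(1 / 4 * (b / d)) * (2 * x * - z) = - (z * x / d / 2) * b" for b d x z :: real
    by (simp add: mult_ac)
  ultimately show ?thesis
    unfolding L_symbol_def by (simp only:)
qed

lemma shift_Z_deriv:
  assumes "0 < t" "adjacent l"
  shows "(shift_Z l has_real_derivative shift_Z_rem l t + L_symbol (int k) t / 2 * shift_Z l t) (at t)"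
proof -
  have id: "c * ((g' * (b * d) - h * (- (p / 2) * b * d + - (q / 2) * d * b)) / (b * d * (b * d)))
      = c * (g' / (b * d)) + p / 2 * (c * (h / (b * d))) + q / 2 * (c * (h / (b * d)))"
    if "0 < b" "0 < d" for b c d g' h p q :: real
    using that by (simp add: field_simps)
  have "((\<lambda>t. shift_scale * (f t / (Delta_root l t * Delta_root (int k) t))) has_real_derivative
      shift_scale * ((g t * (Delta_root l t * Delta_root (int k) t)
        - f t * (- (L_symbol l t / 2) * Delta_root l t * Delta_root (int k) t + - (L_symbol (int k) t / 2) * Delta_root (int k) t * Delta_root l t))
        / (Delta_root l t * Delta_root (int k) t * (Delta_root l t * Delta_root (int k) t)))) (at t)"
    using Delta_root(1)[of l t] Delta_root(1)[of "int k" t]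
    by (intro DERIV_cmult DERIV_divide DERIV_mult f_deriv Delta_root_deriv assms) auto
  then show ?thesis
    unfolding id[OF Delta_root(1) Delta_root(1)] using assms(2) by (simp add: shift_Z_def[abs_def] shift_Z_rem_def)
qed

lemma shift_Q_deriv:
  assumes "0 < t" "adjacent l"
  shows "(shift_Q l has_real_derivative shift_Q_rem l t + L_symbol (int k) t / 2 * shift_Q l t) (at t)"
proof -
  have id: "c * (((g' * b + - (p / 2) * b * h) * d - h * b * (- (q / 2) * d)) / (d * d))
      = c * (g' * (b / d)) - p / 2 * (c * (h * b / d)) + q / 2 * (c * (h * b / d))"
    if "0 < b" "0 < d" for b c d g' h p q :: real
    using that by (simp add: field_simps)
  have "((\<lambda>t. shift_scale * (g t * Delta_root l t / Delta_root (int k) t)) has_real_derivative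
      shift_scale * (((- \<alpha> * f t / (1 + t\<^sup>2) * Delta_root l t + - (L_symbol l t / 2) * Delta_root l t * g t) * Delta_root (int k) t
        - g t * Delta_root l t * (- (L_symbol (int k) t / 2) * Delta_root (int k) t))
        / (Delta_root (int k) t * Delta_root (int k) t))) (at t)"
    using Delta_root(1)[of l t] Delta_root(1)[of "int k" t]
    by (intro DERIV_cmult DERIV_divide DERIV_mult g_deriv Delta_root_deriv assms) auto
  then show ?thesis
    unfolding id[OF Delta_root(1) Delta_root(1)] using assms(2) by (simp add: shift_Q_def[abs_def] shift_Q_rem_def)
qed

lemma alpha_shift_deriv:
  assumes t: "0 < t"
  shows "(alpha_shift has_real_derivative alpha_shift' t) (at t)"
proof -
  have B4: "((\<lambda>t. 1 / Delta_root l t ^ 4) has_real_derivative 2 * L_symbol l t / Delta_root l t ^ 4) (at t)" for l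
  proof -
    have "((\<lambda>t. 1 / Delta_root l t ^ 4) has_real_derivative
        (0 * Delta_root l t ^ 4 - 1 * (4 * (- (L_symbol l t / 2) * Delta_root l t) * Delta_root l t ^ (4 - 1))) / (Delta_root l t ^ 4 * Delta_root l t ^ 4)) (at t)"
      using Delta_root(1)[of l t] DERIV_power[OF Delta_root_deriv[of l t], of 4]
      by (intro DERIV_divide DERIV_const) (auto simp: mult_ac)
    also have "(0 * Delta_root l t ^ 4 - 1 * (4 * (- (L_symbol l t / 2) * Delta_root l t) * Delta_root l t ^ (4 - 1))) / (Delta_root l t ^ 4 * Delta_root l t ^ 4)
        = 2 * L_symbol l t / Delta_root l t ^ 4"
      using Delta_root(1)[of l t] by (simp add: field_simps power_numeral_reduce)
    finally show ?thesis .
  qed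
  have u: "0 < 1 + t\<^sup>2" by (simp add: add_pos_nonneg)
  have u1: "((\<lambda>t. 1 + t\<^sup>2) has_real_derivative 2 * t) (at t)"
    by (rule derivative_eq_intros refl | simp)+
  have T: "((\<lambda>t. 2 / (1 + t\<^sup>2)) has_real_derivative - (4 * t / (1 + t\<^sup>2)\<^sup>2)) (at t)"
    using DERIV_divide[OF DERIV_const[of 2] u1] u by (simp add: power2_eq_square)
  have f2: "((\<lambda>t. (f t)\<^sup>2) has_real_derivative 2 * f t * g t) (at t)"
    using DERIV_power[OF f_deriv[OF t], of 2] by (simp add: mult_ac)
  have id: "c * (2 * F * G) * S + D * (c * F\<^sup>2) = c * (2 * F * G * S + F\<^sup>2 * D)"
    for c F G S D :: real
    by (simp add: algebra_simps)
  from DERIV_mult[OF DERIV_cmult[OF f2, of "sh ^ 4 / 4"]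
      DERIV_add[OF DERIV_add[OF B4[of "int k - 1"] B4[of "int k + 1"]] T]]
  show ?thesis
    unfolding alpha_shift_def[abs_def] alpha_shift'_def by (rule DERIV_cong) (simp only: id diff_conv_add_uminus)
qed

text \<open>Equal to -\<tau> / sqrt (1 + \<tau>^2), with \<tau> = t - \<xi> / k. Its derivative -(1
  + \<tau>^2)^(-3/2) is integrable uniformly in k and \<xi>.\<close>

definition "angle t = (\<xi> - real k * t) / (Delta_root (int k) t)\<^sup>2"

lemma angle: "\<bar>angle t\<bar> \<le> 1" "angle t * M_symbol (int k) t = L_symbol (int k) t"
  using xi_le_Delta_root[of "int k" t] Delta_root(1)[of "int k" t]
  by (auto simp: angle_def abs_divide divide_le_eq M_symbol_def L_symbol_def power_numeral_reduce mult_ac)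

lemma angle_deriv: "(angle has_real_derivative - (1 / res_root t ^ 6)) (at t)"
proof -
  note pos = Delta_root(1)[of "int k" t]
  have B2: "((\<lambda>t. (Delta_root (int k) t)\<^sup>2) has_real_derivative - (L_symbol (int k) t) * (Delta_root (int k) t)\<^sup>2) (at t)"
    using DERIV_power[OF Delta_root_deriv[of "int k" t], of 2] by (simp add: power2_eq_square mult_ac)
  have n: "((\<lambda>t. \<xi> - real k * t) has_real_derivative - real k) (at t)"
    by (rule derivative_eq_intros refl | simp)+
  have B4: "Delta_root (int k) t ^ 4 = (real k)\<^sup>2 + (\<xi> - real k * t)\<^sup>2"
    by (simp add: Delta_root Delta_symbol_def)
  have B6: "Delta_root (int k) t ^ 6 = real k ^ 3 * res_root t ^ 6"
    using power_mult[of sk 2 3] by (simp add: Delta_root_k power_mult_distrib sk)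
  have "(- real k * (Delta_root (int k) t)\<^sup>2 - (\<xi> - real k * t) * (- (L_symbol (int k) t) * (Delta_root (int k) t)\<^sup>2))
      / ((Delta_root (int k) t)\<^sup>2 * (Delta_root (int k) t)\<^sup>2)
      = (- real k * Delta_root (int k) t ^ 4 + real k * (\<xi> - real k * t)\<^sup>2) / Delta_root (int k) t ^ 6"
    using pos by (simp add: L_symbol_def field_simps power_numeral_reduce)
  also have "\<dots> = - (real k ^ 3) / Delta_root (int k) t ^ 6"
    unfolding B4 by (simp add: algebra_simps power_numeral_reduce)
  also have "\<dots> = - (1 / res_root t ^ 6)"
    using k by (simp add: B6)
  finally show ?thesis
    using DERIV_divide[OF n B2] pos by (simp add: angle_def[abs_def])
qed

end

section \<open>The equations mode by mode\<close>

locale resonant_solution = resonance +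
  fixes Z Q :: "real \<Rightarrow> modes"
  assumes solution: "boussinesq_solution \<alpha> f g \<xi> (tres \<xi> k) (tres \<xi> (k - 1)) Z Q"
begin

definition "forcing_Z l t = \<i> * (coupling_ZZ l (l - 1) t *\<^sub>R Z t (l - 1) + coupling_ZZ l (l + 1) t *\<^sub>R Z t (l + 1))"
definition "forcing_Q l t = \<i> * ((coupling_QZ l (l - 1) t *\<^sub>R Z t (l - 1) + coupling_QQ l (l - 1) t *\<^sub>R Q t (l - 1))
  + (coupling_QZ l (l + 1) t *\<^sub>R Z t (l + 1) + coupling_QQ l (l + 1) t *\<^sub>R Q t (l + 1)))"

lemma mode_equations:
  assumes "tres \<xi> k < t" "t < tres \<xi> (k - 1)"
  shows "((\<lambda>s. Z s l) has_vector_derivative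
      (L_symbol l t / 2) *\<^sub>R Z t l - (sqrt \<alpha> * M_symbol l t) *\<^sub>R Q t l + forcing_Z l t) (at t)"
    and "((\<lambda>s. Q s l) has_vector_derivative
      (sqrt \<alpha> * M_symbol l t) *\<^sub>R Z t l - (L_symbol l t / 2) *\<^sub>R Q t l + forcing_Q l t) (at t)"
proof -
  obtain Z' Q' where
    d: "((\<lambda>s. Z s l) has_vector_derivative Z') (at t)" "((\<lambda>s. Q s l) has_vector_derivative Q') (at t)"
    and e: "Z' + A1 \<alpha> \<xi> t (Z t) (Q t) l = rhs1 f g \<xi> t (Z t) (Q t) l"
      "Q' + A2 \<alpha> \<xi> t (Z t) (Q t) l = rhs2 f g \<xi> t (Z t) (Q t) l"
    using solution assms unfolding boussinesq_solution_def by force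
  have L: "L_op \<xi> t u l = of_real (L_symbol l t) * u l" for u
    unfolding L_op_def multiplier_def L_symbol_def Delta_root(2) ..
  have M: "M_op \<xi> t u l = of_real (M_symbol l t) * u l" for u
    unfolding M_op_def multiplier_def M_symbol_def Delta_powr ..
  note op = multiplier_def Delta_pow_def cos_mult_def dy_def Delta_powr
  \<comment> \<open>The operators are expanded once with opaque real symbols; this pulls out the
    common factor i and leaves real coefficients for \<open>scaleR\<close>.\<close>
  have id1: "of_real p * (of_real a * ((\<i> * of_real x * (of_real b1 * z1) + \<i> * of_real x * (of_real b2 * z2)) / 2))
      + of_real v * (of_real p * (of_real a * ((\<i> * of_real x * (of_real c1 * z1) + \<i> * of_real x * (of_real c2 * z2)) / 2)))
      = \<i> * ((x / 2 * p * (a * b1 + v * (a * c1))) *\<^sub>R z1 + (x / 2 * p * (a * b2 + v * (a * c2))) *\<^sub>R z2)"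
    for p a x b1 b2 c1 c2 v :: real and z1 z2 :: complex
    by (simp add: scaleR_conv_of_real field_simps)
  have id2: "of_real r * (of_real a * ((\<i> * of_real x * (of_real b1 * z1) + \<i> * of_real x * (of_real b2 * z2)) / 2))
      + of_real v * (of_real p * (of_real a * ((\<i> * of_real x * (of_real c1 * q1) + \<i> * of_real x * (of_real c2 * q2)) / 2)))
      = \<i> * (((x / 2 * r * (a * b1)) *\<^sub>R z1 + (x / 2 * p * (v * (a * c1))) *\<^sub>R q1)
        + ((x / 2 * r * (a * b2)) *\<^sub>R z2 + (x / 2 * p * (v * (a * c2))) *\<^sub>R q2))"
    for p r a x b1 b2 c1 c2 v :: real and z1 z2 q1 q2 :: complex
    by (simp add: scaleR_conv_of_real field_simps)
  have rhs1: "rhs1 f g \<xi> t (Z t) (Q t) l = forcing_Z l t"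
    unfolding rhs1_def op id1 forcing_Z_def coupling_ZZ_def by (simp add: mult_ac)
  have rhs2: "rhs2 f g \<xi> t (Z t) (Q t) l = forcing_Q l t"
    unfolding rhs2_def op id2 forcing_Q_def coupling_QZ_def coupling_QQ_def by (simp add: mult_ac)
  have "Z' = forcing_Z l t - A1 \<alpha> \<xi> t (Z t) (Q t) l"
    using e(1) by (simp add: rhs1 algebra_simps)
  also have "\<dots> = (L_symbol l t / 2) *\<^sub>R Z t l - (sqrt \<alpha> * M_symbol l t) *\<^sub>R Q t l + forcing_Z l t"
    unfolding A1_def L M by (simp add: scaleR_conv_of_real)
  finally show "((\<lambda>s. Z s l) has_vector_derivative
      (L_symbol l t / 2) *\<^sub>R Z t l - (sqrt \<alpha> * M_symbol l t) *\<^sub>R Q t l + forcing_Z l t) (at t)"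
    using d(1) by simp
  have "Q' = forcing_Q l t - A2 \<alpha> \<xi> t (Z t) (Q t) l"
    using e(2) by (simp add: rhs2 algebra_simps)
  also have "\<dots> = (sqrt \<alpha> * M_symbol l t) *\<^sub>R Z t l - (L_symbol l t / 2) *\<^sub>R Q t l + forcing_Q l t"
    unfolding A2_def L M by (simp add: scaleR_conv_of_real)
  finally show "((\<lambda>s. Q s l) has_vector_derivative
      (sqrt \<alpha> * M_symbol l t) *\<^sub>R Z t l - (L_symbol l t / 2) *\<^sub>R Q t l + forcing_Q l t) (at t)"
    using d(2) by simp
qed

definition "shifted_Z l t = Z t l - \<i> * (shift_Z l t *\<^sub>R Q t (int k))"
definition "shifted_Q l t = Q t l - \<i> * (shift_Q l t *\<^sub>R Q t (int k))"
text \<open>The radius 2 is forced by the shift: the equation of mode l involves l - 1 and l + 1,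
  and if one of these is adjacent to k, expressing it through shifted unknowns brings in Q_k,
  possibly at distance 2 from l.\<close>

definition "local_size l t = (\<Sum>j\<in>{-2..2}. cmod (shifted_Z (l + j) t) + cmod (shifted_Q (l + j) t))"

lemma not_adjacent_k: "\<not> adjacent (int k)"
  by (simp add: adjacent_def)

lemma shifted_not_adjacent: "\<not> adjacent l \<Longrightarrow> shifted_Z l t = Z t l" "\<not> adjacent l \<Longrightarrow> shifted_Q l t = Q t l"
  by (auto simp: shifted_Z_def shifted_Q_def shift_Z_def shift_Q_def)

lemma local_size_mem:
  assumes "\<bar>m - l\<bar> \<le> 2"
  shows "cmod (shifted_Z m t) + cmod (shifted_Q m t) \<le> local_size l t"
proof -
  have "- 2 \<le> m - l \<and> m - l \<le> 2" using assms by linarith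
  then show ?thesis
    unfolding local_size_def
    using member_le_sum[of "m - l" "{-2..2}" "\<lambda>j. cmod (shifted_Z (l + j) t) + cmod (shifted_Q (l + j) t)"] by auto
qed

lemma local_size_mem2:
  assumes "\<bar>m - l\<bar> \<le> 2" "\<bar>m' - l\<bar> \<le> 2" "m \<noteq> m'"
  shows "(cmod (shifted_Z m t) + cmod (shifted_Q m t)) + (cmod (shifted_Z m' t) + cmod (shifted_Q m' t)) \<le> local_size l t"
proof -
  have "(\<Sum>j\<in>{m - l, m' - l}. cmod (shifted_Z (l + j) t) + cmod (shifted_Q (l + j) t)) \<le> local_size l t"
    unfolding local_size_def using assms by (intro sum_mono2) auto
  then show ?thesis using assms(3) by simp
qed

lemma local_size_nonneg: "0 \<le> local_size l t"
  unfolding local_size_def by (intro sum_nonneg) auto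

lemma mode_k: "\<bar>l - int k\<bar> \<le> 2 \<Longrightarrow> cmod (Z t (int k)) + cmod (Q t (int k)) \<le> local_size l t"
  using local_size_mem[of "int k" l t] shifted_not_adjacent[OF not_adjacent_k] by simp

text \<open>Undoing the shift at m costs at most 3 F \<open>theta\<close> |Q_k|, and
  \<open>inv_width * theta t = rho t\<close>. The last hypothesis says that k belongs to the window
  of l whenever a shift has to be undone.\<close>

lemma mode_bound:
  assumes t: "t \<in> I" and m: "m \<noteq> int k" "\<bar>m - l\<bar> \<le> 2" "adjacent m \<Longrightarrow> \<bar>int k - l\<bar> \<le> 2"
  shows "inv_width * cmod (Z t m) \<le> 3 * F * rho t * local_size l t" "inv_width * cmod (Q t m) \<le> 3 * F * rho t * local_size l t"
proof -
  have gen: "inv_width * cmod (z + \<i> * (c *\<^sub>R Q t (int k))) \<le> 3 * F * rho t * local_size l t"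
    if z: "cmod z \<le> cmod (shifted_Z m t) + cmod (shifted_Q m t)" and c: "\<bar>c\<bar> \<le> 3 * F * theta t"
      and c0: "\<not> adjacent m \<Longrightarrow> c = 0" for z c
  proof -
    have F2: "2 * rho t \<le> 3 * F * rho t"
      using F rho_pos[of t] by (intro mult_right_mono) auto
    have q: "inv_width * cmod z \<le> 3 * F * rho t * (cmod (shifted_Z m t) + cmod (shifted_Q m t))"
      using z order_trans[OF inv_width_le_rho[OF t] F2] F rho_pos[of t] by (intro mult_mono) auto
    show ?thesis
    proof (cases "adjacent m")
      case False
      have "3 * F * rho t * (cmod (shifted_Z m t) + cmod (shifted_Q m t)) \<le> 3 * F * rho t * local_size l t"
        using local_size_mem[OF m(2)] F rho_pos[of t] by (intro mult_left_mono) auto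
      then show ?thesis using q c0[OF False] by simp
    next
      case True
      have "cmod (z + \<i> * (c *\<^sub>R Q t (int k))) \<le> cmod z + \<bar>c\<bar> * cmod (Q t (int k))"
        using norm_triangle_ineq[of z "\<i> * (c *\<^sub>R Q t (int k))"] by (simp add: norm_mult)
      also have "\<dots> \<le> cmod z + 3 * F * theta t * cmod (Q t (int k))"
        using c by (intro add_left_mono mult_right_mono) auto
      finally have "inv_width * cmod (z + \<i> * (c *\<^sub>R Q t (int k)))
          \<le> inv_width * (cmod z + 3 * F * theta t * cmod (Q t (int k)))"
        using inv_width_pos by (intro mult_left_mono) auto
      also have "\<dots> = inv_width * cmod z + 3 * F * (inv_width * theta t) * cmod (shifted_Q (int k) t)"
        by (simp add: algebra_simps shifted_not_adjacent(2)[OF not_adjacent_k])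
      also have "\<dots> = inv_width * cmod z + 3 * F * rho t * cmod (shifted_Q (int k) t)"
        by (simp only: inv_width_theta)
      also have "\<dots> \<le> 3 * F * rho t * (cmod (shifted_Z m t) + cmod (shifted_Q m t))
          + 3 * F * rho t * (cmod (shifted_Z (int k) t) + cmod (shifted_Q (int k) t))"
        using q F rho_pos[of t] by (intro add_mono mult_left_mono) auto
      also have "\<dots> \<le> 3 * F * rho t * local_size l t"
        unfolding distrib_left[symmetric] using local_size_mem2[OF m(2) m(3)[OF True] m(1)] F rho_pos[of t]
        by (intro mult_left_mono) auto
      finally show ?thesis .
    qed
  qed
  show "inv_width * cmod (Z t m) \<le> 3 * F * rho t * local_size l t"
    using gen[of "shifted_Z m t" "shift_Z m t"] shift_bound'[OF t, of m] by (auto simp: shifted_Z_def shift_Z_def)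
  show "inv_width * cmod (Q t m) \<le> 3 * F * rho t * local_size l t"
    using gen[of "shifted_Q m t" "shift_Q m t"] shift_bound'[OF t, of m] by (auto simp: shifted_Q_def shift_Q_def)
qed

lemma norm_inv_width_scaled:
  assumes "\<bar>c\<bar> \<le> b * inv_width" "inv_width * cmod u \<le> N" "0 \<le> b"
  shows "cmod (c *\<^sub>R u) \<le> b * N" "cmod (\<i> * (c *\<^sub>R u)) \<le> b * N"
proof -
  have "\<bar>c\<bar> * cmod u \<le> b * inv_width * cmod u"
    using assms(1) by (intro mult_right_mono) auto
  also have "\<dots> \<le> b * N"
    unfolding mult.assoc using assms by (intro mult_left_mono) auto
  finally show "cmod (c *\<^sub>R u) \<le> b * N" "cmod (\<i> * (c *\<^sub>R u)) \<le> b * N"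
    by (auto simp: norm_mult)
qed

lemma linear_part_bound:
  assumes t: "t \<in> I" and l: "l \<noteq> int k"
  shows "cmod ((L_symbol l t / 2) *\<^sub>R Z t l - (sqrt \<alpha> * M_symbol l t) *\<^sub>R Q t l)
      \<le> (4 + 8 * sqrt \<alpha>) * (3 * F * rho t * local_size l t)"
    "cmod ((sqrt \<alpha> * M_symbol l t) *\<^sub>R Z t l - (L_symbol l t / 2) *\<^sub>R Q t l)
      \<le> (4 + 8 * sqrt \<alpha>) * (3 * F * rho t * local_size l t)"
proof -
  have "adjacent l \<Longrightarrow> \<bar>int k - l\<bar> \<le> 2" by (simp add: adjacent_def)
  note b = mode_bound[OF t l _ this, simplified]
  have L: "\<bar>L_symbol l t / 2\<bar> \<le> 4 * inv_width"
    using symbol_bounds(3)[OF t l] by simp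
  have "sqrt \<alpha> * \<bar>M_symbol l t\<bar> \<le> sqrt \<alpha> * (8 * inv_width)"
    using symbol_bounds(2)[OF t l] \<alpha> by (intro mult_left_mono) auto
  then have M: "\<bar>sqrt \<alpha> * M_symbol l t\<bar> \<le> (8 * sqrt \<alpha>) * inv_width"
    using \<alpha> by (simp add: abs_mult)
  show "cmod ((L_symbol l t / 2) *\<^sub>R Z t l - (sqrt \<alpha> * M_symbol l t) *\<^sub>R Q t l)
      \<le> (4 + 8 * sqrt \<alpha>) * (3 * F * rho t * local_size l t)"
    using norm_diff_mono[OF norm_inv_width_scaled(1)[OF L b(1)] norm_inv_width_scaled(1)[OF M b(2)]] \<alpha>
    by (simp add: distrib_right)
  show "cmod ((sqrt \<alpha> * M_symbol l t) *\<^sub>R Z t l - (L_symbol l t / 2) *\<^sub>R Q t l)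
      \<le> (4 + 8 * sqrt \<alpha>) * (3 * F * rho t * local_size l t)"
    using norm_diff_mono[OF norm_inv_width_scaled(1)[OF M b(1)] norm_inv_width_scaled(1)[OF L b(2)]] \<alpha>
    by (simp add: algebra_simps)
qed

end

subsection \<open>The shifted unknowns\<close>

context resonant_solution
begin

lemma mode_k_bound: "t \<in> I \<Longrightarrow> \<bar>l - int k\<bar> \<le> 2 \<Longrightarrow> inv_width * cmod (Z t (int k)) \<le> 3 * F * rho t * local_size l t"
  and rho_local_size: "rho t * local_size l t \<le> 3 * F * rho t * local_size l t"
proof -
  have F2: "2 * rho t \<le> 3 * F * rho t"
    using F rho_pos[of t] by (intro mult_right_mono) auto
  show "inv_width * cmod (Z t (int k)) \<le> 3 * F * rho t * local_size l t" if t: "t \<in> I" and l: "\<bar>l - int k\<bar> \<le> 2"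
  proof (intro mult_mono)
    show "inv_width \<le> 3 * F * rho t" using inv_width_le_rho[OF t] F2 by linarith
    show "cmod (Z t (int k)) \<le> local_size l t"
      using mode_k[OF l, of t] norm_ge_zero[of "Q t (int k)"] by linarith
  qed (use F rho_pos[of t] in auto)
  show "rho t * local_size l t \<le> 3 * F * rho t * local_size l t"
    using F2 rho_pos[of t] local_size_nonneg[of l t] by (intro mult_right_mono) auto
qed

definition "neighbour_size t = (cmod (Z t (int k - 1)) + cmod (Q t (int k - 1)))
  + (cmod (Z t (int k + 1)) + cmod (Q t (int k + 1)))"

lemma neighbour_size_bound:
  assumes t: "t \<in> I" and l: "\<bar>l - int k\<bar> \<le> 1"
  shows "inv_width * neighbour_size t \<le> 4 * (3 * F * rho t * local_size l t)"
proof -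
  have "inv_width * cmod (Z t m) \<le> 3 * F * rho t * local_size l t" "inv_width * cmod (Q t m) \<le> 3 * F * rho t * local_size l t"
    if "m = int k - 1 \<or> m = int k + 1" for m
    using that l by (auto intro!: mode_bound[OF t])
  from this[of "int k - 1"] this[of "int k + 1"] show ?thesis
    unfolding neighbour_size_def distrib_left by simp
qed

lemma forcing_Q_k_bound:
  assumes t: "t \<in> I"
  shows "cmod (forcing_Q (int k) t) \<le> 4 * F * (inv_width / theta t) * neighbour_size t"
proof -
  have a: "adjacent (int k - 1)" "adjacent (int k + 1)" by (auto simp: adjacent_def)
  note c1 = coefficients_to_k[OF t a(1)] and c2 = coefficients_to_k[OF t a(2)]
  have "cmod (forcing_Q (int k) t) \<le>
      (4 * F * (inv_width / theta t) * cmod (Z t (int k - 1)) + 4 * F * (inv_width / theta t) * cmod (Q t (int k - 1)))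
    + (4 * F * (inv_width / theta t) * cmod (Z t (int k + 1)) + 4 * F * (inv_width / theta t) * cmod (Q t (int k + 1)))"
    unfolding forcing_Q_def norm_mult norm_ii mult_1_left
    by (intro norm_triangle_mono norm_scaleR_le order_refl c1 c2)
  then show ?thesis
    by (simp only: neighbour_size_def distrib_left)
qed

text \<open>The shift is O(\<open>theta\<close>) and the forcing of Q_k is
  O(\<open>inv_width / theta t\<close>): the dangerous factor cancels.\<close>

lemma shifted_forcing_bound:
  assumes t: "t \<in> I" and l: "adjacent l" and c: "\<bar>c\<bar> \<le> 3 * F * theta t"
  shows "cmod (\<i> * (c *\<^sub>R forcing_Q (int k) t)) \<le> 48 * F\<^sup>2 * (3 * F * rho t * local_size l t)"
proof -
  have "cmod (\<i> * (c *\<^sub>R forcing_Q (int k) t)) \<le> 3 * F * theta t * (4 * F * (inv_width / theta t) * neighbour_size t)"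
    unfolding norm_mult norm_ii mult_1_left by (intro norm_scaleR_le c forcing_Q_k_bound t)
  also have "\<dots> = 12 * F\<^sup>2 * (inv_width * neighbour_size t)"
    using theta_pos[of t] by (simp add: power2_eq_square)
  also have "\<dots> \<le> 12 * F\<^sup>2 * (4 * (3 * F * rho t * local_size l t))"
    using neighbour_size_bound[OF t, of l] l by (intro mult_left_mono) (auto simp: adjacent_def)
  finally show ?thesis by simp
qed

lemma F_powers: "1 \<le> F\<^sup>2" "F \<le> F\<^sup>2"
proof -
  show "1 \<le> F\<^sup>2" using F by simp
  have "F * 1 \<le> F * F" using F by (intro mult_left_mono) auto
  then show "F \<le> F\<^sup>2" by (simp add: power2_eq_square)
qed

lemma sqrt_alpha_le: "sqrt \<alpha> \<le> 1 + \<alpha>"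
proof (rule real_le_lsqrt)
  show "\<alpha> \<le> (1 + \<alpha>)\<^sup>2" using \<alpha> by (simp add: power2_eq_square algebra_simps)
qed (use \<alpha> in auto)

lemma interior_I: "tres \<xi> k < t \<Longrightarrow> t < tres \<xi> (k - 1) \<Longrightarrow> t \<in> I"
  by (simp add: I_def)

definition "C1 = 90 * (1 + \<alpha>) * F\<^sup>2"

text \<open>The left-hand sides are the totals of the norm estimates below: for modes away from k,
  for the shifted Z next to k, and for the shifted Q next to k.\<close>

lemma C1_bounds:
  "4 + 8 * sqrt \<alpha> + 24 * F \<le> C1"
  "4 + 8 * sqrt \<alpha> + 30 * F + 48 * F\<^sup>2 \<le> C1"
  "4 + 8 * sqrt \<alpha> + 15 * F + (6 * \<alpha> + 12) * F + 48 * F\<^sup>2 \<le> C1"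
proof -
  have 1: "\<alpha> \<le> \<alpha> * F\<^sup>2"
    using mult_left_mono[OF F_powers(1), of \<alpha>] \<alpha> by simp
  have 2: "\<alpha> * F \<le> \<alpha> * F\<^sup>2"
    using F_powers(2) \<alpha> by (intro mult_left_mono) auto
  have C1: "C1 = 90 * F\<^sup>2 + 90 * (\<alpha> * F\<^sup>2)"
    by (simp add: C1_def algebra_simps)
  show "4 + 8 * sqrt \<alpha> + 24 * F \<le> C1" "4 + 8 * sqrt \<alpha> + 30 * F + 48 * F\<^sup>2 \<le> C1"
    using 1 F_powers sqrt_alpha_le \<alpha> unfolding C1 by linarith+
  have "(6 * \<alpha> + 12) * F = 6 * (\<alpha> * F) + 12 * F"
    by (simp add: algebra_simps)
  then show "4 + 8 * sqrt \<alpha> + 15 * F + (6 * \<alpha> + 12) * F + 48 * F\<^sup>2 \<le> C1"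
    using 1 2 F_powers sqrt_alpha_le \<alpha> unfolding C1 by linarith
qed

text \<open>Here both neighbours of l differ from k, so only nonresonant couplings occur; a
  neighbour may itself be shifted, which \<open>mode_bound\<close> accounts for.\<close>

lemma shifted_deriv_far:
  assumes t: "tres \<xi> k < t" "t < tres \<xi> (k - 1)" and l: "l \<noteq> int k" "\<not> adjacent l"
  shows "\<exists>D. (shifted_Z l has_vector_derivative D) (at t) \<and> cmod D \<le> C1 * (3 * F * rho t * local_size l t)"
    and "\<exists>D. (shifted_Q l has_vector_derivative D) (at t) \<and> cmod D \<le> C1 * (3 * F * rho t * local_size l t)"
proof -
  note tI = interior_I[OF t]
  define N where "N = 3 * F * rho t * local_size l t"
  have N: "0 \<le> N" using F rho_pos[of t] local_size_nonneg[of l t] by (simp add: N_def)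
  have m: "m \<noteq> int k" "\<bar>m - l\<bar> \<le> 2" "\<bar>l - m\<bar> = 1" "adjacent m \<Longrightarrow> \<bar>int k - l\<bar> \<le> 2"
    if "m = l - 1 \<or> m = l + 1" for m
    using that l by (auto simp: adjacent_def)
  have forcing_Z: "cmod (forcing_Z l t) \<le> 12 * F * N + 12 * F * N"
    unfolding forcing_Z_def distrib_left N_def using F
    by (intro norm_triangle_mono norm_inv_width_scaled(2)[OF coefficients_nonres(1)[OF tI l(1) m(1) m(3)]
          mode_bound(1)[OF tI m(1) m(2) m(4)]]) auto
  have forcing_Q: "cmod (forcing_Q l t) \<le> (8 * F * N + 4 * F * N) + (8 * F * N + 4 * F * N)"
    unfolding forcing_Q_def distrib_left N_def using F
    by (intro norm_triangle_mono norm_inv_width_scaled(2)[OF coefficients_nonres(2)[OF tI l(1) m(1) m(3)]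
          mode_bound(1)[OF tI m(1) m(2) m(4)]]
        norm_inv_width_scaled(2)[OF coefficients_nonres(3)[OF tI l(1) m(1) m(3)]
          mode_bound(2)[OF tI m(1) m(2) m(4)]]) auto
  have C: "(4 + 8 * sqrt \<alpha>) * N + 24 * F * N \<le> C1 * N"
    using mult_right_mono[OF C1_bounds(1) N] by (simp add: algebra_simps)
  note lin = linear_part_bound[OF tI l(1), folded N_def]
  have "shifted_Z l = (\<lambda>s. Z s l)" "shifted_Q l = (\<lambda>s. Q s l)"
    using shifted_not_adjacent[OF l(2)] by auto
  then show "\<exists>D. (shifted_Z l has_vector_derivative D) (at t) \<and> cmod D \<le> C1 * (3 * F * rho t * local_size l t)"
    "\<exists>D. (shifted_Q l has_vector_derivative D) (at t) \<and> cmod D \<le> C1 * (3 * F * rho t * local_size l t)"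
    using mode_equations[OF t, of l] norm_triangle_mono[OF lin(1) forcing_Z] norm_triangle_mono[OF lin(2) forcing_Q] C
    unfolding N_def[symmetric] by (auto intro!: exI conjI elim!: order_trans)
qed

lemma shifted_deriv_adjacent:
  assumes t: "tres \<xi> k < t" "t < tres \<xi> (k - 1)" and l: "adjacent l"
  shows "\<exists>D. (shifted_Z l has_vector_derivative D) (at t) \<and> cmod D \<le> C1 * (3 * F * rho t * local_size l t)"
    and "\<exists>D. (shifted_Q l has_vector_derivative D) (at t) \<and> cmod D \<le> C1 * (3 * F * rho t * local_size l t)"
proof -
  note tI = interior_I[OF t]
  note t0 = I_bounds(3)[OF tI]
  note lk = adjacent_imp(1)[OF l]
  define N where "N = 3 * F * rho t * local_size l t"
  have N: "0 \<le> N" using F rho_pos[of t] local_size_nonneg[of l t] by (simp add: N_def)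
  \<comment> \<open>The neighbour of l on the side away from k.\<close>
  define m where "m = 2 * l - int k"
  have m: "m \<noteq> int k" "\<bar>m - l\<bar> \<le> 2" "\<bar>l - m\<bar> = 1" "\<bar>int k - l\<bar> \<le> 2"
    using l by (auto simp: adjacent_def m_def)
  have l2: "\<bar>l - int k\<bar> \<le> 2" using l by (simp add: adjacent_def)
  have forcing_Z: "forcing_Z l t = \<i> * (coupling_ZZ l (int k) t *\<^sub>R Z t (int k) + coupling_ZZ l m t *\<^sub>R Z t m)"
    using adjacent_imp(2)[OF l] by (auto simp: forcing_Z_def m_def add_ac)
  have forcing_Q: "forcing_Q l t = \<i> * ((coupling_QZ l (int k) t *\<^sub>R Z t (int k) + coupling_QQ l (int k) t *\<^sub>R Q t (int k))
      + (coupling_QZ l m t *\<^sub>R Z t m + coupling_QQ l m t *\<^sub>R Q t m))"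
    using adjacent_imp(2)[OF l] by (auto simp: forcing_Q_def m_def add_ac)
  have Qk: "cmod (Q t (int k)) \<le> local_size l t"
    using mode_k[OF l2, of t] norm_ge_zero[of "Z t (int k)"] by linarith
  have rQ: "cmod (\<i> * (c *\<^sub>R Q t (int k))) \<le> b * F * N" if c: "\<bar>c\<bar> \<le> b * F * rho t" "0 \<le> b" for c b
  proof -
    have "cmod (\<i> * (c *\<^sub>R Q t (int k))) \<le> b * F * rho t * local_size l t"
      unfolding norm_mult norm_ii mult_1_left by (intro norm_scaleR_le c Qk)
    also have "\<dots> = b * F * (rho t * local_size l t)" by simp
    also have "\<dots> \<le> b * F * N"
      unfolding N_def using rho_local_size F c(2) by (intro mult_left_mono) auto
    finally show ?thesis .
  qed
  note lin = linear_part_bound[OF tI lk, folded N_def]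
  note mZ = mode_bound[OF tI m(1) m(2) m(4), folded N_def]
  note Zk = mode_k_bound[OF tI l2, folded N_def]
  note cn = coefficients_nonres[OF tI lk m(1) m(3)]
  note ck = coefficients_from_k[OF tI l, folded shift_cancels_coupling(1)[OF l]]
  note sF = shifted_forcing_bound[OF tI l, folded N_def]
  show "\<exists>D. (shifted_Z l has_vector_derivative D) (at t) \<and> cmod D \<le> C1 * (3 * F * rho t * local_size l t)"
  proof (intro exI conjI)
    define lp where "lp = (L_symbol l t / 2) *\<^sub>R Z t l - (sqrt \<alpha> * M_symbol l t) *\<^sub>R Q t l"
    \<comment> \<open>The derivative after two cancellations: the L_k / 2 terms of the shift and of
      Q_k drop out, and Z_k keeps only the small remainder of its coupling.\<close>
    define D where "D = lp
      + \<i> * ((coupling_ZZ l (int k) t - shift_Z l t * (sqrt \<alpha> * M_symbol (int k) t)) *\<^sub>R Z t (int k))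
      + \<i> * (coupling_ZZ l m t *\<^sub>R Z t m) - \<i> * (shift_Z_rem l t *\<^sub>R Q t (int k)) - \<i> * (shift_Z l t *\<^sub>R forcing_Q (int k) t)"
    have "(shifted_Z l has_vector_derivative (lp + forcing_Z l t) - \<i> * (shift_Z l t *\<^sub>R
          ((sqrt \<alpha> * M_symbol (int k) t) *\<^sub>R Z t (int k) - (L_symbol (int k) t / 2) *\<^sub>R Q t (int k) + forcing_Q (int k) t)
        + (shift_Z_rem l t + L_symbol (int k) t / 2 * shift_Z l t) *\<^sub>R Q t (int k))) (at t)"
      unfolding shifted_Z_def[abs_def] lp_def
      by (intro has_vector_derivative_diff has_vector_derivative_mult_right has_vector_derivative_scaleR
          mode_equations[OF t] shift_Z_deriv t0 l)
    moreover have "(lp + forcing_Z l t) - \<i> * (shift_Z l t *\<^sub>R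
          ((sqrt \<alpha> * M_symbol (int k) t) *\<^sub>R Z t (int k) - (L_symbol (int k) t / 2) *\<^sub>R Q t (int k) + forcing_Q (int k) t)
        + (shift_Z_rem l t + L_symbol (int k) t / 2 * shift_Z l t) *\<^sub>R Q t (int k)) = D"
      unfolding D_def forcing_Z by (simp add: scaleR_conv_of_real algebra_simps)
    ultimately show "(shifted_Z l has_vector_derivative D) (at t)" by simp
    have "cmod D \<le> (4 + 8 * sqrt \<alpha>) * N + 4 * F * N + 12 * F * N + 14 * F * N + 48 * F\<^sup>2 * N"
      unfolding D_def lp_def using F
      by (intro norm_triangle_mono norm_diff_mono lin norm_inv_width_scaled(2)[OF ck(1) Zk] norm_inv_width_scaled(2)[OF cn(1) mZ(1)]
          rQ shift_rem_bound(1)[OF tI l] sF shift_bound'(1)[OF tI]) auto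
    also have "\<dots> \<le> C1 * N"
      using mult_right_mono[OF C1_bounds(2) N] by (simp add: algebra_simps)
    finally show "cmod D \<le> C1 * (3 * F * rho t * local_size l t)" by (simp add: N_def)
  qed
  show "\<exists>D. (shifted_Q l has_vector_derivative D) (at t) \<and> cmod D \<le> C1 * (3 * F * rho t * local_size l t)"
  proof (intro exI conjI)
    define lp where "lp = (sqrt \<alpha> * M_symbol l t) *\<^sub>R Z t l - (L_symbol l t / 2) *\<^sub>R Q t l"
    \<comment> \<open>In this equation Z_k disappears completely, since \<open>shift_Q\<close>
      matches \<open>coupling_QZ\<close> exactly.\<close>
    define D where "D = lp + (\<i> * (coupling_QQ l (int k) t *\<^sub>R Q t (int k))
      + (\<i> * (coupling_QZ l m t *\<^sub>R Z t m) + \<i> * (coupling_QQ l m t *\<^sub>R Q t m)))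
      - \<i> * (shift_Q_rem l t *\<^sub>R Q t (int k)) - \<i> * (shift_Q l t *\<^sub>R forcing_Q (int k) t)"
    have "(shifted_Q l has_vector_derivative (lp + forcing_Q l t) - \<i> * (shift_Q l t *\<^sub>R
          ((sqrt \<alpha> * M_symbol (int k) t) *\<^sub>R Z t (int k) - (L_symbol (int k) t / 2) *\<^sub>R Q t (int k) + forcing_Q (int k) t)
        + (shift_Q_rem l t + L_symbol (int k) t / 2 * shift_Q l t) *\<^sub>R Q t (int k))) (at t)"
      unfolding shifted_Q_def[abs_def] lp_def
      by (intro has_vector_derivative_diff has_vector_derivative_mult_right has_vector_derivative_scaleR
          mode_equations[OF t] shift_Q_deriv t0 l)
    moreover have "(lp + forcing_Q l t) - \<i> * (shift_Q l t *\<^sub>R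
          ((sqrt \<alpha> * M_symbol (int k) t) *\<^sub>R Z t (int k) - (L_symbol (int k) t / 2) *\<^sub>R Q t (int k) + forcing_Q (int k) t)
        + (shift_Q_rem l t + L_symbol (int k) t / 2 * shift_Q l t) *\<^sub>R Q t (int k)) = D"
      unfolding D_def forcing_Q shift_cancels_coupling(2)[OF l] by (simp add: scaleR_conv_of_real algebra_simps)
    ultimately show "(shifted_Q l has_vector_derivative D) (at t)" by simp
    have "cmod D \<le> (4 + 8 * sqrt \<alpha>) * N + (3 * F * N + (8 * F * N + 4 * F * N))
        + (6 * \<alpha> + 12) * F * N + 48 * F\<^sup>2 * N"
      unfolding D_def lp_def using F \<alpha>
      by (intro norm_triangle_mono norm_diff_mono lin rQ ck(2) norm_inv_width_scaled(2)[OF cn(2) mZ(1)]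
          norm_inv_width_scaled(2)[OF cn(3) mZ(2)] shift_rem_bound(2)[OF tI l] sF shift_bound'(2)[OF tI]) auto
    also have "\<dots> \<le> C1 * N"
      using mult_right_mono[OF C1_bounds(3) N] by (simp add: algebra_simps)
    finally show "cmod D \<le> C1 * (3 * F * rho t * local_size l t)" by (simp add: N_def)
  qed
qed

text \<open>
  As \<open>angle = L\<^sub>k / M\<^sub>k\<close>, the contributions of \<open>L\<^sub>k\<close> and \<open>M\<^sub>k\<close> to the derivative of this energy cancel.
\<close>

definition "resonant_energy t = Z t (int k) \<bullet> Z t (int k) + (1 + alpha_shift t / \<alpha>) * (Q t (int k) \<bullet> Q t (int k))
  - angle t / sqrt \<alpha> * (Z t (int k) \<bullet> Q t (int k))"

text \<open>The neighbours enter through their shifted versions; the difference, a multiple of Q_k,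
  is accounted for by \<open>alpha_shift\<close>.\<close>

definition "resonant_forcing t = \<i> * (coupling_ZZ (int k) (int k - 1) t *\<^sub>R shifted_Z (int k - 1) t
  + coupling_ZZ (int k) (int k + 1) t *\<^sub>R shifted_Z (int k + 1) t)"

lemma resonant_energy_deriv:
  assumes t: "tres \<xi> k < t" "t < tres \<xi> (k - 1)"
  shows "(resonant_energy has_real_derivative
     2 * (Z t (int k) \<bullet> resonant_forcing t) + 2 * (1 + alpha_shift t / \<alpha>) * (Q t (int k) \<bullet> forcing_Q (int k) t)
     + alpha_shift' t / \<alpha> * (Q t (int k) \<bullet> Q t (int k))
     - angle t / sqrt \<alpha> * (Z t (int k) \<bullet> forcing_Q (int k) t + resonant_forcing t \<bullet> Q t (int k))
     + 1 / res_root t ^ 6 / sqrt \<alpha> * (Z t (int k) \<bullet> Q t (int k))) (at t)"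
proof -
  define z q where "z = Z t (int k)" and "q = Q t (int k)"
  define M d a s where "M = M_symbol (int k) t" and "d = 1 + alpha_shift t / \<alpha>" and "a = angle t" and "s = sqrt \<alpha>"
  have t0: "0 < t" using I_bounds(3)[OF interior_I[OF t]] .
  have s: "s \<noteq> 0" "0 < s" using \<alpha> by (auto simp: s_def)
  have "forcing_Z (int k) t = resonant_forcing t - (\<Sum>m\<in>{int k - 1, int k + 1}. coupling_ZZ (int k) m t * shift_Z m t) *\<^sub>R q"
    by (simp add: forcing_Z_def resonant_forcing_def shifted_Z_def scaleR_conv_of_real algebra_simps q_def)
  then have forcing_Z: "forcing_Z (int k) t = resonant_forcing t - (s * M * (alpha_shift t / \<alpha>)) *\<^sub>R q"
    by (simp only: sum_coupling_shift M_def s_def)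
  have Zd: "((\<lambda>s. Z s (int k)) has_vector_derivative (a * M / 2) *\<^sub>R z - (s * M * d) *\<^sub>R q + resonant_forcing t) (at t)"
    using mode_equations(1)[OF t, of "int k"] unfolding forcing_Z
    by (simp add: angle(2)[symmetric] scaleR_conv_of_real algebra_simps z_def q_def M_def a_def s_def d_def)
  have Qd: "((\<lambda>s. Q s (int k)) has_vector_derivative (s * M) *\<^sub>R z - (a * M / 2) *\<^sub>R q + forcing_Q (int k) t) (at t)"
    using mode_equations(2)[OF t, of "int k"]
    by (simp add: angle(2)[symmetric] z_def q_def M_def a_def s_def)
  have d1: "((\<lambda>t. 1 + alpha_shift t / \<alpha>) has_real_derivative 0 + alpha_shift' t / \<alpha>) (at t)"
    by (intro DERIV_add DERIV_const DERIV_cdivide alpha_shift_deriv t0)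
  have a1: "((\<lambda>t. angle t / sqrt \<alpha>) has_real_derivative - (1 / res_root t ^ 6) / sqrt \<alpha>) (at t)"
    by (intro DERIV_cdivide angle_deriv)
  note E1 = DERIV_diff[OF DERIV_add[OF inner_has_real_derivative[OF Zd Zd]
      DERIV_mult[OF d1 inner_has_real_derivative[OF Qd Qd]]]
      DERIV_mult[OF a1 inner_has_real_derivative[OF Zd Qd]]]
  \<comment> \<open>Cancellation of all terms with M_k. The mixed terms 2 s M d z.q cancel because
    the weight d of |q|^2 equals the enlargement of the coupling; a M |z|^2 and a d M |q|^2 cancel
    against the derivative of the cross term with coefficient a / s.\<close>
  have id: "(a * M / 2 * zz - s * M * d * zq + zp + (a * M / 2 * zz - s * M * d * zq + zp))
      + (dr * qq + (s * M * zq - a * M / 2 * qq + qf + (s * M * zq - a * M / 2 * qq + qf)) * d)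
      - (- j / s * zq + (s * M * zz - a * M / 2 * zq + zf + (a * M / 2 * zq - s * M * d * qq + pq)) * (a / s))
      = 2 * zp + 2 * d * qf + dr * qq - a / s * (zf + pq) + j / s * zq"
    for zz zq qq zp qf zf pq dr j :: real
    using s(1) by (simp add: field_simps)
  show ?thesis
    unfolding resonant_energy_def[abs_def]
    apply (rule DERIV_cong[OF E1])
    unfolding z_def[symmetric] q_def[symmetric] d_def[symmetric] a_def[symmetric] s_def[symmetric]
    using id[of "z \<bullet> z" "z \<bullet> q" "z \<bullet> resonant_forcing t" "alpha_shift' t / \<alpha>" "q \<bullet> q" "q \<bullet> forcing_Q (int k) t"
        "1 / res_root t ^ 6" "z \<bullet> forcing_Q (int k) t" "resonant_forcing t \<bullet> q"]
    by (simp add: inner_add inner_diff_left inner_diff_right inner_commute[of q z] inner_commute[of "resonant_forcing t" z]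
        inner_commute[of "forcing_Q (int k) t" q])
qed

end

subsection \<open>The energy estimate\<close>

text \<open>The constants come from undoing the shift at time t (74 \<ge> 2 + 8 * 9), introducing it
  at t_k (290 = 2 + 8 * 36), comparing energy and norm (40 above, c below), and Gronwall: 60 = 5 *
  12, for five neighbours and a weight that varies by at most 12.\<close>

definition growth_const :: "real \<Rightarrow> real \<Rightarrow> real" where
  "growth_const \<alpha> F = (let c = 1 - 1 / (2 * sqrt \<alpha>) in
     sqrt (74 * F\<^sup>2 * (290 * F\<^sup>2) * (40 * F\<^sup>2) / c * exp (60 * (10 * (9000 * (1 + \<alpha>) * F ^ 4) / c))))"

context resonance
begin

definition "c0 = 1 - 1 / (2 * sqrt \<alpha>)"

lemma c0: "0 < c0" "c0 \<le> 1"
  using sqrt_alpha \<alpha> by (auto simp: c0_def divide_less_eq)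

text \<open>
  An antiderivative of a majorant of the remaining growth rates \<open>rho + 1 / (1 + \<tau>\<^sup>2)\<close>, bounded by an
  absolute constant on the resonant interval.
\<close>

definition "growth_weight t = arctan (t - \<xi> / real k) + 2 * (sk / sh) * ((t - \<xi> / real k) / res_root t)"
definition "growth_weight' t = 1 / res_root t ^ 4 + 2 * (sk / sh) * (1 / res_root t - (t - \<xi> / real k)\<^sup>2 / (2 * res_root t ^ 5))"

lemma res_root_deriv: "(res_root has_real_derivative (t - \<xi> / real k) / (2 * res_root t ^ 3)) (at t)"
proof -
  have p: "0 < 1 + (t - \<xi> / real k)\<^sup>2" by (simp add: add_pos_nonneg)
  have D: "((\<lambda>t. 1 + (t - \<xi> / real k)\<^sup>2) has_real_derivative 2 * (t - \<xi> / real k)) (at t)"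
    by (rule derivative_eq_intros refl | simp)+
  have "(res_root has_real_derivative (1 / 4 * (1 + (t - \<xi> / real k)\<^sup>2) powr (1 / 4 - 1)) * (2 * (t - \<xi> / real k))) (at t)"
    unfolding res_root_def[abs_def] by (rule DERIV_chain2[OF has_real_derivative_powr[OF p] D])
  moreover have "(1 + (t - \<xi> / real k)\<^sup>2) powr (1 / 4 - 1) = res_root t / res_root t ^ 4"
    using p unfolding powr_diff res_root(2) by (simp add: res_root_def)
  moreover have "(1 / 4 * (j / j ^ 4)) * (2 * \<tau>) = \<tau> / (2 * j ^ 3)" if "1 \<le> j" for j \<tau> :: real
    using that by (simp add: power_numeral_reduce)
  ultimately show ?thesis
    by (simp only: res_root(1))
qed

lemma growth_weight_deriv: "(growth_weight has_real_derivative growth_weight' t) (at t)"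
proof -
  have j: "0 < res_root t" using res_root(1)[of t] by simp
  have t1: "((\<lambda>t. t - \<xi> / real k) has_real_derivative 1) (at t)"
    by (rule derivative_eq_intros refl | simp)+
  have a: "((\<lambda>t. arctan (t - \<xi> / real k)) has_real_derivative 1 / res_root t ^ 4) (at t)"
    using DERIV_chain2[OF DERIV_arctan t1] by (simp add: res_root(2) inverse_eq_divide)
  have "((\<lambda>t. (t - \<xi> / real k) / res_root t) has_real_derivative
      (1 * res_root t - (t - \<xi> / real k) * ((t - \<xi> / real k) / (2 * res_root t ^ 3))) / (res_root t * res_root t)) (at t)"
    using j by (intro DERIV_divide t1 res_root_deriv) auto
  moreover have "(1 * j - \<tau> * (\<tau> / (2 * j ^ 3))) / (j * j) = 1 / j - \<tau>\<^sup>2 / (2 * j ^ 5)"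
    if "0 < j" for j \<tau> :: real
    using that by (simp add: diff_divide_distrib power2_eq_square power_numeral_reduce mult_ac)
  ultimately have b: "((\<lambda>t. (t - \<xi> / real k) / res_root t) has_real_derivative
      1 / res_root t - (t - \<xi> / real k)\<^sup>2 / (2 * res_root t ^ 5)) (at t)"
    using j by simp
  show ?thesis
    unfolding growth_weight_def[abs_def] growth_weight'_def by (intro DERIV_add a DERIV_cmult b)
qed

lemma tau_sq_le: "(t - \<xi> / real k)\<^sup>2 \<le> res_root t ^ 4"
  by (simp add: res_root)

text \<open>Since \<tau>^2 \<le> \<open>res_root t ^ 4\<close>, the subtracted term takes away at
  most half of 1 / \<open>res_root t\<close>; the factor 2 in the weight compensates for
  this.\<close>

lemma growth_weight'_ge: "rho t + 1 / res_root t ^ 4 \<le> growth_weight' t"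
proof -
  have j: "0 < res_root t" using res_root(1)[of t] by simp
  have "(t - \<xi> / real k)\<^sup>2 / (2 * res_root t ^ 5) \<le> res_root t ^ 4 / (2 * res_root t ^ 5)"
    using tau_sq_le j by (intro divide_right_mono) auto
  also have "\<dots> = 1 / res_root t / 2"
    using j by (simp add: power_numeral_reduce)
  finally have "1 / res_root t / 2 \<le> 1 / res_root t - (t - \<xi> / real k)\<^sup>2 / (2 * res_root t ^ 5)"
    by (simp add: field_simps)
  then have "2 * (sk / sh) * (1 / res_root t / 2) \<le> 2 * (sk / sh) * (1 / res_root t - (t - \<xi> / real k)\<^sup>2 / (2 * res_root t ^ 5))"
    using sk(2) sh(1) by (intro mult_left_mono) auto
  then show ?thesis
    by (simp add: rho_def growth_weight'_def)
qed

lemma growth_weight'_nonneg: "0 \<le> growth_weight' t"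
proof -
  have "0 \<le> 1 / res_root t ^ 4" by simp
  then show ?thesis using growth_weight'_ge[of t] rho_pos[of t] by linarith
qed

lemma growth_weight'_continuous: "continuous_on A growth_weight'"
proof -
  have "continuous_on A res_root"
    using res_root_deriv by (intro DERIV_continuous_on) (rule has_field_derivative_at_within)
  moreover have "res_root t \<noteq> 0" for t using res_root(1)[of t] by simp
  ultimately show ?thesis
    unfolding growth_weight'_def[abs_def] by (intro continuous_intros) auto
qed

text \<open>|\<tau>|^(1/2) is at most \<open>res_root t\<close>, which is at most 2 (\<eta>/k)^(1/2)
  on the interval; the prefactor 2 (k/\<eta>)^(1/2) balances this.\<close>

lemma growth_weight_bound:
  assumes "t \<in> I"
  shows "\<bar>growth_weight t\<bar> \<le> 6"
proof -
  have j: "0 < res_root t" using res_root(1)[of t] by simp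
  have "\<bar>t - \<xi> / real k\<bar>\<^sup>2 \<le> ((res_root t)\<^sup>2)\<^sup>2"
    using tau_sq_le[of t] by (simp flip: power_mult)
  then have "\<bar>t - \<xi> / real k\<bar> \<le> (res_root t)\<^sup>2"
    by (rule power2_le_imp_le) simp
  then have "\<bar>t - \<xi> / real k\<bar> / res_root t \<le> res_root t"
    using j by (simp add: divide_le_eq power2_eq_square)
  then have "2 * (sk / sh) * (\<bar>t - \<xi> / real k\<bar> / res_root t) \<le> 2 * (sk / sh) * res_root t"
    using sk(2) sh(1) by (intro mult_left_mono) auto
  also have "\<dots> \<le> 4"
    using Delta_root_k_upper[OF assms] sh(1) by (simp add: divide_le_eq)
  finally have "\<bar>2 * (sk / sh) * ((t - \<xi> / real k) / res_root t)\<bar> \<le> 4"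
    using j sk(2) sh(1) by (simp add: abs_mult abs_divide)
  moreover have "\<bar>arctan (t - \<xi> / real k)\<bar> \<le> 2"
    using arctan_bounded[of "t - \<xi> / real k"] pi_less_4 by (simp add: abs_le_iff)
  ultimately show ?thesis unfolding growth_weight_def by linarith
qed

lemma theta_le: "theta t \<le> sh / sk"
proof -
  have "sk * 1 \<le> sk * res_root t" using res_root(1) sk(2) by (intro mult_left_mono) auto
  then show ?thesis
    unfolding theta_def using sk(2) sh(1) by (intro frac_le) auto
qed

text \<open>At t_k one has |\<tau>| \<ge> \<eta> / (4 k), so (1 + \<tau>^2)^(1/4) is already
  comparable to (\<eta>/k)^(1/2). Passing to shifted unknowns initially thus costs a constant and
  not X.\<close>

lemma theta_start: "theta (tres \<xi> k) \<le> 2"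
proof -
  define a where "a = tres \<xi> k"
  have j: "0 < res_root a" using res_root(1)[of a] by simp
  have "sh\<^sup>2 / (4 * sk\<^sup>2) \<le> \<bar>a - \<xi> / real k\<bar>"
    using tres_ge(3) unfolding a_def sk(3) by (simp add: sh)
  then have "(sh\<^sup>2 / (4 * sk\<^sup>2))\<^sup>2 \<le> \<bar>a - \<xi> / real k\<bar>\<^sup>2"
    by (intro power_mono) auto
  also have "\<dots> \<le> res_root a ^ 4"
    using tau_sq_le[of a] by simp
  finally have "(sh / (2 * sk)) ^ 4 \<le> res_root a ^ 4"
    by (simp add: power_divide power_mult_distrib flip: power_mult)
  then have "sh / (2 * sk) \<le> res_root a"
    by (rule power4_mono_imp) (use j in simp)
  then show ?thesis
    using sk(2) j by (simp add: theta_def a_def[symmetric] field_simps)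
qed

definition "growth_factor = \<epsilon> * sh\<^sup>2 / sk"

text \<open>Equivalent to k^3 \<le> (\<epsilon> \<xi>)^2, hence a consequence of k \<le> k_0. It
  allows bounded contributions to be absorbed into X.\<close>

lemma growth_factor_ge_1: "1 \<le> growth_factor"
proof -
  have sk6: "sk ^ 6 = real k ^ 3" using power_mult[of sk 2 3] by (simp add: sk)
  have "(\<epsilon> * \<xi>)\<^sup>2 = (\<epsilon> * (sk\<^sup>2 * sh\<^sup>2))\<^sup>2"
    by (simp flip: xi_eq)
  then have "sk ^ 6 \<le> (\<epsilon> * (sk\<^sup>2 * sh\<^sup>2))\<^sup>2"
    using resonant by (simp only: sk6)
  then have "(sk ^ 3)\<^sup>2 \<le> (\<epsilon> * (sk\<^sup>2 * sh\<^sup>2))\<^sup>2"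
    by (simp flip: power_mult)
  then have "sk ^ 3 \<le> \<epsilon> * (sk\<^sup>2 * sh\<^sup>2)"
    using \<epsilon> by (intro power2_le_imp_le[of "sk ^ 3"]) auto
  then have "sk\<^sup>2 * sk \<le> sk\<^sup>2 * (\<epsilon> * sh\<^sup>2)"
    by (simp add: power_numeral_reduce mult_ac)
  then have "sk \<le> \<epsilon> * sh\<^sup>2"
    using sk(2) by simp
  then show ?thesis
    using sk(2) by (simp add: growth_factor_def)
qed

text \<open>Only the two neighbours of k receive the extra term, whence 8 = 2 * 4.\<close>

lemma infsum_adjacent_compare:
  fixes u v :: "int \<Rightarrow> real"
  assumes v: "v summable_on UNIV" and u: "u summable_on UNIV" and local_size: "\<And>l. 0 \<le> v l"
    and le: "\<And>l. u l \<le> 2 * v l + (if adjacent l then 4 * K\<^sup>2 * v (int k) else 0)"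
  shows "infsum u UNIV \<le> (2 + 8 * K\<^sup>2) * infsum v UNIV"
proof -
  let ?d = "\<lambda>l. if adjacent l then 4 * K\<^sup>2 * v (int k) else 0"
  have adjacent: "l \<in> {int k - 1, int k + 1} \<longleftrightarrow> adjacent l" for l
    by (auto simp: adjacent_def)
  have 0: "(\<lambda>l::int. 0::real) summable_on UNIV" by simp
  have d0: "?d l = 0" if "l \<notin> {int k - 1, int k + 1}" for l
    using that unfolding adjacent by simp
  note d = infsum_finite_change[OF 0 _ d0, of "{int k - 1, int k + 1}", simplified]
  have v2: "(\<lambda>l. 2 * v l) summable_on UNIV" by (intro summable_on_cmult_right v)
  have "infsum u UNIV \<le> (\<Sum>\<^sub>\<infinity>l. 2 * v l + ?d l)"
    by (intro infsum_mono summable_on_add u v2 d(1) le)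
  also have "\<dots> = 2 * infsum v UNIV + infsum ?d UNIV"
    by (simp add: infsum_add[OF v2 d(1)] infsum_cmult_right v)
  also have "infsum ?d UNIV = 8 * K\<^sup>2 * v (int k)"
    using d(2) by (simp add: adjacent_def)
  also have "8 * K\<^sup>2 * v (int k) \<le> 8 * K\<^sup>2 * infsum v UNIV"
    using finite_sum_le_infsum[OF v, of "{int k}"] local_size by (intro mult_left_mono) auto
  finally show ?thesis by (simp add: algebra_simps)
qed

end

section \<open>Energies of the modes and their growth\<close>

context resonant_solution
begin

definition "mode_sq l t = (cmod (shifted_Z l t))\<^sup>2 + (cmod (shifted_Q l t))\<^sup>2"
definition "mode_energy l t = (if l = int k then resonant_energy t else mode_sq l t)"
definition "C2 = 9000 * (1 + \<alpha>) * F ^ 4"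

lemma mode_sq_k: "mode_sq (int k) t = (cmod (Z t (int k)))\<^sup>2 + (cmod (Q t (int k)))\<^sup>2"
  by (simp add: mode_sq_def shifted_not_adjacent[OF not_adjacent_k])

lemma mode_sq_nonneg: "0 \<le> mode_sq l t" by (simp add: mode_sq_def)

text \<open>Coercivity at k: the cross term is at most 1 / (2 sqrt \<alpha>) times |Z_k|^2 +
  |Q_k|^2, and \<open>alpha_shift\<close> only adds a nonnegative term. Above,
  \<open>alpha_shift t / \<alpha>\<close> \<le> 36 F^2 and the remainder is at most 2.\<close>

lemma mode_energy_bounds:
  assumes t: "t \<in> I"
  shows "c0 * mode_sq l t \<le> mode_energy l t" "mode_energy l t \<le> 40 * F\<^sup>2 * mode_sq l t"
proof -
  define z q where "z = cmod (Z t (int k))" and "q = cmod (Q t (int k))"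
  define r where "r = angle t / sqrt \<alpha> * (Z t (int k) \<bullet> Q t (int k))"
  have inv: "1 / sqrt \<alpha> \<le> 2" using sqrt_alpha \<alpha> by (simp add: divide_le_eq)
  have "\<bar>r\<bar> \<le> 1 / sqrt \<alpha> * (z * q)"
  proof -
    have "\<bar>angle t\<bar> * (1 / sqrt \<alpha>) * \<bar>Z t (int k) \<bullet> Q t (int k)\<bar> \<le> 1 * (1 / sqrt \<alpha>) * (z * q)"
      unfolding z_def q_def using angle(1) \<alpha>
      by (intro mult_mono Cauchy_Schwarz_ineq2 order_refl) auto
    then show ?thesis using \<alpha> by (simp add: r_def abs_mult abs_divide)
  qed
  also have "\<dots> \<le> 1 / sqrt \<alpha> * ((z\<^sup>2 + q\<^sup>2) / 2)"
    using \<alpha> sum_squares_bound[of z q] by (intro mult_left_mono) auto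
  finally have r: "\<bar>r\<bar> \<le> (1 - c0) * (z\<^sup>2 + q\<^sup>2)" by (simp add: c0_def)
  have wk: "mode_sq (int k) t = z\<^sup>2 + q\<^sup>2" by (simp add: mode_sq_k z_def q_def)
  have resonant_energy: "resonant_energy t = z\<^sup>2 + q\<^sup>2 + alpha_shift t / \<alpha> * q\<^sup>2 - r"
    by (simp add: resonant_energy_def z_def q_def r_def power2_norm_eq_inner algebra_simps)
  have d: "0 \<le> alpha_shift t / \<alpha>" "alpha_shift t / \<alpha> \<le> 36 * F\<^sup>2"
  proof -
    show "0 \<le> alpha_shift t / \<alpha>" using alpha_shift_bound[OF t] \<alpha> by simp
    have "alpha_shift t / \<alpha> \<le> 9 * F\<^sup>2 / (1 / 4)"
      using alpha_shift_bound[OF t] \<alpha> by (intro frac_le) auto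
    then show "alpha_shift t / \<alpha> \<le> 36 * F\<^sup>2" by simp
  qed
  have dq: "0 \<le> alpha_shift t / \<alpha> * q\<^sup>2" "alpha_shift t / \<alpha> * q\<^sup>2 \<le> 36 * F\<^sup>2 * q\<^sup>2"
    using d by (auto intro: mult_right_mono mult_nonneg_nonneg simp del: times_divide_eq_left)
  have "c0 * (z\<^sup>2 + q\<^sup>2) \<le> resonant_energy t"
    using r dq(1) abs_ge_self[of r] unfolding resonant_energy left_diff_distrib mult_1_left by linarith
  moreover have "resonant_energy t \<le> 40 * F\<^sup>2 * (z\<^sup>2 + q\<^sup>2)"
  proof -
    have "(1 - c0) * (z\<^sup>2 + q\<^sup>2) \<le> 1 * (z\<^sup>2 + q\<^sup>2)"
      using c0 by (intro mult_right_mono) auto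
    have "resonant_energy t \<le> 2 * (z\<^sup>2 + q\<^sup>2) + 36 * F\<^sup>2 * q\<^sup>2"
    proof -
      have "- r \<le> z\<^sup>2 + q\<^sup>2"
        using \<open>_ \<le> 1 * (z\<^sup>2 + q\<^sup>2)\<close> r abs_ge_minus_self[of r] unfolding mult_1_left by linarith
      with dq(2) show ?thesis unfolding resonant_energy by simp
    qed
    also have "\<dots> \<le> 2 * F\<^sup>2 * (z\<^sup>2 + q\<^sup>2) + 36 * F\<^sup>2 * (z\<^sup>2 + q\<^sup>2)"
      using F_powers by (intro add_mono mult_mono) auto
    also have "\<dots> \<le> 40 * F\<^sup>2 * (z\<^sup>2 + q\<^sup>2)"
      by (simp flip: distrib_right)
    finally show ?thesis .
  qed
  moreover have "c0 * mode_sq l t \<le> 1 * mode_sq l t" "1 * mode_sq l t \<le> 40 * F\<^sup>2 * mode_sq l t"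
  proof -
    show "c0 * mode_sq l t \<le> 1 * mode_sq l t" by (rule mult_right_mono[OF c0(2) mode_sq_nonneg])
    have "1 \<le> 40 * F\<^sup>2" using F_powers by simp
    then show "1 * mode_sq l t \<le> 40 * F\<^sup>2 * mode_sq l t" by (rule mult_right_mono[OF _ mode_sq_nonneg])
  qed
  ultimately show "c0 * mode_sq l t \<le> mode_energy l t" "mode_energy l t \<le> 40 * F\<^sup>2 * mode_sq l t"
    by (auto simp: mode_energy_def wk)
qed

lemma local_size_sq: "(local_size l t)\<^sup>2 \<le> 10 * (\<Sum>j\<in>{-2..2}. mode_sq (l + j) t)"
proof -
  have "(local_size l t)\<^sup>2 \<le> (\<Sum>j\<in>{-2..2}. (cmod (shifted_Z (l + j) t) + cmod (shifted_Q (l + j) t))\<^sup>2) * card {-2..2::int}"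
    unfolding local_size_def by (rule sum_squared_le_sum_of_squares)
  also have "\<dots> \<le> (\<Sum>j\<in>{-2..2}. 2 * mode_sq (l + j) t) * card {-2..2::int}"
  proof (intro mult_right_mono sum_mono)
    show "(cmod (shifted_Z (l + j) t) + cmod (shifted_Q (l + j) t))\<^sup>2 \<le> 2 * mode_sq (l + j) t" for j
      using sum_squares_bound[of "cmod (shifted_Z (l + j) t)" "cmod (shifted_Q (l + j) t)"]
      by (simp add: mode_sq_def power2_sum)
  qed auto
  also have "\<dots> = 10 * (\<Sum>j\<in>{-2..2}. mode_sq (l + j) t)"
    by (simp flip: sum_distrib_left)
  finally show ?thesis .
qed

lemma F_power4: "F ^ 3 \<le> F ^ 4" "F\<^sup>2 \<le> F ^ 4" "1 \<le> F ^ 4" "F \<le> F ^ 4"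
  using F by (auto intro!: power_increasing one_le_power self_le_power)

lemma mode_energy_deriv_nonres:
  assumes t: "tres \<xi> k < t" "t < tres \<xi> (k - 1)" and l: "l \<noteq> int k"
  shows "\<exists>D. (mode_energy l has_real_derivative D) (at t) \<and> D \<le> C2 * (rho t + 1 / res_root t ^ 4) * (local_size l t)\<^sup>2"
proof -
  obtain D1 D2 where D: "(shifted_Z l has_vector_derivative D1) (at t)" "(shifted_Q l has_vector_derivative D2) (at t)"
    and b: "cmod D1 \<le> C1 * (3 * F * rho t * local_size l t)" "cmod D2 \<le> C1 * (3 * F * rho t * local_size l t)"
    using shifted_deriv_far[OF t l] shifted_deriv_adjacent[OF t] by blast
  have mode_energy: "mode_energy l = (\<lambda>t. shifted_Z l t \<bullet> shifted_Z l t + shifted_Q l t \<bullet> shifted_Q l t)"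
    using l by (simp add: mode_energy_def mode_sq_def power2_norm_eq_inner fun_eq_iff)
  have d: "(mode_energy l has_real_derivative (shifted_Z l t \<bullet> D1 + D1 \<bullet> shifted_Z l t) + (shifted_Q l t \<bullet> D2 + D2 \<bullet> shifted_Q l t)) (at t)"
    unfolding mode_energy by (intro DERIV_add inner_has_real_derivative D)
  have nnn: "cmod (shifted_Z l t) + cmod (shifted_Q l t) \<le> local_size l t" by (rule local_size_mem) simp
  define B where "B = C1 * (3 * F * rho t * local_size l t)"
  have C1: "0 \<le> C1" using \<alpha> by (simp add: C1_def)
  have B: "0 \<le> B" using b(1) norm_ge_zero[of D1] unfolding B_def by linarith
  have "shifted_Z l t \<bullet> D1 \<le> cmod (shifted_Z l t) * B" "shifted_Q l t \<bullet> D2 \<le> cmod (shifted_Q l t) * B"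
    using b unfolding B_def[symmetric]
    by (auto intro!: order_trans[OF norm_cauchy_schwarz] mult_left_mono)
  then have "(shifted_Z l t \<bullet> D1 + D1 \<bullet> shifted_Z l t) + (shifted_Q l t \<bullet> D2 + D2 \<bullet> shifted_Q l t) \<le> 2 * B * (cmod (shifted_Z l t) + cmod (shifted_Q l t))"
    by (simp add: inner_commute algebra_simps)
  also have "\<dots> \<le> 2 * B * local_size l t"
    using B nnn by (intro mult_left_mono) auto
  also have "\<dots> = 540 * (1 + \<alpha>) * F ^ 3 * rho t * (local_size l t)\<^sup>2"
    by (simp add: B_def C1_def power_numeral_reduce)
  also have "\<dots> \<le> 9000 * (1 + \<alpha>) * F ^ 4 * (rho t + 1 / res_root t ^ 4) * (local_size l t)\<^sup>2"
    using F_power4 F \<alpha> rho_pos[of t] res_root(1)[of t] by (intro mult_mono) auto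
  finally show ?thesis using d unfolding C2_def by blast
qed

text \<open>Every remaining term is O(\<open>rho\<close>), except the one from the derivative of
  \<open>angle\<close>. That one is not small compared with \<open>rho\<close> near the resonance
  and is the reason for the additional rate \<open>1 / res_root t ^ 4\<close>.\<close>

lemma mode_energy_deriv_res:
  assumes t: "tres \<xi> k < t" "t < tres \<xi> (k - 1)"
  shows "\<exists>D. (mode_energy (int k) has_real_derivative D) (at t) \<and> D \<le> C2 * (rho t + 1 / res_root t ^ 4) * (local_size (int k) t)\<^sup>2"
proof -
  note tI = interior_I[OF t]
  define n where "n = local_size (int k) t"
  define z q p h where "z = Z t (int k)" and "q = Q t (int k)" and "p = resonant_forcing t" and "h = forcing_Q (int k) t"
  have n: "0 \<le> n" using local_size_nonneg by (simp add: n_def)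
  have zq: "cmod z \<le> n" "cmod q \<le> n"
    using mode_k[of "int k" t] norm_ge_zero[of "Z t (int k)"] norm_ge_zero[of "Q t (int k)"] unfolding n_def z_def q_def by linarith+
  have rho: "0 < rho t" by (rule rho_pos)
  have j: "1 \<le> res_root t" by (rule res_root)
  have a: "adjacent (int k - 1)" "adjacent (int k + 1)" by (auto simp: adjacent_def)
  have "cmod p \<le> 7 * F * rho t * cmod (shifted_Z (int k - 1) t) + 7 * F * rho t * cmod (shifted_Z (int k + 1) t)"
    unfolding p_def resonant_forcing_def norm_mult norm_ii mult_1_left
    by (intro norm_triangle_mono norm_scaleR_le order_refl coefficients_to_k[OF tI] a)
  also have "\<dots> \<le> 7 * F * rho t * n"
  proof -
    have "cmod (shifted_Z (int k - 1) t) + cmod (shifted_Z (int k + 1) t) \<le> n"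
      using local_size_mem2[of "int k - 1" "int k" "int k + 1" t]
        norm_ge_zero[of "shifted_Q (int k - 1) t"] norm_ge_zero[of "shifted_Q (int k + 1) t"]
      unfolding n_def by linarith
    then show ?thesis
      unfolding distrib_left[symmetric] using F rho by (intro mult_left_mono) auto
  qed
  finally have p: "cmod p \<le> 7 * F * rho t * n" .
  have "cmod h \<le> 4 * F * (inv_width / theta t) * neighbour_size t"
    unfolding h_def by (rule forcing_Q_k_bound[OF tI])
  also have "\<dots> \<le> 4 * F * (2 * inv_width) * neighbour_size t"
    using inv_width_over_theta[OF tI] F by (intro mult_right_mono mult_left_mono) (auto simp: neighbour_size_def)
  also have "\<dots> = 8 * F * (inv_width * neighbour_size t)" by simp
  also have "\<dots> \<le> 8 * F * (4 * (3 * F * rho t * n))"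
    unfolding n_def using neighbour_size_bound[OF tI, of "int k"] F by (intro mult_left_mono) auto
  finally have h: "cmod h \<le> 96 * F\<^sup>2 * rho t * n" by (simp add: power2_eq_square)
  have ip: "x \<bullet> y \<le> b * n\<^sup>2" "- (x \<bullet> y) \<le> b * n\<^sup>2" if "cmod x \<le> n" "cmod y \<le> b * n" for x y :: complex and b
  proof -
    have "\<bar>x \<bullet> y\<bar> \<le> cmod x * cmod y" by (rule Cauchy_Schwarz_ineq2)
    also have "\<dots> \<le> n * (b * n)" using that n by (intro mult_mono) auto
    finally show "x \<bullet> y \<le> b * n\<^sup>2" "- (x \<bullet> y) \<le> b * n\<^sup>2" by (auto simp: power2_eq_square mult_ac)
  qed
  have inv: "0 < 1 / sqrt \<alpha>" "1 / sqrt \<alpha> \<le> 2" "1 / \<alpha> \<le> 4" "0 < 1 / \<alpha>"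
    using sqrt_alpha \<alpha> by (auto simp: divide_le_eq)
  have d: "0 \<le> 1 + alpha_shift t / \<alpha>" "1 + alpha_shift t / \<alpha> \<le> 37 * F\<^sup>2"
  proof -
    show "0 \<le> 1 + alpha_shift t / \<alpha>" using alpha_shift_bound[OF tI] \<alpha> by simp
    have "alpha_shift t / \<alpha> \<le> 9 * F\<^sup>2 / (1 / 4)"
      using alpha_shift_bound[OF tI] \<alpha> by (intro frac_le) auto
    then show "1 + alpha_shift t / \<alpha> \<le> 37 * F\<^sup>2" using F_powers by simp
  qed
  have t1: "2 * (z \<bullet> p) \<le> 14 * F * rho t * n\<^sup>2"
    using ip(1)[OF zq(1) p] by simp
  have t2: "2 * (1 + alpha_shift t / \<alpha>) * (q \<bullet> h) \<le> 2 * (37 * F\<^sup>2) * (96 * F\<^sup>2 * rho t * n\<^sup>2)"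
  proof -
    have "2 * (1 + alpha_shift t / \<alpha>) * (q \<bullet> h) \<le> 2 * (1 + alpha_shift t / \<alpha>) * (96 * F\<^sup>2 * rho t * n\<^sup>2)"
      using ip(1)[OF zq(2) h] d by (intro mult_left_mono) auto
    also have "\<dots> \<le> 2 * (37 * F\<^sup>2) * (96 * F\<^sup>2 * rho t * n\<^sup>2)"
      using d rho by (intro mult_right_mono mult_left_mono) auto
    finally show ?thesis .
  qed
  have t3: "alpha_shift' t / \<alpha> * (q \<bullet> q) \<le> 1200 * F\<^sup>2 * rho t * n\<^sup>2"
  proof -
    have "alpha_shift' t * (1 / \<alpha>) * (q \<bullet> q) \<le> 300 * F\<^sup>2 * rho t * 4 * n\<^sup>2"
      using alpha_shift_bound(3)[OF tI] inv zq(2) rho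
      by (intro mult_mono) (auto simp: power2_norm_eq_inner[symmetric] intro!: power_mono)
    then show ?thesis by simp
  qed
  have t4: "- (angle t / sqrt \<alpha> * (z \<bullet> h + p \<bullet> q)) \<le> 2 * (96 * F\<^sup>2 * rho t * n\<^sup>2 + 7 * F * rho t * n\<^sup>2)"
  proof -
    have "\<bar>z \<bullet> h + p \<bullet> q\<bar> \<le> 96 * F\<^sup>2 * rho t * n\<^sup>2 + 7 * F * rho t * n\<^sup>2"
      using ip[OF zq(1) h] ip[OF zq(2) p] by (simp add: abs_le_iff inner_commute[of p])
    then have "\<bar>angle t\<bar> * (1 / sqrt \<alpha>) * \<bar>z \<bullet> h + p \<bullet> q\<bar> \<le> 1 * 2 * (96 * F\<^sup>2 * rho t * n\<^sup>2 + 7 * F * rho t * n\<^sup>2)"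
      using angle(1)[of t] inv by (intro mult_mono) auto
    then show ?thesis
      using \<alpha> abs_ge_minus_self[of "angle t / sqrt \<alpha> * (z \<bullet> h + p \<bullet> q)"] by (simp add: abs_mult abs_divide)
  qed
  have t5: "1 / res_root t ^ 6 / sqrt \<alpha> * (z \<bullet> q) \<le> 2 * (1 / res_root t ^ 4) * n\<^sup>2"
  proof -
    have "1 / res_root t ^ 6 \<le> 1 / res_root t ^ 4"
    proof (rule divide_left_mono)
      show "res_root t ^ 4 \<le> res_root t ^ 6" using j by (intro power_increasing) auto
      have "0 < res_root t" using j by linarith
      then show "0 < res_root t ^ 6 * res_root t ^ 4" by (intro mult_pos_pos zero_less_power)
    qed simp
    then have "1 / res_root t ^ 6 * (1 / sqrt \<alpha>) \<le> 1 / res_root t ^ 4 * 2"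
      using inv j by (intro mult_mono) auto
    then have "1 / res_root t ^ 6 * (1 / sqrt \<alpha>) * n\<^sup>2 \<le> 1 / res_root t ^ 4 * 2 * n\<^sup>2"
      by (rule mult_right_mono) simp
    moreover have "1 / res_root t ^ 6 * (1 / sqrt \<alpha>) * (z \<bullet> q) \<le> 1 / res_root t ^ 6 * (1 / sqrt \<alpha>) * n\<^sup>2"
    proof (rule mult_left_mono)
      show "z \<bullet> q \<le> n\<^sup>2" using ip(1)[OF zq(1), of q 1] zq(2) by simp
    qed (use inv j in auto)
    ultimately have "1 / res_root t ^ 6 * (1 / sqrt \<alpha>) * (z \<bullet> q) \<le> 1 / res_root t ^ 4 * 2 * n\<^sup>2"
      by (rule order_trans[rotated])
    then show ?thesis by simp
  qed
  let ?D = "2 * (z \<bullet> p) + 2 * (1 + alpha_shift t / \<alpha>) * (q \<bullet> h) + alpha_shift' t / \<alpha> * (q \<bullet> q)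
     - angle t / sqrt \<alpha> * (z \<bullet> h + p \<bullet> q) + 1 / res_root t ^ 6 / sqrt \<alpha> * (z \<bullet> q)"
  \<comment> \<open>28 = 14 + 14, 7104 = 2 * 37 * 96 and 1392 = 1200 + 192; their sum 8524 explains
    the 9000 in \<open>C2\<close>.\<close>
  have "?D \<le> (28 * F + 7104 * (F\<^sup>2 * F\<^sup>2) + 1392 * F\<^sup>2) * (rho t * n\<^sup>2) + 2 * (1 / res_root t ^ 4 * n\<^sup>2)"
  proof -
    define N V where "N = rho t * n\<^sup>2" and "V = 1 / res_root t ^ 4 * n\<^sup>2"
    have "(28 * F + 7104 * (F\<^sup>2 * F\<^sup>2) + 1392 * F\<^sup>2) * N + 2 * V
        = 14 * (F * N) + 2 * (37 * F\<^sup>2 * (96 * (F\<^sup>2 * N))) + 1200 * (F\<^sup>2 * N)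
          + 2 * (96 * (F\<^sup>2 * N) + 7 * (F * N)) + 2 * V"
      by (simp add: algebra_simps)
    with t1 t2 t3 t4 t5 show ?thesis
      unfolding mult.assoc N_def[symmetric] V_def[symmetric] by linarith
  qed
  also have "\<dots> \<le> C2 * (rho t * n\<^sup>2) + C2 * (1 / res_root t ^ 4 * n\<^sup>2)"
  proof (intro add_mono mult_right_mono)
    have "1 * F ^ 4 \<le> (1 + \<alpha>) * F ^ 4"
      using \<alpha> by (intro mult_right_mono) auto
    then have C2: "9000 * F ^ 4 \<le> C2" unfolding C2_def by linarith
    have "28 * F + 7104 * (F\<^sup>2 * F\<^sup>2) + 1392 * F\<^sup>2 \<le> 9000 * F ^ 4"
      using F_power4 by (simp flip: power_add)
    with C2 show "28 * F + 7104 * (F\<^sup>2 * F\<^sup>2) + 1392 * F\<^sup>2 \<le> C2" by simp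
    show "2 \<le> C2" using C2 F_power4(3) by simp
  qed (use rho j in auto)
  also have "\<dots> = C2 * (rho t + 1 / res_root t ^ 4) * n\<^sup>2"
    by (simp add: algebra_simps)
  finally have "?D \<le> C2 * (rho t + 1 / res_root t ^ 4) * n\<^sup>2" .
  moreover have "mode_energy (int k) = resonant_energy" by (simp add: mode_energy_def fun_eq_iff)
  ultimately show ?thesis
    using resonant_energy_deriv[OF t] unfolding z_def q_def p_def h_def n_def by auto
qed

lemma mode_energy_deriv:
  assumes t: "tres \<xi> k < t" "t < tres \<xi> (k - 1)"
  shows "\<exists>D. (mode_energy l has_real_derivative D) (at t) \<and>
    D \<le> 10 * C2 / c0 * growth_weight' t * (\<Sum>j\<in>{-2..2}. mode_energy (l + j) t)"
proof -
  obtain D where D: "(mode_energy l has_real_derivative D) (at t)" "D \<le> C2 * (rho t + 1 / res_root t ^ 4) * (local_size l t)\<^sup>2"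
    using mode_energy_deriv_nonres[OF t, of l] mode_energy_deriv_res[OF t] by (cases "l = int k") blast+
  have C2: "0 \<le> C2" using \<alpha> F by (simp add: C2_def)
  note D(2)
  also have "C2 * (rho t + 1 / res_root t ^ 4) * (local_size l t)\<^sup>2 \<le> C2 * growth_weight' t * (10 * (\<Sum>j\<in>{-2..2}. mode_sq (l + j) t))"
    using C2 growth_weight'_ge[of t] growth_weight'_nonneg[of t] local_size_sq[of l t] by (intro mult_mono mult_left_mono) auto
  also have "(\<Sum>j\<in>{-2..2}. mode_sq (l + j) t) \<le> (\<Sum>j\<in>{-2..2}. mode_energy (l + j) t / c0)"
  proof (rule sum_mono)
    show "mode_sq (l + j) t \<le> mode_energy (l + j) t / c0" for j
      using mode_energy_bounds(1)[OF interior_I[OF t], of "l + j"] c0(1) by (simp add: le_divide_eq mult.commute)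
  qed
  finally have "D \<le> C2 * growth_weight' t * (10 * (\<Sum>j\<in>{-2..2}. mode_energy (l + j) t / c0))"
    using C2 growth_weight'_nonneg[of t] by (simp add: mult_left_mono)
  also have "\<dots> = 10 * C2 / c0 * growth_weight' t * (\<Sum>j\<in>{-2..2}. mode_energy (l + j) t)"
    by (simp flip: sum_divide_distrib)
  finally show ?thesis using D(1) by blast
qed

section \<open>Continuity, summation over the modes and Gronwall\<close>

lemma l2: "t \<in> I \<Longrightarrow> in_l2 (Z t) (Q t)"
  using solution by (simp add: boussinesq_solution_def I_def)

lemma curve_continuous:
  shows "continuous_on I (\<lambda>t. l2_norm (Z t) (Q t))"
    and "continuous_on I (\<lambda>t. Z t l)" and "continuous_on I (\<lambda>t. Q t l)"
proof -
  have c: "((\<lambda>s. l2_norm (\<lambda>l. Z s l - Z t l) (\<lambda>l. Q s l - Q t l)) \<longlongrightarrow> 0) (at t within I)" if "t \<in> I" for t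
    using solution that unfolding boussinesq_solution_def I_def by blast
  show "continuous_on I (\<lambda>t. l2_norm (Z t) (Q t))" "continuous_on I (\<lambda>t. Z t l)" "continuous_on I (\<lambda>t. Q t l)"
    by (rule continuous_on_l2_curve[OF l2 c]; assumption)+
qed

lemma coefficients_continuous:
  "continuous_on I (shift_Z l)" "continuous_on I (shift_Q l)" "continuous_on I alpha_shift" "continuous_on I angle"
proof -
  have c: "continuous_on I u" if "\<And>t. t \<in> I \<Longrightarrow> (u has_real_derivative u' t) (at t)" for u u' :: "real \<Rightarrow> real"
    using that by (intro DERIV_continuous_on) (rule has_field_derivative_at_within)
  show "continuous_on I alpha_shift" "continuous_on I angle"
    using c[OF alpha_shift_deriv[OF I_bounds(3)]] c[OF angle_deriv] by auto
  show "continuous_on I (shift_Z l)" "continuous_on I (shift_Q l)"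
  proof -
    have 0: "shift_Z l = (\<lambda>t. 0)" "shift_Q l = (\<lambda>t. 0)" if "\<not> adjacent l"
      using that by (auto simp: shift_Z_def shift_Q_def)
    show "continuous_on I (shift_Z l)" "continuous_on I (shift_Q l)"
      using c[OF shift_Z_deriv[OF I_bounds(3)], of l] c[OF shift_Q_deriv[OF I_bounds(3)], of l] 0
      by (cases "adjacent l"; simp)+
  qed
qed

lemma mode_energy_continuous: "continuous_on I (mode_energy l)"
proof -
  have "continuous_on I (shifted_Z l)" "continuous_on I (shifted_Q l)"
    unfolding shifted_Z_def[abs_def] shifted_Q_def[abs_def]
    by (intro continuous_intros curve_continuous coefficients_continuous)+
  then have "continuous_on I (mode_sq l)"
    unfolding mode_sq_def[abs_def] by (intro continuous_intros)
  moreover have "continuous_on I resonant_energy"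
    unfolding resonant_energy_def[abs_def] using \<alpha>
    by (intro continuous_intros curve_continuous coefficients_continuous) auto
  ultimately show ?thesis
    unfolding mode_energy_def[abs_def] by (cases "l = int k") simp_all
qed

definition "near = {int k - 1, int k, int k + 1}"

lemma mode_sq_eq: "l \<notin> near \<Longrightarrow> mode_sq l t = (cmod (Z t l))\<^sup>2 + (cmod (Q t l))\<^sup>2"
  by (subst (asm) near_def) (auto simp: mode_sq_def shifted_not_adjacent adjacent_def abs_if split: if_splits)

lemma mode_energy_eq: "l \<notin> near \<Longrightarrow> mode_energy l t = (cmod (Z t l))\<^sup>2 + (cmod (Q t l))\<^sup>2"
  using mode_sq_eq[of l t] by (auto simp: mode_energy_def near_def)

lemma base_summable: "t \<in> I \<Longrightarrow> (\<lambda>l. (cmod (Z t l))\<^sup>2 + (cmod (Q t l))\<^sup>2) summable_on UNIV"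
  using l2 by (simp add: in_l2_def)

lemma mode_sq_summable: "t \<in> I \<Longrightarrow> (\<lambda>l. mode_sq l t) summable_on UNIV"
  by (rule infsum_finite_change(1)[where F = near, OF base_summable _ mode_sq_eq]) (auto simp: near_def)

lemma mode_energy_summable: "t \<in> I \<Longrightarrow> (\<lambda>l. mode_energy l t) summable_on UNIV"
  and mode_energy_infsum: "t \<in> I \<Longrightarrow> (\<Sum>\<^sub>\<infinity>l. mode_energy l t) = (l2_norm (Z t) (Q t))\<^sup>2
    + (\<Sum>l\<in>near. mode_energy l t - ((cmod (Z t l))\<^sup>2 + (cmod (Q t l))\<^sup>2))"
proof -
  have fin: "finite near" by (simp add: near_def)
  show "(\<lambda>l. mode_energy l t) summable_on UNIV" if "t \<in> I"
    by (rule infsum_finite_change(1)[OF base_summable[OF that] fin mode_energy_eq])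
  show "(\<Sum>\<^sub>\<infinity>l. mode_energy l t) = (l2_norm (Z t) (Q t))\<^sup>2
      + (\<Sum>l\<in>near. mode_energy l t - ((cmod (Z t l))\<^sup>2 + (cmod (Q t l))\<^sup>2))" if "t \<in> I"
    unfolding l2_norm_sq by (rule infsum_finite_change(2)[OF base_summable[OF that] fin mode_energy_eq])
qed

text \<open>The sum is the squared norm, continuous by the definition of a solution, plus a
  correction from three continuous modes.\<close>

lemma mode_energy_infsum_continuous: "continuous_on I (\<lambda>t. \<Sum>\<^sub>\<infinity>l. mode_energy l t)"
proof -
  have "continuous_on I (\<lambda>t. (l2_norm (Z t) (Q t))\<^sup>2
      + (\<Sum>l\<in>near. mode_energy l t - ((cmod (Z t l))\<^sup>2 + (cmod (Q t l))\<^sup>2)))"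
    by (intro continuous_intros curve_continuous mode_energy_continuous)
  then show ?thesis
    by (subst continuous_on_cong[OF refl mode_energy_infsum])
qed

lemma energy_growth:
  assumes b: "b \<in> I"
  shows "(\<Sum>\<^sub>\<infinity>l. mode_energy l b) \<le> exp (60 * (10 * C2 / c0)) * (\<Sum>\<^sub>\<infinity>l. mode_energy l (tres \<xi> k))"
proof -
  define a where "a = tres \<xi> k"
  have ab: "a \<le> b" "{a..b} \<subseteq> I" "a \<in> I" using b by (auto simp: I_def a_def)
  define c where "c = 10 * C2 / c0"
  have c: "0 \<le> c" using \<alpha> F c0 by (simp add: c_def C2_def)
  define P where "P = (\<lambda>l t D. (mode_energy l has_real_derivative D) (at t) \<and>
      D \<le> c * growth_weight' t * (\<Sum>j\<in>{-2..2}. mode_energy (l + j) t))"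
  \<comment> \<open>A derivative is selected for each mode and time, since its bound is available
    only together with an existence statement.\<close>
  define e' where "e' = (\<lambda>l t. SOME D. P l t D)"
  have "P l t (e' l t)" if "a < t" "t < b" for l t
  proof -
    have "\<exists>D. P l t D"
      unfolding P_def c_def using that b by (intro mode_energy_deriv) (auto simp: a_def I_def)
    then show ?thesis unfolding e'_def by (rule someI_ex)
  qed
  then have e': "(mode_energy l has_real_derivative e' l t) (at t)"
      "e' l t \<le> c * growth_weight' t * (\<Sum>j\<in>{-2..2}. mode_energy (l + j) t)" if "a < t" "t < b" for l t
    using that by (simp_all add: P_def)
  have e0: "0 \<le> mode_energy l t" if "t \<in> I" for l t
    using order_trans[OF mult_nonneg_nonneg[OF less_imp_le[OF c0(1)] mode_sq_nonneg] mode_energy_bounds(1)[OF that]] .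
  have "(\<Sum>\<^sub>\<infinity>l. mode_energy l b) \<le> exp (5 * ((\<lambda>t. c * growth_weight t) b - (\<lambda>t. c * growth_weight t) a)) * (\<Sum>\<^sub>\<infinity>l. mode_energy l a)"
  proof (rule gronwall_lattice_sum[where r = "\<lambda>t. c * growth_weight' t" and e' = e'])
    show "((\<lambda>t. c * growth_weight t) has_real_derivative c * growth_weight' t) (at t within {a..b})" for t
      using DERIV_cmult[OF growth_weight_deriv, of c] by (rule has_field_derivative_at_within)
    show "continuous_on {a..b} (\<lambda>t. c * growth_weight' t)"
      by (intro continuous_intros growth_weight'_continuous)
    show "continuous_on {a..b} (mode_energy l)" for l
      using mode_energy_continuous ab(2) by (rule continuous_on_subset)
    show "continuous_on {a..b} (\<lambda>t. \<Sum>\<^sub>\<infinity>l. mode_energy l t)"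
      using mode_energy_infsum_continuous ab(2) by (rule continuous_on_subset)
    show "0 \<le> c * growth_weight' t" for t using c growth_weight'_nonneg by simp
  qed (use ab e' e0 mode_energy_summable in auto)
  also have "\<dots> \<le> exp (60 * c) * (\<Sum>\<^sub>\<infinity>l. mode_energy l a)"
  proof (intro mult_right_mono)
    have "growth_weight b - growth_weight a \<le> 12"
      using growth_weight_bound[OF b] growth_weight_bound[OF ab(3)] by linarith
    then have "c * (growth_weight b - growth_weight a) \<le> c * 12"
      using c by (rule mult_left_mono)
    then show "exp (5 * ((\<lambda>t. c * growth_weight t) b - (\<lambda>t. c * growth_weight t) a)) \<le> exp (60 * c)"
      by (simp add: right_diff_distrib)
    show "0 \<le> (\<Sum>\<^sub>\<infinity>l. mode_energy l a)"
      using e0[OF ab(3)] by (rule infsum_nonneg)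
  qed
  finally show ?thesis by (simp add: c_def a_def)
qed

text \<open>The shift adds multiples of Q_k to the two neighbours of k and leaves Q_k itself
  unchanged, so its inverse has the same form with opposite sign and both directions share one
  constant.\<close>

lemma norm_comparison:
  assumes t: "t \<in> I" and K: "3 * F * (\<epsilon> * sh) * theta t \<le> K"
  shows "(l2_norm (Z t) (Q t))\<^sup>2 \<le> (2 + 8 * K\<^sup>2) * (\<Sum>\<^sub>\<infinity>l. mode_sq l t)"
    and "(\<Sum>\<^sub>\<infinity>l. mode_sq l t) \<le> (2 + 8 * K\<^sup>2) * (l2_norm (Z t) (Q t))\<^sup>2"
proof -
  have b: "\<bar>shift_Z l t\<bar> \<le> K" "\<bar>shift_Q l t\<bar> \<le> K" "0 \<le> K" for l
    using shift_bound[OF t, of l] K abs_ge_zero[of "shift_Z l t"] by linarith+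
  define p where "p = cmod (Q t (int k))"
  have p: "p\<^sup>2 \<le> mode_sq (int k) t" "p\<^sup>2 \<le> (cmod (Z t (int k)))\<^sup>2 + (cmod (Q t (int k)))\<^sup>2"
    by (simp_all add: mode_sq_k p_def)
  have p0: "0 \<le> p" by (simp add: p_def)
  have d: "cmod (Z t l - shifted_Z l t) \<le> K * p" "cmod (Q t l - shifted_Q l t) \<le> K * p"
    "cmod (shifted_Z l t - Z t l) \<le> K * p" "cmod (shifted_Q l t - Q t l) \<le> K * p" for l
    using mult_right_mono[OF b(1) p0, of l] mult_right_mono[OF b(2) p0, of l]
    by (auto simp: shifted_Z_def shifted_Q_def norm_mult p_def)
  have adj1: "(cmod (Z t l))\<^sup>2 + (cmod (Q t l))\<^sup>2 \<le> 2 * mode_sq l t + 4 * K\<^sup>2 * p\<^sup>2"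
    and adj2: "mode_sq l t \<le> 2 * ((cmod (Z t l))\<^sup>2 + (cmod (Q t l))\<^sup>2) + 4 * K\<^sup>2 * p\<^sup>2" for l
    using sq_sum_le[OF d(1) b(3), of l] sq_sum_le[OF d(2) b(3), of l]
      sq_sum_le[OF d(3) b(3), of l] sq_sum_le[OF d(4) b(3), of l]
    by (auto simp: mode_sq_def)
  have pK: "4 * K\<^sup>2 * p\<^sup>2 \<le> 4 * K\<^sup>2 * mode_sq (int k) t"
    "4 * K\<^sup>2 * p\<^sup>2 \<le> 4 * K\<^sup>2 * ((cmod (Z t (int k)))\<^sup>2 + (cmod (Q t (int k)))\<^sup>2)"
    using p by (auto intro!: mult_left_mono)
  show "(l2_norm (Z t) (Q t))\<^sup>2 \<le> (2 + 8 * K\<^sup>2) * (\<Sum>\<^sub>\<infinity>l. mode_sq l t)"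
    unfolding l2_norm_sq
  proof (rule infsum_adjacent_compare[OF mode_sq_summable[OF t] base_summable[OF t] mode_sq_nonneg])
    show "(cmod (Z t l))\<^sup>2 + (cmod (Q t l))\<^sup>2 \<le> 2 * mode_sq l t + (if adjacent l then 4 * K\<^sup>2 * mode_sq (int k) t else 0)" for l
    proof (cases "adjacent l")
      case True
      then show ?thesis using adj1[of l] pK(1) by simp
    next
      case False
      then have "mode_sq l t = (cmod (Z t l))\<^sup>2 + (cmod (Q t l))\<^sup>2" by (simp add: mode_sq_def shifted_not_adjacent)
      then show ?thesis using False by simp
    qed
  qed
  show "(\<Sum>\<^sub>\<infinity>l. mode_sq l t) \<le> (2 + 8 * K\<^sup>2) * (l2_norm (Z t) (Q t))\<^sup>2"
    unfolding l2_norm_sq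
  proof (rule infsum_adjacent_compare[OF base_summable[OF t] mode_sq_summable[OF t]])
    show "mode_sq l t \<le> 2 * ((cmod (Z t l))\<^sup>2 + (cmod (Q t l))\<^sup>2)
      + (if adjacent l then 4 * K\<^sup>2 * ((cmod (Z t (int k)))\<^sup>2 + (cmod (Q t (int k)))\<^sup>2) else 0)" for l
    proof (cases "adjacent l")
      case True
      then show ?thesis using adj2[of l] pK(2) by simp
    next
      case False
      then have "mode_sq l t = (cmod (Z t l))\<^sup>2 + (cmod (Q t l))\<^sup>2" by (simp add: mode_sq_def shifted_not_adjacent)
      then show ?thesis using False by simp
    qed
  qed simp
qed

text \<open>The comparison of norms is applied with K = 6 F at t_k and with K = 3 F X at the final
  time, so X enters the estimate for the norm only to the first power.\<close>

lemma solution_growth: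
  assumes b: "b \<in> I"
  shows "l2_norm (Z b) (Q b) \<le> growth_const \<alpha> F * growth_factor * l2_norm (Z (tres \<xi> k)) (Q (tres \<xi> k))"
proof -
  define a where "a = tres \<xi> k"
  define na nb where "na = l2_norm (Z a) (Q a)" and "nb = l2_norm (Z b) (Q b)"
  define G where "G = exp (60 * (10 * C2 / c0))"
  have a: "a \<in> I" using b by (auto simp: I_def a_def)
  have es: "0 \<le> \<epsilon> * sh" using \<epsilon> sh by simp
  have Kb: "3 * F * (\<epsilon> * sh) * theta b \<le> 3 * F * growth_factor"
  proof -
    have "3 * F * (\<epsilon> * sh) * theta b \<le> 3 * F * (\<epsilon> * sh) * (sh / sk)"
      using theta_le F es by (intro mult_left_mono) auto
    then show ?thesis by (simp add: growth_factor_def power2_eq_square)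
  qed
  have Ka: "3 * F * (\<epsilon> * sh) * theta a \<le> 6 * F"
  proof -
    have "3 * F * (\<epsilon> * sh) * theta a \<le> 3 * F * 1 * 2"
      using theta_start eps_sh F es theta_pos[of a] unfolding a_def by (intro mult_mono) auto
    then show ?thesis by simp
  qed
  have X2: "1 \<le> growth_factor\<^sup>2" using growth_factor_ge_1 by simp
  have FX: "1 * 1 \<le> F\<^sup>2 * growth_factor\<^sup>2" using F_powers X2 by (intro mult_mono) auto
  have sums: "0 \<le> (\<Sum>\<^sub>\<infinity>l. mode_sq l t)" for t by (intro infsum_nonneg mode_sq_nonneg)
  have "nb\<^sup>2 \<le> (2 + 8 * (3 * F * growth_factor)\<^sup>2) * (\<Sum>\<^sub>\<infinity>l. mode_sq l b)"
    unfolding nb_def by (rule norm_comparison[OF b Kb])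
  also have "\<dots> \<le> 74 * F\<^sup>2 * growth_factor\<^sup>2 * (\<Sum>\<^sub>\<infinity>l. mode_sq l b)"
    using FX sums by (intro mult_right_mono) (auto simp: power_mult_distrib)
  finally have h1: "nb\<^sup>2 \<le> 74 * F\<^sup>2 * growth_factor\<^sup>2 * (\<Sum>\<^sub>\<infinity>l. mode_sq l b)" .
  have "(\<Sum>\<^sub>\<infinity>l. mode_sq l b) \<le> (\<Sum>\<^sub>\<infinity>l. 1 / c0 * mode_energy l b)"
  proof (rule infsum_mono)
    show "mode_sq l b \<le> 1 / c0 * mode_energy l b" for l
      using mode_energy_bounds(1)[OF b, of l] c0(1) by (simp add: le_divide_eq mult.commute)
  qed (intro mode_sq_summable mode_energy_summable summable_on_cmult_right b)+
  also have "\<dots> = 1 / c0 * (\<Sum>\<^sub>\<infinity>l. mode_energy l b)"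
    by (rule infsum_cmult_right) (rule mode_energy_summable[OF b])
  finally have h2: "(\<Sum>\<^sub>\<infinity>l. mode_sq l b) \<le> 1 / c0 * (\<Sum>\<^sub>\<infinity>l. mode_energy l b)" .
  have "(\<Sum>\<^sub>\<infinity>l. mode_energy l a) \<le> (\<Sum>\<^sub>\<infinity>l. 40 * F\<^sup>2 * mode_sq l a)"
    by (intro infsum_mono mode_energy_bounds(2) mode_energy_summable mode_sq_summable summable_on_cmult_right a)
  also have "\<dots> = 40 * F\<^sup>2 * (\<Sum>\<^sub>\<infinity>l. mode_sq l a)"
    by (rule infsum_cmult_right) (rule mode_sq_summable[OF a])
  finally have h3: "(\<Sum>\<^sub>\<infinity>l. mode_energy l a) \<le> 40 * F\<^sup>2 * (\<Sum>\<^sub>\<infinity>l. mode_sq l a)" .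
  have "(\<Sum>\<^sub>\<infinity>l. mode_sq l a) \<le> (2 + 8 * (6 * F)\<^sup>2) * na\<^sup>2"
    unfolding na_def by (rule norm_comparison[OF a Ka])
  also have "\<dots> \<le> 290 * F\<^sup>2 * na\<^sup>2"
    using F_powers by (intro mult_right_mono) (auto simp: power_mult_distrib)
  finally have h4: "40 * F\<^sup>2 * (\<Sum>\<^sub>\<infinity>l. mode_sq l a) \<le> 40 * F\<^sup>2 * (290 * F\<^sup>2 * na\<^sup>2)"
    by (rule mult_left_mono) simp
  have "(\<Sum>\<^sub>\<infinity>l. mode_energy l b) \<le> G * (\<Sum>\<^sub>\<infinity>l. mode_energy l a)"
    using energy_growth[OF b] unfolding G_def a_def .
  also have "\<dots> \<le> G * (40 * F\<^sup>2 * (290 * F\<^sup>2 * na\<^sup>2))"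
    using order_trans[OF h3 h4] by (rule mult_left_mono) (simp add: G_def)
  finally have "1 / c0 * (\<Sum>\<^sub>\<infinity>l. mode_energy l b) \<le> 1 / c0 * (G * (40 * F\<^sup>2 * (290 * F\<^sup>2 * na\<^sup>2)))"
    by (rule mult_left_mono) (use c0 in simp)
  from order_trans[OF h2 this]
  have "74 * F\<^sup>2 * growth_factor\<^sup>2 * (\<Sum>\<^sub>\<infinity>l. mode_sq l b) \<le> 74 * F\<^sup>2 * growth_factor\<^sup>2 * (1 / c0 * (G * (40 * F\<^sup>2 * (290 * F\<^sup>2 * na\<^sup>2))))"
    by (rule mult_left_mono) simp
  with h1 have "nb\<^sup>2 \<le> 74 * F\<^sup>2 * growth_factor\<^sup>2 * (1 / c0 * (G * (40 * F\<^sup>2 * (290 * F\<^sup>2 * na\<^sup>2))))"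
    by (rule order_trans)
  also have "\<dots> = (74 * F\<^sup>2 * (290 * F\<^sup>2) * (40 * F\<^sup>2) / c0 * G) * (growth_factor * na)\<^sup>2"
    by (simp add: power_mult_distrib mult_ac)
  also have "\<dots> = (growth_const \<alpha> F * (growth_factor * na))\<^sup>2"
    unfolding growth_const_def G_def C2_def c0_def[symmetric] Let_def power_mult_distrib[of "sqrt _"]
    using c0 F by (subst real_sqrt_pow2) (auto simp: power_mult_distrib)
  finally have "nb \<le> growth_const \<alpha> F * (growth_factor * na)"
  proof (rule power2_le_imp_le)
    have "0 \<le> growth_const \<alpha> F"
      unfolding growth_const_def c0_def[symmetric] Let_def using c0 F by simp
    then show "0 \<le> growth_const \<alpha> F * (growth_factor * na)"
      using growth_factor_ge_1 l2_norm_nonneg by (simp add: na_def)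
  qed
  then show ?thesis by (simp add: na_def nb_def a_def mult.assoc)
qed

end

theorem proposition4p2:
  fixes \<alpha> :: real
  assumes "\<alpha> > 1 / 4"
  shows "\<exists>C>0. \<forall>\<delta>. 0 < \<delta> \<and> \<delta> < 1 / 10 \<longrightarrow>
    (\<exists>\<gamma>. 0 < \<gamma> \<and> \<gamma> < \<delta> \<and>
      (\<forall>(\<epsilon>::real) (\<xi>::real) (f::real \<Rightarrow> real) (g::real \<Rightarrow> real) (k::nat)
         (Z::real \<Rightarrow> modes) (Q::real \<Rightarrow> modes).
         0 < \<epsilon> \<and> \<epsilon> < \<delta> \<and> 0 < \<xi> \<and> \<xi> < 1 / \<epsilon> ^ 4 \<and>
         wave_coefficients \<alpha> \<epsilon> f g \<and>
         1 \<le> k \<and> k \<le> k0 \<epsilon> \<xi> \<and>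
         boussinesq_solution \<alpha> f g \<xi> (tres \<xi> k) (tres \<xi> (k - 1)) Z Q \<longrightarrow>
         (\<forall>t\<in>{tres \<xi> k..tres \<xi> (k - 1)}. t \<le> \<delta>\<^sup>2 / \<epsilon>\<^sup>2 \<longrightarrow>
            l2_norm (Z t) (Q t)
              \<le> C * \<epsilon> * (\<xi> / real k) powr (1 / 2) * (\<xi> / (real k)\<^sup>2) powr (1 / 2 + \<gamma>)
                 * l2_norm (Z (tres \<xi> k)) (Q (tres \<xi> k)))))"
proof -
  obtain F where F: "F \<ge> 1" and Fb:
    "\<And>\<epsilon> f g \<eta> t. \<lbrakk>0 < \<epsilon>; wave_coefficients \<alpha> \<epsilon> f g; 1 \<le> \<eta>; 3 / 4 * \<eta> \<le> t; t \<le> 2 * \<eta>\<rbrakk>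
      \<Longrightarrow> \<bar>f t\<bar> \<le> F * \<epsilon> * sqrt \<eta> \<and> \<bar>g t\<bar> \<le> F * \<epsilon> / sqrt \<eta>"
    using wave_coefficients_bound[OF assms] by metis
  \<comment> \<open>The maximum with 1 guarantees positivity.\<close>
  define C where "C = max 1 (growth_const \<alpha> F)"
  have C: "0 < C" "growth_const \<alpha> F \<le> C" by (auto simp: C_def)
  show ?thesis
  proof (rule exI[of _ C], rule conjI, rule C(1), intro allI impI)
    fix \<delta> :: real assume \<delta>: "0 < \<delta> \<and> \<delta> < 1 / 10"
    show "\<exists>\<gamma>. 0 < \<gamma> \<and> \<gamma> < \<delta> \<and>
      (\<forall>(\<epsilon>::real) (\<xi>::real) (f::real \<Rightarrow> real) (g::real \<Rightarrow> real) (k::nat)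
         (Z::real \<Rightarrow> modes) (Q::real \<Rightarrow> modes).
         0 < \<epsilon> \<and> \<epsilon> < \<delta> \<and> 0 < \<xi> \<and> \<xi> < 1 / \<epsilon> ^ 4 \<and>
         wave_coefficients \<alpha> \<epsilon> f g \<and>
         1 \<le> k \<and> k \<le> k0 \<epsilon> \<xi> \<and>
         boussinesq_solution \<alpha> f g \<xi> (tres \<xi> k) (tres \<xi> (k - 1)) Z Q \<longrightarrow>
         (\<forall>t\<in>{tres \<xi> k..tres \<xi> (k - 1)}. t \<le> \<delta>\<^sup>2 / \<epsilon>\<^sup>2 \<longrightarrow>
            l2_norm (Z t) (Q t)
              \<le> C * \<epsilon> * (\<xi> / real k) powr (1 / 2) * (\<xi> / (real k)\<^sup>2) powr (1 / 2 + \<gamma>)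
                 * l2_norm (Z (tres \<xi> k)) (Q (tres \<xi> k))))"
    \<comment> \<open>Since \<xi> / k^2 \<ge> 1, the power is monotone in its exponent and \<delta>
      / 2 is one admissible choice in the open interval from 0 to \<delta>.\<close>
    proof (intro exI[of _ "\<delta> / 2"] conjI allI impI ballI)
      fix \<epsilon> \<xi> :: real and f g :: "real \<Rightarrow> real" and k :: nat and Z Q :: "real \<Rightarrow> modes" and t :: real
      assume *: "0 < \<epsilon> \<and> \<epsilon> < \<delta> \<and> 0 < \<xi> \<and> \<xi> < 1 / \<epsilon> ^ 4 \<and>
         wave_coefficients \<alpha> \<epsilon> f g \<and> 1 \<le> k \<and> k \<le> k0 \<epsilon> \<xi> \<and>
         boussinesq_solution \<alpha> f g \<xi> (tres \<xi> k) (tres \<xi> (k - 1)) Z Q"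
        and t: "t \<in> {tres \<xi> k..tres \<xi> (k - 1)}" "t \<le> \<delta>\<^sup>2 / \<epsilon>\<^sup>2"
      have \<epsilon>: "0 < \<epsilon>" and \<xi>: "0 < \<xi>" and k: "1 \<le> k" using * by auto
      have k3: "real k ^ 3 \<le> (\<epsilon> * \<xi>)\<^sup>2" using * by (intro k0_bound) auto
      define \<eta> where "\<eta> = \<xi> / real k"
      have \<eta>: "0 < \<eta>" "\<xi> = \<eta> * real k" using \<xi> k by (auto simp: \<eta>_def)
      \<comment> \<open>Any admissible t is at least t_k \<ge> 3/4 \<eta>; together with \<delta> <
        1/10 this gives \<epsilon>^2 \<eta> \<le> 4/3 * 1/100 = 1/75.\<close>
      have "3 / 4 * \<eta> \<le> tres \<xi> k"
        unfolding \<eta>_def using \<xi> k by (rule tres_lower)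
      then have "3 / 4 * \<eta> \<le> \<delta>\<^sup>2 / \<epsilon>\<^sup>2"
        using t unfolding atLeastAtMost_iff by linarith
      then have "3 / 4 * \<eta> * \<epsilon>\<^sup>2 \<le> \<delta>\<^sup>2"
        using \<epsilon> by (simp add: field_simps)
      moreover have "\<delta>\<^sup>2 \<le> (1 / 10)\<^sup>2"
        using \<delta> by (intro power_mono) auto
      ultimately have small: "\<epsilon>\<^sup>2 * \<eta> \<le> 1 / 75"
        by (simp add: power_divide mult.commute)
      have "real k ^ 3 \<le> \<epsilon>\<^sup>2 * \<eta> * (\<eta> * (real k)\<^sup>2)"
        using k3 by (simp add: \<eta>(2) power_mult_distrib power2_eq_square mult_ac)
      also have "\<dots> \<le> 1 / 75 * (\<eta> * (real k)\<^sup>2)"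
        using small \<eta> by (intro mult_right_mono) auto
      finally have "real k * (real k)\<^sup>2 \<le> (\<eta> / 75) * (real k)\<^sup>2"
        by (simp add: power_numeral_reduce)
      then have k\<eta>: "75 * real k \<le> \<eta>"
        using k by simp
      then have \<eta>1: "1 \<le> \<eta>" using k by linarith
      interpret resonant_solution \<alpha> \<epsilon> \<xi> F f g k Z Q
        using * assms F k3 small Fb[of \<epsilon> f g \<eta>] \<eta>1 by unfold_locales (auto simp: \<eta>_def)
      have I: "t \<in> I" using t by (simp add: I_def)
      define n where "n = l2_norm (Z (tres \<xi> k)) (Q (tres \<xi> k))"
      have n: "0 \<le> n" by (simp add: n_def l2_norm_nonneg)
      have T: "1 \<le> \<xi> / (real k)\<^sup>2"
      proof -
        have "real k \<le> \<eta>" using k\<eta> by linarith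
        then have "1 \<le> \<eta> / real k" using k by simp
        then show ?thesis by (simp add: \<eta>_def power2_eq_square)
      qed
      have "sqrt (\<xi> / (real k)\<^sup>2) = sh / sk"
        by (simp add: sh_def sk_def power2_eq_square flip: real_sqrt_divide)
      then have "growth_factor = \<epsilon> * sqrt (\<xi> / real k) * sqrt (\<xi> / (real k)\<^sup>2)"
        by (simp add: growth_factor_def power2_eq_square flip: sh_def)
      also have "sqrt (\<xi> / (real k)\<^sup>2) = (\<xi> / (real k)\<^sup>2) powr (1 / 2)"
        using T by (simp add: powr_half_sqrt)
      also have "sqrt (\<xi> / real k) = (\<xi> / real k) powr (1 / 2)"
        using k \<xi> by (simp add: powr_half_sqrt)
      finally have growth_factor: "growth_factor = \<epsilon> * (\<xi> / real k) powr (1 / 2) * (\<xi> / (real k)\<^sup>2) powr (1 / 2)" .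
      have "l2_norm (Z t) (Q t) \<le> growth_const \<alpha> F * growth_factor * n"
        unfolding n_def by (rule solution_growth[OF I])
      also have "\<dots> \<le> C * growth_factor * n"
        using C growth_factor_ge_1 n by (intro mult_right_mono) auto
      also have "\<dots> \<le> C * (\<epsilon> * (\<xi> / real k) powr (1 / 2) * (\<xi> / (real k)\<^sup>2) powr (1 / 2 + \<delta> / 2)) * n"
        unfolding growth_factor using C \<epsilon> n T \<delta> by (intro mult_right_mono mult_left_mono powr_mono) auto
      finally show "l2_norm (Z t) (Q t)
          \<le> C * \<epsilon> * (\<xi> / real k) powr (1 / 2) * (\<xi> / (real k)\<^sup>2) powr (1 / 2 + \<delta> / 2)
             * l2_norm (Z (tres \<xi> k)) (Q (tres \<xi> k))"
        by (simp add: n_def mult_ac)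
    qed (use \<delta> in auto)
  qed
qed

end
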